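(* Let $X$ be a paracompact space and let $X_n$, $n<\omega$, be closed subsets of $X$ with $\dim(X_n)\le n$ for every $n<\omega$. Let $Y$ be a countable product of Banach spaces, let $\varphi:X\to\mathcal{F}_c(Y)$ be a lower semi-continuous mapping, and let $\psi_n:X\to\mathcal{P}(Y)$, $n<\omega$, be a sequence of mappings such that each $\psi_n$ has an $F_\sigma$-graph and $\psi_n(x)\cap\varphi(x)$ is a $\sigma Z_n$-set in $\varphi(x)$ for every $x\in X_n$ and $n<\omega$. Then the set $$\{f\in\mathrm{Sel}(\varphi): f(x)\notin\psi_n(x)\text{ for every }x\in X_n\text{ and every }n<\omega\}$$ is a dense $G_\delta$-set in $\mathrm{Sel}(\varphi)$ equipped with the fine topology.
   Context: Paracompact spaces are Hausdorff; $\dim$ is covering dimension. $\mathcal{F}_c(Y)$ is the family of all non-empty closed convex subsets of $Y$; $\mathcal{P}(Y)$ is the family of all subsets of $Y$ (including $\emptyset$). $C(X,Y)$ is the set of continuous maps $X\to Y$. A mapping $\varphi:X\to\mathcal{F}_c(Y)$ is lower semi-continuous if $\{x\in X:\varphi(x)\cap U\ne\emptyset\}$ is open in $X$ for every open $U\subset Y$. $\mathrm{Sel}(\varphi)=\{f\in C(X,Y): f(x)\in\varphi(x)\text{ for all }x\in X\}$. For a metrizable space $Z$, a closed (possibly empty) set $F\subset Z$ is a $Z_n$-set in $Z$ if $C(\mathbb{B}^n,Z\setminus F)$ is dense in $C(\mathbb{B}^n,Z)$ with respect to the uniform topology generated by a compatible metric on $Z$, where $\mathbb{B}^n$ is the closed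 $n$-dimensional ball. A $\sigma Z_n$-set in $Z$ is a countable union of $Z_n$-sets in $Z$. A mapping $\psi:X\to\mathcal{P}(Y)$ has an $F_\sigma$-graph if $\{(x,y)\in X\times Y:y\in\psi(x)\}$ is an $F_\sigma$-subset of $X\times Y$. Fix a compatible metric $\rho$ on $Y$. The fine topology on $C(X,Y)$ is the topology with local base at $f$ given by the sets $V(f,\alpha)=\{g\in C(X,Y):\rho(g(x),f(x))<\alpha(x)\text{ for each }x\in X\}$, where $\alpha$ runs over all continuous functions $X\to(0,+\infty)$; for paracompact $X$ it does not depend on the choice of $\rho$. $\mathrm{Sel}(\varphi)$ carries the subspace topology. *)

theory Defs
  imports "HOL-Analysis.Analysis"
begin

section \<open>Paracompactness and covering dimension\<close>

definition open_cover_of :: "'a topology \<Rightarrow> 'a set set \<Rightarrow> bool" where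
  "open_cover_of X \<U> \<longleftrightarrow> (\<forall>U\<in>\<U>. openin X U) \<and> \<Union>\<U> = topspace X"

definition cover_refines :: "'a set set \<Rightarrow> 'a set set \<Rightarrow> bool" where
  "cover_refines \<V> \<U> \<longleftrightarrow> (\<forall>V\<in>\<V>. \<exists>U\<in>\<U>. V \<subseteq> U)"

definition paracompact_space :: "'a topology \<Rightarrow> bool" where
  "paracompact_space X \<longleftrightarrow> Hausdorff_space X \<and>
     (\<forall>\<U>. open_cover_of X \<U> \<longrightarrow>
        (\<exists>\<V>. open_cover_of X \<V> \<and> cover_refines \<V> \<U> \<and> locally_finite_in X \<V>))"

text \<open>The Cech--Lebesgue dimension: \<open>dim X \<le> n\<close> means that every finite open cover has a finite
  open refinement of order at most \<open>n\<close>, i.e. every point is in at most \<open>n + 1\<close> of its members.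
  The empty space (of dimension \<open>-1\<close>) satisfies this for every \<open>n\<close>.\<close>

definition covering_dim_le :: "'a topology \<Rightarrow> nat \<Rightarrow> bool" where
  "covering_dim_le X n \<longleftrightarrow>
     (\<forall>\<U>. finite \<U> \<and> open_cover_of X \<U> \<longrightarrow>
        (\<exists>\<V>. finite \<V> \<and> open_cover_of X \<V> \<and> cover_refines \<V> \<U> \<and>
             (\<forall>x\<in>topspace X. card {V \<in> \<V>. x \<in> V} \<le> n + 1)))"


section \<open>Countable products of Banach spaces\<close>

text \<open>The factors of a product may be different Banach spaces. They are rendered as linear subspaces,
  complete in the norm, of one real normed space \<open>'b\<close>, which itself need not be complete.
  No generality is lost: any family of Banach spaces embeds isometrically in this way, as the
  summands of its algebraic direct sum normed by the sum of the norms.\<close>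

definition banach_subspace :: "'b::real_normed_vector set \<Rightarrow> bool" where
  "banach_subspace E \<longleftrightarrow> subspace E \<and> complete E"

definition prod_space :: "'i set \<Rightarrow> ('i \<Rightarrow> 'b::real_normed_vector set) \<Rightarrow> ('i \<Rightarrow> 'b) topology" where
  "prod_space I E = product_topology (\<lambda>i. top_of_set (E i)) I"

lemma topspace_prod_space: "topspace (prod_space I E) = (\<Pi>\<^sub>E i\<in>I. E i)"
  by (simp add: prod_space_def)

text \<open>The linear structure of the product is the coordinatewise one.\<close>

definition convex_in_prod :: "'i set \<Rightarrow> ('i \<Rightarrow> 'b::real_normed_vector) set \<Rightarrow> bool" where
  "convex_in_prod I C \<longleftrightarrow>
     (\<forall>y\<in>C. \<forall>z\<in>C. \<forall>t\<in>{0..1::real}. (\<lambda>i\<in>I. (1 - t) *\<^sub>R y i + t *\<^sub>R z i) \<in> C)"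

definition closed_convex_sets ::
  "'i set \<Rightarrow> ('i \<Rightarrow> 'b::real_normed_vector set) \<Rightarrow> ('i \<Rightarrow> 'b) set set" where
  "closed_convex_sets I E = {C. C \<noteq> {} \<and> closedin (prod_space I E) C \<and> convex_in_prod I C}"


section \<open>Set-valued mappings and selections\<close>

definition lower_semicontinuous :: "'x topology \<Rightarrow> 'y topology \<Rightarrow> ('x \<Rightarrow> 'y set) \<Rightarrow> bool" where
  "lower_semicontinuous X Y \<phi> \<longleftrightarrow>
     (\<forall>U. openin Y U \<longrightarrow> openin X {x \<in> topspace X. \<phi> x \<inter> U \<noteq> {}})"

definition has_fsigma_graph :: "'x topology \<Rightarrow> 'y topology \<Rightarrow> ('x \<Rightarrow> 'y set) \<Rightarrow> bool" where
  "has_fsigma_graph X Y \<psi> \<longleftrightarrow>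
     fsigma_in (prod_topology X Y) {(x, y). x \<in> topspace X \<and> y \<in> topspace Y \<and> y \<in> \<psi> x}"

text \<open>As in \<^const>\<open>cfunspace\<close>, maps are made extensional so that each continuous map on
  \<open>topspace X\<close> is represented by exactly one function.\<close>

definition cmaps :: "'x topology \<Rightarrow> 'y topology \<Rightarrow> ('x \<Rightarrow> 'y) set" where
  "cmaps X Y = {f \<in> extensional (topspace X). continuous_map X Y f}"

definition selections :: "'x topology \<Rightarrow> 'y topology \<Rightarrow> ('x \<Rightarrow> 'y set) \<Rightarrow> ('x \<Rightarrow> 'y) set" where
  "selections X Y \<phi> = {f \<in> cmaps X Y. \<forall>x\<in>topspace X. f x \<in> \<phi> x}"


section \<open>The fine topology\<close>

definition pos_cmaps :: "'x topology \<Rightarrow> ('x \<Rightarrow> real) set" where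
  "pos_cmaps X = {\<alpha>. continuous_map X euclideanreal \<alpha> \<and> (\<forall>x\<in>topspace X. 0 < \<alpha> x)}"

definition fine_nbhd ::
  "'x topology \<Rightarrow> 'y metric \<Rightarrow> ('x \<Rightarrow> 'y) \<Rightarrow> ('x \<Rightarrow> real) \<Rightarrow> ('x \<Rightarrow> 'y) set" where
  "fine_nbhd X \<rho> f \<alpha> =
     {g \<in> cmaps X (mtopology_of \<rho>). \<forall>x\<in>topspace X. mdist \<rho> (g x) (f x) < \<alpha> x}"

definition fine_topology :: "'x topology \<Rightarrow> 'y metric \<Rightarrow> ('x \<Rightarrow> 'y) topology" where
  "fine_topology X \<rho> = topology (\<lambda>W. W \<subseteq> cmaps X (mtopology_of \<rho>) \<and>
     (\<forall>f\<in>W. \<exists>\<alpha>\<in>pos_cmaps X. fine_nbhd X \<rho> f \<alpha> \<subseteq> W))"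

lemma openin_fine_topology:
  "openin (fine_topology X \<rho>) W \<longleftrightarrow> W \<subseteq> cmaps X (mtopology_of \<rho>) \<and>
     (\<forall>f\<in>W. \<exists>\<alpha>\<in>pos_cmaps X. fine_nbhd X \<rho> f \<alpha> \<subseteq> W)"
proof -
  let ?P = "\<lambda>W. W \<subseteq> cmaps X (mtopology_of \<rho>) \<and>
     (\<forall>f\<in>W. \<exists>\<alpha>\<in>pos_cmaps X. fine_nbhd X \<rho> f \<alpha> \<subseteq> W)"
  have int: "?P (S \<inter> T)" if S: "?P S" and T: "?P T" for S T
  proof (intro conjI ballI)
    show "S \<inter> T \<subseteq> cmaps X (mtopology_of \<rho>)" using S by blast
    fix f assume "f \<in> S \<inter> T"
    then obtain \<alpha> \<beta> where \<alpha>: "\<alpha> \<in> pos_cmaps X" "fine_nbhd X \<rho> f \<alpha> \<subseteq> S"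
      and \<beta>: "\<beta> \<in> pos_cmaps X" "fine_nbhd X \<rho> f \<beta> \<subseteq> T"
      using S T by blast
    have "(\<lambda>x. min (\<alpha> x) (\<beta> x)) \<in> pos_cmaps X"
      using \<alpha>(1) \<beta>(1) by (auto simp: pos_cmaps_def intro: continuous_map_real_min)
    moreover have "fine_nbhd X \<rho> f (\<lambda>x. min (\<alpha> x) (\<beta> x)) \<subseteq> S \<inter> T"
      using \<alpha>(2) \<beta>(2) by (fastforce simp: fine_nbhd_def)
    ultimately show "\<exists>\<alpha>\<in>pos_cmaps X. fine_nbhd X \<rho> f \<alpha> \<subseteq> S \<inter> T" by blast
  qed
  have un: "?P (\<Union>\<K>)" if K: "\<And>S. S \<in> \<K> \<Longrightarrow> ?P S" for \<K>
  proof (intro conjI ballI)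
    show "\<Union>\<K> \<subseteq> cmaps X (mtopology_of \<rho>)" using K by blast
    fix f assume "f \<in> \<Union>\<K>"
    then obtain S where "S \<in> \<K>" "f \<in> S" by blast
    with K[of S] show "\<exists>\<alpha>\<in>pos_cmaps X. fine_nbhd X \<rho> f \<alpha> \<subseteq> \<Union>\<K>" by blast
  qed
  have "istopology ?P"
    unfolding istopology_def
  proof (rule conjI; intro allI impI)
    fix S T assume "?P S" "?P T" then show "?P (S \<inter> T)" by (rule int)
  next
    fix \<K> assume "\<forall>S\<in>\<K>. ?P S" then show "?P (\<Union>\<K>)" by (intro un) (rule bspec)
  qed
  then show ?thesis
    unfolding fine_topology_def by (simp only: topology_inverse')
qed

lemma topspace_fine_topology:
  "topspace (fine_topology X \<rho>) = cmaps X (mtopology_of \<rho>)"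
proof -
  have one: "(\<lambda>x. 1) \<in> pos_cmaps X"
    by (simp add: pos_cmaps_def)
  have "fine_nbhd X \<rho> f (\<lambda>x. 1) \<subseteq> cmaps X (mtopology_of \<rho>)" for f
    unfolding fine_nbhd_def by (rule Collect_restrict)
  then have "openin (fine_topology X \<rho>) (cmaps X (mtopology_of \<rho>))"
    unfolding openin_fine_topology using one by (intro conjI subset_refl ballI bexI)
  moreover have "topspace (fine_topology X \<rho>) \<subseteq> cmaps X (mtopology_of \<rho>)"
    using openin_topspace[of "fine_topology X \<rho>", unfolded openin_fine_topology] by (rule conjunct1)
  ultimately show ?thesis
    by (intro subset_antisym openin_subset)
qed

lemma openin_fine_nbhd:
  assumes "f \<in> cmaps X (mtopology_of \<rho>)" "\<alpha> \<in> pos_cmaps X"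
  shows "openin (fine_topology X \<rho>) (fine_nbhd X \<rho> f \<alpha>)"
  unfolding openin_fine_topology
proof (intro conjI ballI)
  show "fine_nbhd X \<rho> f \<alpha> \<subseteq> cmaps X (mtopology_of \<rho>)"
    unfolding fine_nbhd_def by (rule Collect_restrict)
  fix g assume g: "g \<in> fine_nbhd X \<rho> f \<alpha>"
  then have gc: "g \<in> cmaps X (mtopology_of \<rho>)"
    and gf: "\<And>x. x \<in> topspace X \<Longrightarrow> mdist \<rho> (g x) (f x) < \<alpha> x"
    unfolding fine_nbhd_def by blast+
  have cm: "continuous_map X (mtopology_of \<rho>) h" if "h \<in> cmaps X (mtopology_of \<rho>)" for h
    using that unfolding cmaps_def by blast
  have ms: "h x \<in> mspace \<rho>" if "h \<in> cmaps X (mtopology_of \<rho>)" "x \<in> topspace X" for h x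
    using funcset_mem[OF continuous_map_funspace[OF cm[OF that(1)]] that(2)] by simp
  define \<beta> where "\<beta> = (\<lambda>x. \<alpha> x - mdist \<rho> (g x) (f x))"
  have \<alpha>: "continuous_map X euclideanreal \<alpha>"
    using assms(2) unfolding pos_cmaps_def by blast
  have "continuous_map X euclideanreal \<beta>"
    unfolding \<beta>_def
    by (rule continuous_map_diff[OF \<alpha> continuous_map_mdist[OF cm[OF gc] cm[OF assms(1)]]])
  then have "\<beta> \<in> pos_cmaps X"
    using gf unfolding pos_cmaps_def \<beta>_def by simp
  moreover have "fine_nbhd X \<rho> g \<beta> \<subseteq> fine_nbhd X \<rho> f \<alpha>"
  proof
    fix h assume "h \<in> fine_nbhd X \<rho> g \<beta>"
    then have hc: "h \<in> cmaps X (mtopology_of \<rho>)"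
      and hg: "\<And>x. x \<in> topspace X \<Longrightarrow> mdist \<rho> (h x) (g x) < \<beta> x"
      unfolding fine_nbhd_def by blast+
    have "mdist \<rho> (h x) (f x) < \<alpha> x" if x: "x \<in> topspace X" for x
      using mdist_triangle[OF ms[OF hc x] ms[OF gc x] ms[OF assms(1) x]] hg[OF x]
      unfolding \<beta>_def by linarith
    with hc show "h \<in> fine_nbhd X \<rho> f \<alpha>" unfolding fine_nbhd_def by blast
  qed
  ultimately show "\<exists>\<beta>\<in>pos_cmaps X. fine_nbhd X \<rho> g \<beta> \<subseteq> fine_nbhd X \<rho> f \<alpha>"
    by blast
qed


section \<open>\<open>Z\<^sub>n\<close>-sets\<close>

definition ball_space :: "nat \<Rightarrow> (nat \<Rightarrow> real) topology" where
  "ball_space n = subtopology (Euclidean_space n) {x. (\<Sum>i<n. x i ^ 2) \<le> 1}"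

text \<open>\<^term>\<open>cfunspace (ball_space n) m\<close> carries the supremum metric; its boundedness condition on maps
  is vacuous because the ball is compact. For the same reason its topology is the compact-open one
  and does not depend on the choice of the compatible metric \<open>m\<close>, so it is immaterial whether
  \<open>m\<close> is quantified existentially or universally when \<open>Z\<close> is metrizable.\<close>

definition Zn_set :: "nat \<Rightarrow> 'y topology \<Rightarrow> 'y set \<Rightarrow> bool" where
  "Zn_set n Z F \<longleftrightarrow> closedin Z F \<and>
     (\<exists>m. mtopology_of m = Z \<and>
        mtopology_of (cfunspace (ball_space n) m) closure_of
            {f \<in> mspace (cfunspace (ball_space n) m). f ` topspace (ball_space n) \<subseteq> topspace Z - F}
          = mspace (cfunspace (ball_space n) m))"

definition sigma_Zn_set :: "nat \<Rightarrow> 'y topology \<Rightarrow> 'y set \<Rightarrow> bool" where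
  "sigma_Zn_set n Z S \<longleftrightarrow> (\<exists>\<F>. countable \<F> \<and> (\<forall>F\<in>\<F>. Zn_set n Z F) \<and> \<Union>\<F> = S)"

end

(*
  A closed piece F of an F_sigma graph gives an open condition on selections, by a graph
  neighbourhood argument in the fine topology, so by a Baire argument only its density matters.
  Over A n the selection is perturbed as follows. Put O(x) = {y. d(y, f x) < alpha x, (x,y) not in F},
  where d is a complete metric on the product with convex balls. The sigma-Z_n hypothesis and Baire's
  theorem in C(B^n, phi x) show that maps into O(x) Int phi(x) extend from the boundary of a cell of
  dimension at most n to the cell. Michael's theorem on (cell) x X extends such a cell to nearby
  points x. Hence, inductively over n + 1 colours, one gets open covers U_0, ..., U_n and compatible
  families of selections parametrized by the simplices whose vertices have different colours. Since
  dim (A n) <= n, the covers have disjoint refinements, one for each U_i, that together cover A n;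
  evaluating the families at a partition of unity subordinate to them gives the selection over A n,
  which is then extended to X, again by Michael's theorem.
*)

theory Submission
  imports Defs
begin

section \<open>Paracompact spaces\<close>

text \<open>Convex combinations of local selections, the usual way to globalize, leave O(x) Int
  phi(x), which need not be convex; hence selections are carried in families over simplices and
  glued by filling boundaries of cells, a step available only up to dimension n. The count is tight:
  adding a colour to k earlier ones cones over simplices with at most k vertices, so the filled
  cells have dimension at most k, and k = n is the last step to n + 1 colours. Each cover is chosen
  after the families on the previous ones, so the dimension can only be used at the end, by a
  refinement that serves n + 1 unrelated covers at once; its disjointness within a colour leaves at
  most one active member of each colour at a point. The metric is a supremum of truncated norms
  because a supremum keeps balls convex, which a weighted sum of truncated norms need not do. The
  fine topology is in general not metrizable, so the Baire argument for selections uses functions as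
  radii; bounding them by powers of 1/2 makes the centres converge uniformly.\<close>

definition locally_finite_family :: "'a topology \<Rightarrow> 'j set \<Rightarrow> ('j \<Rightarrow> 'a set) \<Rightarrow> bool" where
  "locally_finite_family X J U \<longleftrightarrow>
     (\<forall>x\<in>topspace X. \<exists>V. openin X V \<and> x \<in> V \<and> finite {j\<in>J. U j \<inter> V \<noteq> {}})"

lemma locally_finite_family_mono:
  assumes "locally_finite_family X J U" and "\<And>j. j \<in> J \<Longrightarrow> U' j \<subseteq> U j"
  shows "locally_finite_family X J U'"
  unfolding locally_finite_family_def
proof
  fix x assume "x \<in> topspace X"
  then obtain V where V: "openin X V" "x \<in> V" "finite {j\<in>J. U j \<inter> V \<noteq> {}}"
    using assms(1) unfolding locally_finite_family_def by blast
  have "{j\<in>J. U' j \<inter> V \<noteq> {}} \<subseteq> {j\<in>J. U j \<inter> V \<noteq> {}}"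
    using assms(2) by fast
  then show "\<exists>V. openin X V \<and> x \<in> V \<and> finite {j\<in>J. U' j \<inter> V \<noteq> {}}"
    using V finite_subset by blast
qed

lemma locally_finite_family_closure:
  assumes "locally_finite_family X J U"
  shows "locally_finite_family X J (\<lambda>j. X closure_of U j)"
  using assms unfolding locally_finite_family_def
  by (simp add: Int_commute openin_Int_closure_of_eq_empty cong: conj_cong)

lemma closedin_locally_finite_family_Union:
  assumes lf: "locally_finite_family X J U" and cl: "\<And>j. j \<in> J \<Longrightarrow> closedin X (U j)"
  shows "closedin X (\<Union>j\<in>J. U j)"
  unfolding closedin_def
proof
  show "(\<Union>j\<in>J. U j) \<subseteq> topspace X"
    using cl closedin_subset by blast
  show "openin X (topspace X - (\<Union>j\<in>J. U j))"
  proof (subst openin_subopen, intro ballI)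
    fix x assume x: "x \<in> topspace X - (\<Union>j\<in>J. U j)"
    then obtain V where V: "openin X V" "x \<in> V" "finite {j\<in>J. U j \<inter> V \<noteq> {}}"
      using lf unfolding locally_finite_family_def by blast
    let ?F = "{j\<in>J. U j \<inter> V \<noteq> {}}"
    have "closedin X (\<Union>j\<in>?F. U j)"
      using V(3) cl by (intro closedin_Union) auto
    then have "openin X (V - (\<Union>j\<in>?F. U j))"
      using V(1) by (rule openin_diff[rotated])
    moreover have "x \<in> V - (\<Union>j\<in>?F. U j)"
      using x V(2) by blast
    moreover have "V - (\<Union>j\<in>?F. U j) \<subseteq> topspace X - (\<Union>j\<in>J. U j)"
      using openin_subset[OF V(1)] by blast
    ultimately show "\<exists>T. openin X T \<and> x \<in> T \<and> T \<subseteq> topspace X - (\<Union>j\<in>J. U j)"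
      by blast
  qed
qed

lemma closure_of_locally_finite_family_Union:
  assumes "locally_finite_family X J U" and "\<And>j. j \<in> J \<Longrightarrow> U j \<subseteq> topspace X"
  shows "X closure_of (\<Union>j\<in>J. U j) = (\<Union>j\<in>J. X closure_of U j)"
proof
  have "closedin X (\<Union>j\<in>J. X closure_of U j)"
    using locally_finite_family_closure[OF assms(1)]
    by (rule closedin_locally_finite_family_Union) simp
  moreover have "(\<Union>j\<in>J. U j) \<subseteq> (\<Union>j\<in>J. X closure_of U j)"
    using assms(2) closure_of_subset by fast
  ultimately show "X closure_of (\<Union>j\<in>J. U j) \<subseteq> (\<Union>j\<in>J. X closure_of U j)"
    by (rule closure_of_minimal[rotated])
  show "(\<Union>j\<in>J. X closure_of U j) \<subseteq> X closure_of (\<Union>j\<in>J. U j)"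
    by (intro UN_least closure_of_mono) blast
qed

text \<open>Sorting the members of a refinement by a chosen index \<open>c\<close> and uniting those
  with the same index gives a refinement on the original index set; local finiteness survives
  because a set meeting \<open>V j\<close> meets a member with index \<open>j\<close>. Indexed
  families are kept throughout, since equal sets may carry different indices.\<close>

lemma paracompact_locally_finite_refinement:
  assumes X: "paracompact_space X"
    and op: "\<And>j. j \<in> J \<Longrightarrow> openin X (U j)" and cov: "topspace X \<subseteq> (\<Union>j\<in>J. U j)"
  obtains V where "\<And>j. j \<in> J \<Longrightarrow> openin X (V j)" "\<And>j. j \<in> J \<Longrightarrow> V j \<subseteq> U j"
    "(\<Union>j\<in>J. V j) = topspace X" "locally_finite_family X J V"
proof -
  have "open_cover_of X (U ` J)"
    using op cov openin_subset unfolding open_cover_of_def by fast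
  then obtain \<V> where \<V>: "open_cover_of X \<V>" "cover_refines \<V> (U ` J)" "locally_finite_in X \<V>"
    using X unfolding paracompact_space_def by metis
  have "\<forall>W\<in>\<V>. \<exists>j. j \<in> J \<and> W \<subseteq> U j"
    using \<V>(2) unfolding cover_refines_def by blast
  then obtain c where c: "\<forall>W\<in>\<V>. c W \<in> J \<and> W \<subseteq> U (c W)" by metis
  define V where "V = (\<lambda>j. \<Union>{W \<in> \<V>. c W = j})"
  have "locally_finite_family X J V"
    unfolding locally_finite_family_def
  proof
    fix x assume "x \<in> topspace X"
    then obtain N where N: "openin X N" "x \<in> N" "finite {W \<in> \<V>. W \<inter> N \<noteq> {}}"
      using \<V>(3) unfolding locally_finite_in_def by blast
    have "{j\<in>J. V j \<inter> N \<noteq> {}} \<subseteq> c ` {W \<in> \<V>. W \<inter> N \<noteq> {}}"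
      unfolding V_def by blast
    then have "finite {j\<in>J. V j \<inter> N \<noteq> {}}"
      using finite_imageI[OF N(3), of c] by (rule finite_subset)
    then show "\<exists>N. openin X N \<and> x \<in> N \<and> finite {j\<in>J. V j \<inter> N \<noteq> {}}"
      using N by blast
  qed
  moreover have "openin X (V j)" for j
    using \<V>(1) unfolding V_def open_cover_of_def by blast
  moreover have "V j \<subseteq> U j" for j
    using c unfolding V_def by blast
  moreover have "(\<Union>j\<in>J. V j) = topspace X"
    using \<V>(1) c unfolding V_def open_cover_of_def by blast
  ultimately show ?thesis by (intro that[of V])
qed

text \<open>The common core of regularity and normality: local separation from \<open>B\<close> is made global by
  the union of those members of a locally finite refinement that meet \<open>C\<close>.\<close>

lemma paracompact_separation:
  assumes X: "paracompact_space X" and C: "closedin X C"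
    and loc: "\<And>x. x \<in> C \<Longrightarrow> \<exists>U. openin X U \<and> x \<in> U \<and> B \<inter> X closure_of U = {}"
  obtains W where "openin X W" "C \<subseteq> W" "B \<inter> X closure_of W = {}"
proof -
  from loc obtain U where U: "\<And>x. x \<in> C \<Longrightarrow> openin X (U x) \<and> x \<in> U x \<and> B \<inter> X closure_of (U x) = {}"
    by metis
  \<comment> \<open>The index \<open>None\<close> stands for the complement of \<open>C\<close>,
    which completes the sets \<open>U x\<close> to a cover of the whole space; it is dropped again
    in \<open>W\<close>.\<close>
  define U' where "U' = case_option (topspace X - C) U"
  have CX: "C \<subseteq> topspace X" using C closedin_subset by blast
  obtain V where V: "\<And>j. j \<in> insert None (Some ` C) \<Longrightarrow> openin X (V j)"
      "\<And>j. j \<in> insert None (Some ` C) \<Longrightarrow> V j \<subseteq> U' j"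
      "(\<Union>j\<in>insert None (Some ` C). V j) = topspace X"
      "locally_finite_family X (insert None (Some ` C)) V"
    by (rule paracompact_locally_finite_refinement[OF X, of "insert None (Some ` C)" U'])
      (use openin_diff[OF openin_topspace C] U in \<open>auto simp: U'_def\<close>)
  define W where "W = (\<Union>x\<in>C. V (Some x))"
  have lf: "locally_finite_family X C (\<lambda>x. V (Some x))"
    unfolding locally_finite_family_def
  proof
    fix x assume "x \<in> topspace X"
    then obtain N where N: "openin X N" "x \<in> N" "finite {j\<in>insert None (Some ` C). V j \<inter> N \<noteq> {}}"
      using V(4) unfolding locally_finite_family_def by blast
    have "Some ` {j \<in> C. V (Some j) \<inter> N \<noteq> {}} \<subseteq> {j\<in>insert None (Some ` C). V j \<inter> N \<noteq> {}}"
      by blast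
    then have "finite {j \<in> C. V (Some j) \<inter> N \<noteq> {}}"
      using N(3) by (meson finite_imageD finite_subset inj_Some subset_UNIV inj_on_subset)
    then show "\<exists>V'. openin X V' \<and> x \<in> V' \<and> finite {j \<in> C. V (Some j) \<inter> V' \<noteq> {}}"
      using N by blast
  qed
  have "X closure_of W = (\<Union>x\<in>C. X closure_of V (Some x))"
    unfolding W_def
    by (rule closure_of_locally_finite_family_Union[OF lf]) (use V(1) openin_subset in blast)
  moreover have "B \<inter> X closure_of V (Some x) = {}" if "x \<in> C" for x
  proof -
    have "V (Some x) \<subseteq> U x" using V(2)[of "Some x"] that by (simp add: U'_def)
    then show ?thesis using closure_of_mono[of "V (Some x)" "U x" X] U[OF that] by blast
  qed
  ultimately have "B \<inter> X closure_of W = {}" by blast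
  moreover have "openin X W" unfolding W_def using V(1) by blast
  moreover have "C \<subseteq> W"
  proof
    fix x assume x: "x \<in> C"
    then obtain j where "j \<in> insert None (Some ` C)" "x \<in> V j" using V(3) CX by blast
    then show "x \<in> W" using V(2)[of None] x unfolding W_def U'_def by auto
  qed
  ultimately show ?thesis using that by blast
qed

lemma paracompact_imp_regular_space:
  assumes "paracompact_space X" shows "regular_space X"
  unfolding regular_space_def
proof (intro allI impI, elim conjE)
  fix C a assume C: "closedin X C" and a: "a \<in> topspace X - C"
  have "\<exists>U. openin X U \<and> x \<in> U \<and> {a} \<inter> X closure_of U = {}" if x: "x \<in> C" for x
  proof -
    have "Hausdorff_space X" using assms unfolding paracompact_space_def by blast
    moreover have "x \<in> topspace X" "a \<in> topspace X" "x \<noteq> a"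
      using x a C closedin_subset by blast+
    ultimately obtain U V where UV: "openin X U" "openin X V" "x \<in> U" "a \<in> V" "disjnt U V"
      unfolding Hausdorff_space_def by metis
    have "V \<inter> X closure_of U = {}"
      using UV by (simp add: openin_Int_closure_of_eq_empty disjnt_def Int_commute)
    then show ?thesis using UV by blast
  qed
  then obtain W where "openin X W" "C \<subseteq> W" "{a} \<inter> X closure_of W = {}"
    using paracompact_separation[OF assms C, of "{a}"] by blast
  moreover have "openin X (topspace X - X closure_of W)"
    by (intro openin_diff) auto
  moreover have "disjnt (topspace X - X closure_of W) W"
    using closure_of_subset[OF openin_subset[OF \<open>openin X W\<close>]] by (auto simp: disjnt_def)
  ultimately show "\<exists>U V. openin X U \<and> openin X V \<and> a \<in> U \<and> C \<subseteq> V \<and> disjnt U V"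
    using a by blast
qed

lemma regular_space_shrink:
  assumes "regular_space X" "openin X U" "x \<in> U"
  obtains V where "openin X V" "x \<in> V" "X closure_of V \<subseteq> U"
proof -
  have "closedin X (topspace X - U)" "x \<in> topspace X - (topspace X - U)"
    using assms openin_subset by auto
  then obtain V where "openin X V" "x \<in> V" "disjnt (topspace X - U) (X closure_of V)"
    using assms(1) unfolding regular_space by metis
  then show ?thesis
    using that closure_of_subset_topspace[of X V] by (auto simp: disjnt_def)
qed

lemma paracompact_imp_normal_space:
  assumes "paracompact_space X" shows "normal_space X"
  unfolding normal_space_def
proof (intro allI impI, elim conjE)
  fix S T assume S: "closedin X S" and T: "closedin X T" and "disjnt S T"
  have "\<exists>U. openin X U \<and> x \<in> U \<and> T \<inter> X closure_of U = {}" if x: "x \<in> S" for x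
  proof -
    have "openin X (topspace X - T)" "x \<in> topspace X - T"
      using S T \<open>disjnt S T\<close> x closedin_subset by (auto simp: disjnt_def)
    then obtain V where "openin X V" "x \<in> V" "X closure_of V \<subseteq> topspace X - T"
      using regular_space_shrink[OF paracompact_imp_regular_space[OF assms]] by metis
    then show ?thesis by blast
  qed
  then obtain W where W: "openin X W" "S \<subseteq> W" "T \<inter> X closure_of W = {}"
    using paracompact_separation[OF assms S, of T] by blast
  moreover have "openin X (topspace X - X closure_of W)"
    by (intro openin_diff) auto
  moreover have "disjnt W (topspace X - X closure_of W)"
    using closure_of_subset[OF openin_subset[OF \<open>openin X W\<close>]] by (auto simp: disjnt_def)
  moreover have "T \<subseteq> topspace X - X closure_of W"
    using W(3) closedin_subset[OF T] by blast
  ultimately show "\<exists>U V. openin X U \<and> openin X V \<and> S \<subseteq> U \<and> T \<subseteq> V \<and> disjnt U V"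
    by blast
qed

text \<open>Regularity gives each point a neighbourhood whose closure lies in some
  \<open>U j\<close>. Closures commute with locally finite unions, so uniting a locally finite
  refinement by index keeps the closures inside \<open>U j\<close>.\<close>

lemma paracompact_closure_refinement:
  assumes X: "paracompact_space X"
    and op: "\<And>j. j \<in> J \<Longrightarrow> openin X (U j)" and cov: "topspace X \<subseteq> (\<Union>j\<in>J. U j)"
  obtains V where "\<And>j. j \<in> J \<Longrightarrow> openin X (V j)" "\<And>j. j \<in> J \<Longrightarrow> X closure_of (V j) \<subseteq> U j"
    "(\<Union>j\<in>J. V j) = topspace X" "locally_finite_family X J V"
proof -
  have "\<exists>j N. j \<in> J \<and> openin X N \<and> x \<in> N \<and> X closure_of N \<subseteq> U j" if "x \<in> topspace X" for x
  proof -
    obtain j where "j \<in> J" "x \<in> U j" using cov \<open>x \<in> topspace X\<close> by blast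
    then show ?thesis
      using regular_space_shrink[OF paracompact_imp_regular_space[OF X] op] by metis
  qed
  then obtain j N where jN:
    "\<And>x. x \<in> topspace X \<Longrightarrow> j x \<in> J \<and> openin X (N x) \<and> x \<in> N x \<and> X closure_of (N x) \<subseteq> U (j x)"
    by metis
  obtain R where R: "\<And>x. x \<in> topspace X \<Longrightarrow> openin X (R x)" "\<And>x. x \<in> topspace X \<Longrightarrow> R x \<subseteq> N x"
    "(\<Union>x\<in>topspace X. R x) = topspace X" "locally_finite_family X (topspace X) R"
    by (rule paracompact_locally_finite_refinement[OF X, of "topspace X" N]) (use jN in auto)
  define V where "V = (\<lambda>i. \<Union>x\<in>{x\<in>topspace X. j x = i}. R x)"
  have sub: "locally_finite_family X {x\<in>topspace X. j x = i} R" for i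
    unfolding locally_finite_family_def
  proof
    fix x assume "x \<in> topspace X"
    then obtain W where W: "openin X W" "x \<in> W" "finite {j\<in>topspace X. R j \<inter> W \<noteq> {}}"
      using R(4) unfolding locally_finite_family_def by blast
    have "finite {k\<in>{x\<in>topspace X. j x = i}. R k \<inter> W \<noteq> {}}"
      by (rule finite_subset[OF _ W(3)]) blast
    then show "\<exists>W. openin X W \<and> x \<in> W \<and> finite {k\<in>{x\<in>topspace X. j x = i}. R k \<inter> W \<noteq> {}}"
      using W by blast
  qed
  have cl: "X closure_of (V i) \<subseteq> U i" for i
  proof -
    have "X closure_of (V i) = (\<Union>x\<in>{x\<in>topspace X. j x = i}. X closure_of R x)"
      unfolding V_def
      by (rule closure_of_locally_finite_family_Union[OF sub]) (use R(1) openin_subset in blast)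
    moreover have "X closure_of R x \<subseteq> U (j x)" if "x \<in> topspace X" for x
      using jN[OF that] closure_of_mono[OF R(2)[OF that], of X] by blast
    ultimately show ?thesis by blast
  qed
  have "locally_finite_family X J V"
    unfolding locally_finite_family_def
  proof
    fix x assume "x \<in> topspace X"
    then obtain W where W: "openin X W" "x \<in> W" "finite {j\<in>topspace X. R j \<inter> W \<noteq> {}}"
      using R(4) unfolding locally_finite_family_def by blast
    have "finite {i\<in>J. V i \<inter> W \<noteq> {}}"
      by (rule finite_subset[OF _ finite_imageI[OF W(3), of j]]) (auto simp: V_def)
    then show "\<exists>W. openin X W \<and> x \<in> W \<and> finite {i\<in>J. V i \<inter> W \<noteq> {}}"
      using W by blast
  qed
  moreover have "openin X (V i)" for i
    unfolding V_def using R(1) by blast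
  moreover have "(\<Union>i\<in>J. V i) = topspace X"
  proof -
    have "j x \<in> J" if "x \<in> topspace X" for x using jN[OF that] by blast
    then have "(\<Union>i\<in>J. V i) = (\<Union>x\<in>topspace X. R x)" unfolding V_def by blast
    then show ?thesis using R(3) by simp
  qed
  ultimately show ?thesis using cl by (intro that[of V])
qed

section \<open>Closed subspaces of paracompact spaces and products with compact spaces\<close>

lemma paracompact_space_closed_subtopology:
  assumes X: "paracompact_space X" and C: "closedin X C"
  shows "paracompact_space (subtopology X C)"
  unfolding paracompact_space_def
proof (intro conjI allI impI)
  show "Hausdorff_space (subtopology X C)"
    using X unfolding paracompact_space_def by (blast intro: Hausdorff_space_subtopology)
  have CX: "C \<subseteq> topspace X" using C closedin_subset by blast
  fix \<U> assume \<U>: "open_cover_of (subtopology X C) \<U>"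
  then have "\<forall>U\<in>\<U>. \<exists>G. openin X G \<and> U = G \<inter> C"
    unfolding open_cover_of_def openin_subtopology by blast
  then obtain G where G: "\<And>U. U \<in> \<U> \<Longrightarrow> openin X (G U) \<and> U = G U \<inter> C" by metis
  have U\<U>: "\<Union>\<U> = C" using \<U> CX unfolding open_cover_of_def by auto
  \<comment> \<open>The relatively open sets are extended to open sets of \<open>X\<close>, and the
    complement of \<open>C\<close> enters under the index \<open>None\<close>, so that
    \<open>V None\<close> misses \<open>C\<close>.\<close>
  define G' where "G' = case_option (topspace X - C) G"
  let ?J = "insert None (Some ` \<U>)"
  have "openin X (G' j)" if "j \<in> ?J" for j
    using that openin_diff[OF openin_topspace C] G unfolding G'_def by auto
  moreover have "topspace X \<subseteq> (\<Union>j\<in>?J. G' j)"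
    using U\<U> G unfolding G'_def by fastforce
  ultimately obtain V where V: "\<And>j. j \<in> ?J \<Longrightarrow> openin X (V j)" "\<And>j. j \<in> ?J \<Longrightarrow> V j \<subseteq> G' j"
    "(\<Union>j\<in>?J. V j) = topspace X" "locally_finite_family X ?J V"
    by (rule paracompact_locally_finite_refinement[OF X]) blast+
  let ?\<V> = "(\<lambda>U. V (Some U) \<inter> C) ` \<U>"
  have "V None \<inter> C = {}" using V(2)[of None] unfolding G'_def by auto
  then have "\<Union>?\<V> = C" using V(3) CX by fastforce
  moreover have "openin (subtopology X C) (V (Some U) \<inter> C)" if "U \<in> \<U>" for U
    using V(1)[of "Some U"] that by (auto simp: openin_subtopology)
  ultimately have 1: "open_cover_of (subtopology X C) ?\<V>"
    using CX unfolding open_cover_of_def by (auto simp: Int_absorb1)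
  have "V (Some U) \<inter> C \<subseteq> U" if "U \<in> \<U>" for U
    using V(2)[of "Some U"] G[OF that] that unfolding G'_def by auto
  then have 2: "cover_refines ?\<V> \<U>" unfolding cover_refines_def by blast
  have "\<exists>W. openin (subtopology X C) W \<and> x \<in> W \<and> finite {U \<in> ?\<V>. U \<inter> W \<noteq> {}}"
    if x: "x \<in> C" for x
  proof -
    obtain N where N: "openin X N" "x \<in> N" "finite {j\<in>?J. V j \<inter> N \<noteq> {}}"
      using x CX V(4) unfolding locally_finite_family_def by blast
    have "{U \<in> ?\<V>. U \<inter> (N \<inter> C) \<noteq> {}} \<subseteq> (\<lambda>j. V j \<inter> C) ` {j\<in>?J. V j \<inter> N \<noteq> {}}" by blast
    then have "finite {U \<in> ?\<V>. U \<inter> (N \<inter> C) \<noteq> {}}" using N(3) by (rule finite_surj[rotated])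
    then show ?thesis using N x by (intro exI[of _ "N \<inter> C"]) (auto simp: openin_subtopology)
  qed
  then have 3: "locally_finite_in (subtopology X C) ?\<V>"
    using CX unfolding locally_finite_in_def by auto
  show "\<exists>\<V>. open_cover_of (subtopology X C) \<V> \<and> cover_refines \<V> \<U> \<and> locally_finite_in (subtopology X C) \<V>"
    using 1 2 3 by blast
qed

lemma compact_imp_paracompact_space:
  assumes "compact_space X" "Hausdorff_space X"
  shows "paracompact_space X"
  unfolding paracompact_space_def
proof (intro conjI allI impI)
  fix \<U> assume "open_cover_of X \<U>"
  then obtain \<F> where "finite \<F>" "\<F> \<subseteq> \<U>" "topspace X \<subseteq> \<Union>\<F>" "\<Union>\<U> = topspace X" "\<forall>U\<in>\<U>. openin X U"
    using assms(1) unfolding open_cover_of_def compact_space_def compactin_def by (metis subset_refl)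
  then show "\<exists>\<V>. open_cover_of X \<V> \<and> cover_refines \<V> \<U> \<and> locally_finite_in X \<V>"
    unfolding open_cover_of_def cover_refines_def
    by (intro exI[of _ \<F>] conjI) (auto intro!: finite_imp_locally_finite_in)
qed (use assms in blast)

text \<open>By the tube lemma every slice \<open>topspace K \<times> {x}\<close> has a tube covered
  by finitely many members of the cover; a locally finite refinement of the bases of these tubes
  cuts the finite subfamilies into a locally finite refinement. This makes Michael's theorem
  applicable to selections that depend on a parameter in a cell.\<close>

lemma paracompact_space_compact_prod:
  assumes K: "compact_space K" "Hausdorff_space K" and X: "paracompact_space X"
  shows "paracompact_space (prod_topology K X)"
  unfolding paracompact_space_def
proof (intro conjI allI impI)
  show "Hausdorff_space (prod_topology K X)"
    using K X unfolding paracompact_space_def by (simp add: Hausdorff_space_prod_topology)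
  fix \<U> assume \<U>: "open_cover_of (prod_topology K X) \<U>"
  have "\<exists>\<F> W. finite \<F> \<and> \<F> \<subseteq> \<U> \<and> openin X W \<and> x \<in> W \<and> topspace K \<times> W \<subseteq> \<Union>\<F>" if x: "x \<in> topspace X" for x
  proof -
    have "compactin (prod_topology K X) (topspace K \<times> {x})"
      using K x by (simp add: compactin_Times compact_space_def)
    moreover have "topspace K \<times> {x} \<subseteq> \<Union>\<U>"
      using \<U> x unfolding open_cover_of_def by auto
    ultimately obtain \<F> where \<F>: "finite \<F>" "\<F> \<subseteq> \<U>" "topspace K \<times> {x} \<subseteq> \<Union>\<F>"
      using \<U> unfolding open_cover_of_def by (metis compactinD)
    have "openin (prod_topology K X) (\<Union>\<F>)"
      using \<F>(2) \<U> unfolding open_cover_of_def by blast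
    then obtain U V where "openin X V" "topspace K \<subseteq> U" "x \<in> V" "U \<times> V \<subseteq> \<Union>\<F>"
      using tube_lemma_left[of K X "\<Union>\<F>" "topspace K" x] K(1) x \<F>(3) unfolding compact_space_def by blast
    then show ?thesis
      using \<F> by (intro exI[of _ \<F>] exI[of _ V]) auto
  qed
  then obtain \<F> W where \<F>: "\<And>x. x \<in> topspace X \<Longrightarrow>
    finite (\<F> x) \<and> \<F> x \<subseteq> \<U> \<and> openin X (W x) \<and> x \<in> W x \<and> topspace K \<times> W x \<subseteq> \<Union>(\<F> x)"
    by metis
  obtain R where R: "\<And>x. x \<in> topspace X \<Longrightarrow> openin X (R x)" "\<And>x. x \<in> topspace X \<Longrightarrow> R x \<subseteq> W x"
    "(\<Union>x\<in>topspace X. R x) = topspace X" "locally_finite_family X (topspace X) R"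
    by (rule paracompact_locally_finite_refinement[OF X, of "topspace X" W]) (use \<F> in auto)
  define \<V> where "\<V> = (\<Union>x\<in>topspace X. (\<lambda>U. U \<inter> (topspace K \<times> R x)) ` \<F> x)"
  have op\<U>: "openin (prod_topology K X) U" if "U \<in> \<U>" for U
    using \<U> that unfolding open_cover_of_def by blast
  have opV: "openin (prod_topology K X) V" if "V \<in> \<V>" for V
  proof -
    obtain x U where "x \<in> topspace X" "U \<in> \<F> x" "V = U \<inter> (topspace K \<times> R x)"
      using \<open>V \<in> \<V>\<close> unfolding \<V>_def by blast
    then show ?thesis
      using op\<U>[of U] \<F>[of x] R(1)[of x]
      by (auto simp: openin_prod_Times_iff intro!: openin_Int)
  qed
  have "(t, x) \<in> \<Union>\<V>" if "t \<in> topspace K" "x \<in> topspace X" for t x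
  proof -
    obtain x' where x': "x' \<in> topspace X" "x \<in> R x'" using R(3) \<open>x \<in> topspace X\<close> by blast
    then have "(t, x) \<in> topspace K \<times> W x'" using R(2) \<open>t \<in> topspace K\<close> by blast
    then obtain U where "U \<in> \<F> x'" "(t, x) \<in> U" using \<F>[OF x'(1)] by blast
    then show ?thesis unfolding \<V>_def using x' \<open>t \<in> topspace K\<close> by blast
  qed
  then have "topspace (prod_topology K X) \<subseteq> \<Union>\<V>" by auto
  moreover have "\<Union>\<V> \<subseteq> topspace (prod_topology K X)" using opV openin_subset by blast
  ultimately have 1: "open_cover_of (prod_topology K X) \<V>"
    unfolding open_cover_of_def using opV by blast
  have 2: "cover_refines \<V> \<U>"
    unfolding cover_refines_def \<V>_def using \<F> by blast
  have "\<exists>N. openin (prod_topology K X) N \<and> (t, x) \<in> N \<and> finite {U \<in> \<V>. U \<inter> N \<noteq> {}}"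
    if "t \<in> topspace K" "x \<in> topspace X" for t x
  proof -
    obtain N where N: "openin X N" "x \<in> N" "finite {j\<in>topspace X. R j \<inter> N \<noteq> {}}"
      using R(4) \<open>x \<in> topspace X\<close> unfolding locally_finite_family_def by blast
    have "{U \<in> \<V>. U \<inter> (topspace K \<times> N) \<noteq> {}}
        \<subseteq> (\<Union>y\<in>{j\<in>topspace X. R j \<inter> N \<noteq> {}}. (\<lambda>U. U \<inter> (topspace K \<times> R y)) ` \<F> y)"
      unfolding \<V>_def by blast
    moreover have "finite (\<Union>y\<in>{j\<in>topspace X. R j \<inter> N \<noteq> {}}. (\<lambda>U. U \<inter> (topspace K \<times> R y)) ` \<F> y)"
      using N(3) \<F> by auto
    ultimately have "finite {U \<in> \<V>. U \<inter> (topspace K \<times> N) \<noteq> {}}" using finite_subset by blast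
    then show ?thesis
      using N \<open>t \<in> topspace K\<close> by (intro exI[of _ "topspace K \<times> N"]) (simp add: openin_prod_Times_iff)
  qed
  then have 3: "locally_finite_in (prod_topology K X) \<V>"
    using 1 unfolding locally_finite_in_def open_cover_of_def by force
  show "\<exists>\<V>. open_cover_of (prod_topology K X) \<V> \<and> cover_refines \<V> \<U> \<and> locally_finite_in (prod_topology K X) \<V>"
    using 1 2 3 by blast
qed

section \<open>Partitions of unity\<close>

text \<open>The sum runs over the indices active at \<open>x\<close>, a finite set, because a sum
  over an infinite \<open>J\<close> would have the default value 0. The activity predicate
  \<open>S\<close> is separate from \<open>h\<close>, so that a partition of unity can localize
  summands such as \<open>p j x * e j\<close>.\<close>

lemma continuous_map_locally_finite_sum:
  fixes h :: "'j \<Rightarrow> 'a \<Rightarrow> 'b::real_normed_vector"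
  assumes lf: "locally_finite_family X J (\<lambda>j. {x\<in>topspace X. S j x})"
    and zero: "\<And>j x. j \<in> J \<Longrightarrow> x \<in> topspace X \<Longrightarrow> \<not> S j x \<Longrightarrow> h j x = 0"
    and cont: "\<And>j. j \<in> J \<Longrightarrow> continuous_map X euclidean (h j)"
  shows "continuous_map X euclidean (\<lambda>x. \<Sum>j | j \<in> J \<and> S j x. h j x)"
proof -
  obtain N where N: "\<And>x. x \<in> topspace X \<Longrightarrow>
      openin X (N x) \<and> x \<in> N x \<and> finite {j\<in>J. {x\<in>topspace X. S j x} \<inter> N x \<noteq> {}}"
    using bchoice[OF lf[unfolded locally_finite_family_def]] by blast
  let ?F = "\<lambda>x. {j\<in>J. {x\<in>topspace X. S j x} \<inter> N x \<noteq> {}}"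
  have eq: "(\<Sum>j | j \<in> J \<and> S j y. h j y) = (\<Sum>j\<in>?F x. h j y)"
    if "x \<in> topspace X" "y \<in> topspace X" "y \<in> N x" for x y
    using that N[OF that(1)] zero by (intro sum.mono_neutral_left) auto
  show ?thesis
  proof (rule pasting_lemma[where I = "topspace X" and T = N and f = "\<lambda>x y. \<Sum>j\<in>?F x. h j y"])
    show "continuous_map (subtopology X (N x)) euclidean (\<lambda>y. \<Sum>j\<in>?F x. h j y)" if "x \<in> topspace X" for x
      using N[OF that] cont by (intro continuous_map_sum continuous_map_from_subtopology) auto
    show "(\<Sum>j\<in>?F i. h j x) = (\<Sum>j\<in>?F i'. h j x)"
      if "i \<in> topspace X" "i' \<in> topspace X" "x \<in> topspace X \<inter> N i \<inter> N i'" for i i' x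
      using eq[of i x] eq[of i' x] that by auto
    show "\<exists>j. j \<in> topspace X \<and> x \<in> N j \<and> (\<Sum>j | j \<in> J \<and> S j x. h j x) = (\<Sum>j\<in>?F j. h j x)"
      if "x \<in> topspace X" for x
      using eq[of x x] N[OF that] that by blast
  qed (use N in blast)
qed

lemma locally_finite_family_finite_at:
  assumes "locally_finite_family X J U" "x \<in> topspace X"
  shows "finite {j\<in>J. x \<in> U j}"
proof -
  obtain V where V: "x \<in> V" "finite {j\<in>J. U j \<inter> V \<noteq> {}}"
    using assms unfolding locally_finite_family_def by blast
  show ?thesis by (rule finite_subset[OF _ V(2)]) (use V(1) in blast)
qed

definition partition_of_unity :: "'a topology \<Rightarrow> 'j set \<Rightarrow> ('j \<Rightarrow> 'a set) \<Rightarrow> ('j \<Rightarrow> 'a \<Rightarrow> real) \<Rightarrow> bool" where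
  "partition_of_unity X J U p \<longleftrightarrow>
     (\<forall>j\<in>J. continuous_map X euclideanreal (p j)) \<and>
     locally_finite_family X J (\<lambda>j. {x\<in>topspace X. p j x \<noteq> 0}) \<and>
     (\<forall>x\<in>topspace X. (\<forall>j\<in>J. 0 \<le> p j x \<and> (p j x \<noteq> 0 \<longrightarrow> x \<in> U j)) \<and>
        finite {j\<in>J. p j x \<noteq> 0} \<and> (\<Sum>j | j \<in> J \<and> p j x \<noteq> 0. p j x) = 1)"

lemma paracompact_partition_of_unity:
  assumes X: "paracompact_space X"
    and op: "\<And>j. j \<in> J \<Longrightarrow> openin X (U j)" and cov: "topspace X \<subseteq> (\<Union>j\<in>J. U j)"
  obtains p where "partition_of_unity X J U p"
proof -
  obtain V where V: "\<And>j. j \<in> J \<Longrightarrow> openin X (V j)" "\<And>j. j \<in> J \<Longrightarrow> X closure_of (V j) \<subseteq> U j"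
    "(\<Union>j\<in>J. V j) = topspace X" "locally_finite_family X J V"
    using paracompact_closure_refinement[OF X op cov] by metis
  \<comment> \<open>The second shrinking leaves room between the closure of \<open>W j\<close> and
    the complement of \<open>V j\<close> for a Urysohn function; the sets \<open>V j\<close> give
    local finiteness and the sets \<open>W j\<close> positivity of the sum.\<close>
  obtain W where W: "\<And>j. j \<in> J \<Longrightarrow> openin X (W j)" "\<And>j. j \<in> J \<Longrightarrow> X closure_of (W j) \<subseteq> V j"
    "(\<Union>j\<in>J. W j) = topspace X"
    by (rule paracompact_closure_refinement[OF X V(1), of J]) (use V(3) in auto)
  have "\<exists>f. continuous_map X (top_of_set {0..1::real}) f \<and> f ` (topspace X - V j) \<subseteq> {0} \<and> f ` (X closure_of W j) \<subseteq> {1}"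
    if j: "j \<in> J" for j
  proof -
    have "closedin X (topspace X - V j)" "disjnt (topspace X - V j) (X closure_of W j)"
      using V(1)[OF j] W(2)[OF j] by (auto simp: disjnt_def)
    then show ?thesis
      using Urysohn_lemma[OF paracompact_imp_normal_space[OF X], of "topspace X - V j" "X closure_of W j" 0 1]
      by (metis closedin_closure_of zero_le_one)
  qed
  then obtain h where h: "\<And>j. j \<in> J \<Longrightarrow> continuous_map X (top_of_set {0..1::real}) (h j)"
     "\<And>j. j \<in> J \<Longrightarrow> h j ` (topspace X - V j) \<subseteq> {0}" "\<And>j. j \<in> J \<Longrightarrow> h j ` (X closure_of W j) \<subseteq> {1}"
    by metis
  have hc: "continuous_map X euclideanreal (h j)" if "j \<in> J" for j
    using h(1)[OF that] continuous_map_into_fulltopology by blast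
  have h0: "0 \<le> h j x" if "j \<in> J" "x \<in> topspace X" for j x
    using continuous_map_funspace[OF h(1)[OF that(1)]] that(2) by (auto simp: Pi_iff)
  have hV: "x \<in> V j" if "j \<in> J" "x \<in> topspace X" "h j x \<noteq> 0" for j x
    using h(2)[OF that(1)] that by (auto simp: image_subset_iff)
  have lf: "locally_finite_family X J (\<lambda>j. {x\<in>topspace X. h j x \<noteq> 0})"
    by (rule locally_finite_family_mono[OF V(4)]) (use hV in blast)
  define s where "s = (\<lambda>x. \<Sum>j | j \<in> J \<and> h j x \<noteq> 0. h j x)"
  have sc: "continuous_map X euclideanreal s"
    unfolding s_def by (rule continuous_map_locally_finite_sum[OF lf _ hc]) auto
  have fin: "finite {j\<in>J. h j x \<noteq> 0}" if "x \<in> topspace X" for x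
    using locally_finite_family_finite_at[OF lf that] that by simp
  have s0: "0 < s x" if x: "x \<in> topspace X" for x
  proof -
    obtain j where j: "j \<in> J" "x \<in> W j" using W(3) x by blast
    then have "x \<in> X closure_of W j" using closure_of_subset[OF openin_subset[OF W(1)]] by blast
    then have "h j x = 1" using h(3)[OF j(1)] by blast
    then show ?thesis unfolding s_def
      using fin[OF x] j(1) h0[OF _ x] by (intro sum_pos2[where i=j]) auto
  qed
  define p where "p = (\<lambda>j x. h j x / s x)"
  have p0: "p j x \<noteq> 0 \<longleftrightarrow> h j x \<noteq> 0" if "x \<in> topspace X" for j x
    unfolding p_def using s0[OF that] by simp
  have VU: "V j \<subseteq> U j" if "j \<in> J" for j
    using closure_of_subset[OF openin_subset[OF V(1)[OF that]]] V(2)[OF that] by blast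
  have "partition_of_unity X J U p"
    unfolding partition_of_unity_def
  proof (intro conjI ballI)
    show "continuous_map X euclideanreal (p j)" if "j \<in> J" for j
      unfolding p_def using hc[OF that] sc s0 by (intro continuous_map_real_divide) force+
    show "locally_finite_family X J (\<lambda>j. {x\<in>topspace X. p j x \<noteq> 0})"
      using lf p0 by (simp cong: conj_cong)
    fix x assume x: "x \<in> topspace X"
    show "finite {j\<in>J. p j x \<noteq> 0}" using fin[OF x] p0[OF x] by simp
    show "(\<Sum>j | j \<in> J \<and> p j x \<noteq> 0. p j x) = 1"
      using p0[OF x] s0[OF x] unfolding p_def
      by (simp add: sum_divide_distrib[symmetric]) (simp add: s_def)
    show "p j x \<noteq> 0 \<longrightarrow> x \<in> U j" if "j \<in> J" for j
      using p0[OF x] hV[OF that x] VU[OF that] by blast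
    show "0 \<le> p j x" if "j \<in> J" for j
      unfolding p_def using h0[OF that x] s0[OF x] by simp
  qed
  then show ?thesis by (rule that)
qed

lemma partition_of_unityD:
  assumes "partition_of_unity X J U p"
  shows "\<And>j. j \<in> J \<Longrightarrow> continuous_map X euclideanreal (p j)"
    and "locally_finite_family X J (\<lambda>j. {x\<in>topspace X. p j x \<noteq> 0})"
    and "\<And>j x. j \<in> J \<Longrightarrow> x \<in> topspace X \<Longrightarrow> 0 \<le> p j x"
    and "\<And>j x. j \<in> J \<Longrightarrow> x \<in> topspace X \<Longrightarrow> p j x \<noteq> 0 \<Longrightarrow> x \<in> U j"
    and "\<And>x. x \<in> topspace X \<Longrightarrow> finite {j\<in>J. p j x \<noteq> 0}"
    and "\<And>x. x \<in> topspace X \<Longrightarrow> (\<Sum>j | j \<in> J \<and> p j x \<noteq> 0. p j x) = 1"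
  using assms unfolding partition_of_unity_def by blast+

text \<open>A convex combination of the local constants is at most the largest constant active at
  the point, and \<open>P\<close> passes to smaller positive constants.\<close>

lemma paracompact_positive_function:
  assumes X: "paracompact_space X"
    and loc: "\<And>x. x \<in> topspace X \<Longrightarrow> \<exists>W e. openin X W \<and> x \<in> W \<and> 0 < e \<and> (\<forall>y\<in>W. P y e)"
    and mono: "\<And>y e e'. P y e \<Longrightarrow> 0 < e' \<Longrightarrow> e' \<le> e \<Longrightarrow> P y (e'::real)"
  obtains \<alpha> where "\<alpha> \<in> pos_cmaps X" "\<And>y. y \<in> topspace X \<Longrightarrow> P y (\<alpha> y)"
proof -
  from loc obtain W e where W: "\<And>x. x \<in> topspace X \<Longrightarrow> openin X (W x) \<and> x \<in> W x \<and> 0 < e x \<and> (\<forall>y\<in>W x. P y (e x))"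
    by metis
  obtain p where p: "partition_of_unity X (topspace X) W p"
    using paracompact_partition_of_unity[OF X, of "topspace X" W] W by blast
  note p = partition_of_unityD[OF p]
  define \<alpha> where "\<alpha> = (\<lambda>x. \<Sum>j | j \<in> topspace X \<and> p j x \<noteq> 0. p j x * e j)"
  have "continuous_map X euclideanreal \<alpha>"
    unfolding \<alpha>_def
    by (rule continuous_map_locally_finite_sum[OF p(2)])
      (auto intro!: continuous_map_real_mult p(1))
  have both: "0 < \<alpha> x \<and> P x (\<alpha> x)" if x: "x \<in> topspace X" for x
  proof -
    let ?S = "{j. j \<in> topspace X \<and> p j x \<noteq> 0}"
    have fin: "finite ?S" using p(5)[OF x] by simp
    have ne: "?S \<noteq> {}" using p(6)[OF x] by force
    have pos: "0 < \<alpha> x" unfolding \<alpha>_def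
      using fin ne W p(3)[OF _ x] by (intro sum_pos) (auto intro!: mult_pos_pos simp: less_le)
    obtain j where j: "j \<in> ?S" "\<And>i. i \<in> ?S \<Longrightarrow> e i \<le> e j"
    proof -
      have "Max (e ` ?S) \<in> e ` ?S" using fin ne by (intro Max_in) auto
      then obtain j where "j \<in> ?S" "e j = Max (e ` ?S)" by force
      then show ?thesis using fin that[of j] by simp
    qed
    have "\<alpha> x \<le> (\<Sum>i\<in>?S. p i x * e j)"
      unfolding \<alpha>_def using j(2) p(3)[OF _ x] by (intro sum_mono mult_left_mono) auto
    also have "\<dots> = e j" using p(6)[OF x] by (simp add: sum_distrib_right[symmetric])
    finally have "\<alpha> x \<le> e j" .
    moreover have "P x (e j)" using W[of j] p(4)[of j x] j(1) x by blast
    ultimately show ?thesis using mono[of x "e j" "\<alpha> x"] pos by simp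
  qed
  show ?thesis
    using that[of \<alpha>] both \<open>continuous_map X euclideanreal \<alpha>\<close> unfolding pos_cmaps_def by blast
qed


section \<open>Coloured refinements in spaces of covering dimension at most \<open>n\<close>\<close>

text \<open>If the functions \<open>p\<close> are read as barycentric coordinates in the nerve, this
  is, for nonempty finite \<open>T\<close>, the preimage of the open star of the barycentre of
  \<open>T\<close> in the barycentric subdivision. Barycentres of distinct simplices of equal
  dimension are not adjacent there, whence the disjointness below.\<close>

definition dominance_set :: "'a topology \<Rightarrow> 'j set \<Rightarrow> ('j \<Rightarrow> 'a \<Rightarrow> real) \<Rightarrow> 'j set \<Rightarrow> 'a set" where
  "dominance_set X J p T = {x\<in>topspace X. \<forall>s\<in>T. 0 < p s x \<and> (\<forall>s'\<in>J-T. p s' x < p s x)}"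

lemma openin_dominance_set:
  assumes p: "partition_of_unity X J U p" and T: "finite T" "T \<subseteq> J"
  shows "openin X (dominance_set X J p T)"
proof (subst openin_subopen, intro ballI)
  note p = partition_of_unityD[OF p]
  fix x assume x: "x \<in> dominance_set X J p T"
  then have xX: "x \<in> topspace X" unfolding dominance_set_def by blast
  then obtain N where N: "openin X N" "x \<in> N" "finite {j\<in>J. {x\<in>topspace X. p j x \<noteq> 0} \<inter> N \<noteq> {}}"
    using p(2) unfolding locally_finite_family_def by blast
  \<comment> \<open>Off \<open>T\<close> only the finitely many functions that are nonzero somewhere
    on \<open>N\<close> impose a strict inequality; for the others it follows from
    \<open>0 < p s y\<close>.\<close>
  define F where "F = {j\<in>J. {x\<in>topspace X. p j x \<noteq> 0} \<inter> N \<noteq> {}} - T"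
  define G where "G = (\<lambda>s s'. {y\<in>topspace X. p s y - p s' y \<in> {0<..}})"
  define G0 where "G0 = (\<lambda>s. {y\<in>topspace X. p s y \<in> {0<..}})"
  \<comment> \<open>The intersections with \<open>topspace X\<close> cover the cases of an empty
    \<open>T\<close> or \<open>F\<close>.\<close>
  define W where "W = N \<inter> ((\<Inter>s\<in>T. G0 s) \<inter> topspace X) \<inter>
    ((\<Inter>s\<in>T. (\<Inter>s'\<in>F. G s s') \<inter> topspace X) \<inter> topspace X)"
  have "finite F" using N(3) unfolding F_def by blast
  have "openin X (G s s')" if "s \<in> T" "s' \<in> F" for s s'
    unfolding G_def
    using that T p(1) by (intro openin_continuous_map_preimage[of X euclideanreal] continuous_map_diff) (auto simp: F_def)
  moreover have "openin X (G0 s)" if "s \<in> T" for s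
    unfolding G0_def
    using that T p(1) by (intro openin_continuous_map_preimage[of X euclideanreal]) auto
  ultimately have "openin X W"
    unfolding W_def using T(1) \<open>finite F\<close> N(1) by (intro openin_Int openin_INT) auto
  moreover have "x \<in> W"
    using x N(2) xX unfolding W_def G_def G0_def F_def dominance_set_def by auto
  moreover have "W \<subseteq> dominance_set X J p T"
  proof
    fix y assume y: "y \<in> W"
    then have yX: "y \<in> topspace X" using N(1) openin_subset unfolding W_def by blast
    have "p s' y < p s y" if "s \<in> T" "s' \<in> J - T" for s s'
    proof (cases "s' \<in> F")
      case True
      then have "y \<in> G s s'" using y that(1) unfolding W_def by blast
      then show ?thesis unfolding G_def by simp
    next
      case False
      then have "p s' y = 0" using y that yX unfolding W_def F_def by blast
      then show ?thesis using y that(1) unfolding W_def G0_def by simp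
    qed
    then show "y \<in> dominance_set X J p T"
      using y yX unfolding dominance_set_def W_def G0_def by auto
  qed
  ultimately show "\<exists>W. openin X W \<and> x \<in> W \<and> W \<subseteq> dominance_set X J p T" by blast
qed

text \<open>Distinct finite sets of equal size do not contain one another, and an index from each
  difference gives opposite strict inequalities.\<close>

lemma dominance_set_disjoint:
  assumes "T \<noteq> T'" "card T = card T'" "finite T" "finite T'" "T \<subseteq> J" "T' \<subseteq> J"
  shows "dominance_set X J p T \<inter> dominance_set X J p T' = {}"
proof -
  have "\<not> T \<subseteq> T'" "\<not> T' \<subseteq> T" using assms card_subset_eq by metis+
  then obtain s s' where s: "s \<in> T" "s \<notin> T'" "s' \<in> T'" "s' \<notin> T" by blast
  have "p s' x < p s x" if "x \<in> dominance_set X J p T" for x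
    using that s assms unfolding dominance_set_def by blast
  moreover have "p s x < p s' x" if "x \<in> dominance_set X J p T'" for x
    using that s assms unfolding dominance_set_def by blast
  ultimately show ?thesis by fastforce
qed

lemma dominance_set_subset:
  assumes p: "partition_of_unity X J U p" and "T \<subseteq> J" "s \<in> T"
  shows "dominance_set X J p T \<subseteq> U s"
  using partition_of_unityD(4)[OF p, of s] assms(2,3) unfolding dominance_set_def by fastforce

text \<open>The witness is the set of indices at which \<open>p\<close> attains its maximum at
  \<open>x\<close>; it is finite because the maximum is positive.\<close>

lemma dominance_set_cover:
  assumes p: "partition_of_unity X J U p" and x: "x \<in> topspace X"
  obtains T where "finite T" "T \<noteq> {}" "T \<subseteq> J" "x \<in> dominance_set X J p T" "\<And>s. s \<in> T \<Longrightarrow> x \<in> U s"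
proof -
  note p' = partition_of_unityD[OF p]
  let ?S = "{j\<in>J. p j x \<noteq> 0}"
  have fin: "finite ?S" using p'(5)[OF x] .
  have ne: "?S \<noteq> {}" using p'(6)[OF x] by force
  define M where "M = Max ((\<lambda>j. p j x) ` ?S)"
  have M: "M \<in> (\<lambda>j. p j x) ` ?S" unfolding M_def using fin ne by (intro Max_in) auto
  then have M0: "M > 0" using p'(3)[OF _ x] by force
  have le: "p j x \<le> M" if "j \<in> J" for j
  proof (cases "p j x = 0")
    case True then show ?thesis using M0 by simp
  next
    case False then show ?thesis unfolding M_def using fin that by (intro Max_ge) auto
  qed
  let ?T = "{j\<in>J. p j x = M}"
  have "?T \<subseteq> ?S" using M0 by auto
  then have "finite ?T" using fin by (rule finite_subset)
  moreover have "?T \<noteq> {}" using M by blast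
  moreover have "x \<in> dominance_set X J p ?T"
    unfolding dominance_set_def using x M0 le by (auto simp: less_le)
  moreover have "x \<in> U s" if "s \<in> ?T" for s using p'(4)[of s x] that x M0 by auto
  ultimately show ?thesis by (intro that[of ?T]) auto
qed

text \<open>The complement of \<open>C\<close> completes the finite cover, and the members of the
  refinement that meet \<open>C\<close> are united by a chosen index; at each point this cannot
  raise the number of members.\<close>

lemma covering_dim_le_shrink:
  assumes dim: "covering_dim_le X n" and fin: "finite J"
    and op: "\<And>j. j \<in> J \<Longrightarrow> openin X (U j)" and C: "closedin X C" and cov: "C \<subseteq> (\<Union>j\<in>J. U j)"
  obtains V where "\<And>j. j \<in> J \<Longrightarrow> openin X (V j)" "\<And>j. j \<in> J \<Longrightarrow> V j \<subseteq> U j" "C \<subseteq> (\<Union>j\<in>J. V j)"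
    "\<And>x. x \<in> topspace X \<Longrightarrow> card {j\<in>J. x \<in> V j} \<le> n + 1"
proof -
  let ?\<U> = "insert (topspace X - C) (U ` J)"
  have "\<Union>?\<U> = topspace X"
  proof
    show "\<Union>?\<U> \<subseteq> topspace X" using op[THEN openin_subset] by auto
    show "topspace X \<subseteq> \<Union>?\<U>" using cov by auto
  qed
  moreover have "openin X U" if "U \<in> ?\<U>" for U
    using that op openin_diff[OF openin_topspace C] by auto
  ultimately have "open_cover_of X ?\<U>"
    unfolding open_cover_of_def by simp
  then obtain \<V> where \<V>: "finite \<V>" "open_cover_of X \<V>" "cover_refines \<V> ?\<U>"
    "\<And>x. x \<in> topspace X \<Longrightarrow> card {V\<in>\<V>. x \<in> V} \<le> n + 1"
    using dim[unfolded covering_dim_le_def, rule_format, of ?\<U>] fin by auto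
  have "\<forall>W\<in>\<V>. W \<inter> C \<noteq> {} \<longrightarrow> (\<exists>j\<in>J. W \<subseteq> U j)"
    using \<V>(3) unfolding cover_refines_def by blast
  then obtain c where c: "\<And>W. W \<in> \<V> \<Longrightarrow> W \<inter> C \<noteq> {} \<Longrightarrow> c W \<in> J \<and> W \<subseteq> U (c W)" by metis
  define V where "V = (\<lambda>j. \<Union>{W\<in>\<V>. W \<inter> C \<noteq> {} \<and> c W = j})"
  have "openin X (V j)" for j
    unfolding V_def using \<V>(2) unfolding open_cover_of_def by blast
  moreover have "V j \<subseteq> U j" for j unfolding V_def using c by blast
  moreover have "C \<subseteq> (\<Union>j\<in>J. V j)"
  proof
    fix x assume x: "x \<in> C"
    then obtain W where "W \<in> \<V>" "x \<in> W"
      using \<V>(2) closedin_subset[OF C] unfolding open_cover_of_def by blast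
    then show "x \<in> (\<Union>j\<in>J. V j)" using c[of W] x unfolding V_def by blast
  qed
  moreover have "card {j\<in>J. x \<in> V j} \<le> n + 1" if x: "x \<in> topspace X" for x
  proof -
    have "{j\<in>J. x \<in> V j} \<subseteq> c ` {V\<in>\<V>. x \<in> V}" unfolding V_def by blast
    then have "card {j\<in>J. x \<in> V j} \<le> card {V\<in>\<V>. x \<in> V}"
      using \<V>(1) by (intro surj_card_le) auto
    then show ?thesis using \<V>(4)[OF x] by linarith
  qed
  ultimately show ?thesis by (intro that[of V])
qed

text \<open>The slabs \<open>{k \<le> h \<le> k + 1}\<close> with \<open>k \<in> P\<close> are pairwise disjoint, so the finite covers
  can be shrunk on all of them at once.\<close>

lemma order_shrink_on_slabs:
  fixes h :: "'a \<Rightarrow> real"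
  assumes C_def: "C = (\<lambda>k::nat. {x\<in>topspace X. h x \<in> {real k..real k + 1}})"
    and dim: "covering_dim_le X n" and h: "continuous_map X euclideanreal h"
    and op: "\<And>j::nat. openin X (Q j)" and cov: "\<And>k. C k \<subseteq> (\<Union>j\<le>k + r. Q j)"
    and P: "\<And>k k'. k \<in> P \<Longrightarrow> k' \<in> P \<Longrightarrow> k \<noteq> k' \<Longrightarrow> C k \<inter> C k' = {}"
  obtains Q' where "\<And>j. openin X (Q' j)" "\<And>j. Q' j \<subseteq> Q j" "\<And>k. C k \<subseteq> (\<Union>j\<le>k + r + 1. Q' j)"
    "\<And>k x. k \<in> P \<Longrightarrow> x \<in> C k \<Longrightarrow> finite {j. x \<in> Q' j} \<and> card {j. x \<in> Q' j} \<le> n + 1"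
proof -
  have Ccl: "closedin X (C k)" for k
    unfolding C_def using h by (intro closedin_continuous_map_preimage[of X euclideanreal]) auto
  have "\<exists>V. (\<forall>j\<in>{..k + r}. openin X (V j) \<and> V j \<subseteq> Q j) \<and> C k \<subseteq> (\<Union>j\<in>{..k+r}. V j) \<and>
       (\<forall>x\<in>topspace X. card {j\<in>{..k+r}. x \<in> V j} \<le> n + 1)" for k
  proof -
    obtain V where "\<And>j. j \<in> {..k + r} \<Longrightarrow> openin X (V j)" "\<And>j. j \<in> {..k + r} \<Longrightarrow> V j \<subseteq> Q j"
      "C k \<subseteq> (\<Union>j\<in>{..k + r}. V j)" "\<And>x. x \<in> topspace X \<Longrightarrow> card {j\<in>{..k + r}. x \<in> V j} \<le> n + 1"
      by (rule covering_dim_le_shrink[OF dim finite_atMost[of "k + r"] op Ccl[of k] cov[of k]]) (iprover intro: that)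
    then show ?thesis by (intro exI[of _ V]) blast
  qed
  then obtain V where V: "\<And>k j. j \<le> k + r \<Longrightarrow> openin X (V k j) \<and> V k j \<subseteq> Q j"
    "\<And>k. C k \<subseteq> (\<Union>j\<le>k+r. V k j)" "\<And>k x. x \<in> topspace X \<Longrightarrow> card {j. j \<le> k+r \<and> x \<in> V k j} \<le> n + 1"
    by (metis (no_types, lifting) atMost_iff Collect_cong)
  define V' where "V' = (\<lambda>k j. if j \<le> k + r then V k j else {})"
  \<comment> \<open>On a slab \<open>C k\<close> with \<open>k \<in> P\<close> the set
    \<open>Q j\<close> is cut down to \<open>V' k j\<close>, elsewhere it is unchanged. The removed
    sets form a locally finite union of closed sets, so \<open>Q' j\<close> stays open.\<close>
  define Q' where "Q' = (\<lambda>j. Q j - (\<Union>k\<in>P. C k - V' k j))"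
  have lfC: "locally_finite_family X P C"
    unfolding locally_finite_family_def
  proof
    fix x assume x: "x \<in> topspace X"
    let ?N = "{y\<in>topspace X. h y \<in> {..<h x + 1}}"
    obtain m :: nat where m: "h x + 1 < real m" using reals_Archimedean2[of "h x + 1"] by blast
    have "openin X ?N" using h by (intro openin_continuous_map_preimage[of X euclideanreal]) auto
    moreover have "x \<in> ?N" using x by simp
    moreover have "finite {k\<in>P. C k \<inter> ?N \<noteq> {}}"
      by (rule finite_subset[of _ "{..m}"]) (use m in \<open>auto simp: C_def\<close>)
    ultimately show "\<exists>N. openin X N \<and> x \<in> N \<and> finite {k\<in>P. C k \<inter> N \<noteq> {}}"
      by blast
  qed
  have "openin X (V' k j)" for k j using V(1) unfolding V'_def by auto
  then have "closedin X (\<Union>k\<in>P. C k - V' k j)" for j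
    by (intro closedin_locally_finite_family_Union[OF locally_finite_family_mono[OF lfC]]
        closedin_diff[OF Ccl]) auto
  then have op': "openin X (Q' j)" for j
    unfolding Q'_def by (rule openin_diff[OF op])
  have inV: "x \<in> Q' j \<Longrightarrow> j \<le> k + r \<and> x \<in> V k j" if "k \<in> P" "x \<in> C k" for k x j
    using that unfolding Q'_def V'_def by (auto split: if_splits)
  \<comment> \<open>A point of \<open>C k\<close> with \<open>h x = k + 1\<close> also lies in
    \<open>C (k + 1)\<close>; if \<open>k + 1 \<in> P\<close>, the members left at this point have
    indices up to \<open>k + 1 + r\<close>. Hence the additional 1.\<close>
  have "C k \<subseteq> (\<Union>j\<le>k + r + 1. Q' j)" for k
  proof
    fix x assume x: "x \<in> C k"
    show "x \<in> (\<Union>j\<le>k + r + 1. Q' j)"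
    proof (cases "\<exists>k'\<in>P. x \<in> C k'")
      case False
      then show ?thesis using cov[of k] x unfolding Q'_def by fastforce
    next
      case True
      then obtain k' where k': "k' \<in> P" "x \<in> C k'" by blast
      then obtain j where j: "j \<le> k' + r" "x \<in> V k' j" using V(2)[of k'] by blast
      have "k' \<le> k + 1" using x k'(2) unfolding C_def by auto
      moreover have "k'' = k'" if "k'' \<in> P" "x \<in> C k''" for k'' using P[OF that(1) k'(1)] that(2) k'(2) by blast
      then have "x \<in> Q' j" using j V(1)[OF j(1)] unfolding Q'_def V'_def by auto
      ultimately show ?thesis using j(1) by (intro UN_I[of j]) auto
    qed
  qed
  moreover have "finite {j. x \<in> Q' j} \<and> card {j. x \<in> Q' j} \<le> n + 1" if "k \<in> P" "x \<in> C k" for k x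
  proof -
    have sub: "{j. x \<in> Q' j} \<subseteq> {j. j \<le> k + r \<and> x \<in> V k j}" using inV[OF that] by blast
    have fin: "finite {j. j \<le> k + r \<and> x \<in> V k j}" by simp
    have "x \<in> topspace X" using that unfolding C_def by simp
    then show ?thesis
      using card_mono[OF fin sub] V(3)[of x k] finite_subset[OF sub fin] by linarith
  qed
  moreover have "Q' j \<subseteq> Q j" for j unfolding Q'_def by blast
  ultimately show ?thesis by (intro that[of Q'] op')
qed

text \<open>The average \<open>h\<close> of the indices, weighted by a partition of unity, cuts the
  space into slabs each covered by finitely many \<open>Q j\<close>, where the dimension applies.
  Neighbouring slabs meet, so the even ones are treated first and then the odd ones; the second pass
  only shrinks the members and so keeps the order reached on the even slabs.\<close>

lemma Dowker_countable_cover: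
  assumes X: "paracompact_space X" and dim: "covering_dim_le X n"
    and op: "\<And>j::nat. openin X (Q j)" and cov: "topspace X \<subseteq> (\<Union>j. Q j)"
  obtains Q' where "\<And>j. openin X (Q' j)" "\<And>j. Q' j \<subseteq> Q j" "topspace X \<subseteq> (\<Union>j. Q' j)"
    "\<And>x. x \<in> topspace X \<Longrightarrow> finite {j. x \<in> Q' j}"
    "\<And>x. x \<in> topspace X \<Longrightarrow> card {j. x \<in> Q' j} \<le> n + 1"
proof -
  obtain q where q: "partition_of_unity X UNIV Q q"
    using paracompact_partition_of_unity[OF X, of UNIV Q] op cov by blast
  note q = partition_of_unityD[OF q]
  define h where "h = (\<lambda>x. \<Sum>j | j \<in> UNIV \<and> q j x \<noteq> 0. q j x * real j)"
  have h: "continuous_map X euclideanreal h"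
    unfolding h_def by (rule continuous_map_locally_finite_sum[OF q(2)]) (auto intro!: continuous_map_real_mult q(1))
  define C where "C = (\<lambda>k::nat. {x\<in>topspace X. h x \<in> {real k..real k + 1}})"
  \<comment> \<open>If \<open>x\<close> lies in no \<open>Q j\<close> with
    \<open>j \<le> k + 1\<close>, all indices averaged in \<open>h x\<close> are at least
    \<open>k + 2\<close>, while \<open>h x \<le> k + 1\<close> on \<open>C k\<close>.\<close>
  have cov1: "C k \<subseteq> (\<Union>j\<le>k + 1. Q j)" for k
  proof (rule subsetI, rule ccontr)
    fix x assume x: "x \<in> C k" and nx: "x \<notin> (\<Union>j\<le>k + 1. Q j)"
    then have xX: "x \<in> topspace X" unfolding C_def by simp
    have "real (k + 2) = (\<Sum>j | j \<in> UNIV \<and> q j x \<noteq> 0. q j x * real (k + 2))"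
      using q(6)[OF xX] by (simp add: sum_distrib_right[symmetric])
    also have "\<dots> \<le> h x"
      unfolding h_def
    proof (intro sum_mono mult_left_mono)
      fix j assume j: "j \<in> {j. j \<in> UNIV \<and> q j x \<noteq> 0}"
      then have "x \<in> Q j" using q(4)[of j x] xX by blast
      then have "\<not> j \<le> k + 1" using nx by blast
      then show "real (k + 2) \<le> real j" by linarith
      show "0 \<le> q j x" using q(3)[OF _ xX] by blast
    qed
    finally show False using x unfolding C_def by simp
  qed
  have h0: "0 \<le> h x" if "x \<in> topspace X" for x
    unfolding h_def using q(3)[OF _ that] by (intro sum_nonneg) auto
  have inC: "\<exists>k. x \<in> C k" if "x \<in> topspace X" for x
  proof -
    have "0 \<le> \<lfloor>h x\<rfloor>" using h0[OF that] by simp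
    then have "real (nat \<lfloor>h x\<rfloor>) = of_int \<lfloor>h x\<rfloor>" by simp
    then have "x \<in> C (nat \<lfloor>h x\<rfloor>)" using that unfolding C_def by auto
    then show ?thesis by blast
  qed
  have dis: "C k \<inter> C k' = {}" if "k \<noteq> k'" "even k = even k'" for k k'
  proof -
    have "k + 1 < k' \<or> k' + 1 < k" using that by presburger
    then show ?thesis unfolding C_def by auto
  qed
  obtain Q1 where Q1: "\<And>j. openin X (Q1 j)" "\<And>j. Q1 j \<subseteq> Q j" "\<And>k. C k \<subseteq> (\<Union>j\<le>k + 1 + 1. Q1 j)"
    "\<And>k x. k \<in> {k. even k} \<Longrightarrow> x \<in> C k \<Longrightarrow> finite {j. x \<in> Q1 j} \<and> card {j. x \<in> Q1 j} \<le> n + 1"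
    by (rule order_shrink_on_slabs[OF C_def dim h op cov1, of "{k. even k}"])
      (use dis in blast)+
  have cov2: "C k \<subseteq> (\<Union>j\<le>k + 2. Q1 j)" for k using Q1(3)[of k] by simp
  obtain Q2 where Q2: "\<And>j. openin X (Q2 j)" "\<And>j. Q2 j \<subseteq> Q1 j" "\<And>k. C k \<subseteq> (\<Union>j\<le>k + 2 + 1. Q2 j)"
    "\<And>k x. k \<in> {k. odd k} \<Longrightarrow> x \<in> C k \<Longrightarrow> finite {j. x \<in> Q2 j} \<and> card {j. x \<in> Q2 j} \<le> n + 1"
    by (rule order_shrink_on_slabs[OF C_def dim h Q1(1) cov2, of "{k. odd k}"])
      (use dis in blast)+
  show ?thesis
  proof (rule that[of Q2])
    show "Q2 j \<subseteq> Q j" for j using Q1(2) Q2(2) by blast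
    show "topspace X \<subseteq> (\<Union>j. Q2 j)"
    proof
      fix x assume "x \<in> topspace X"
      then obtain k where "x \<in> C k" using inC[of x] by blast
      then show "x \<in> (\<Union>j. Q2 j)" using Q2(3)[of k] by blast
    qed
    have "finite {j. x \<in> Q2 j} \<and> card {j. x \<in> Q2 j} \<le> n + 1" if x: "x \<in> topspace X" for x
    proof -
      obtain k where k: "x \<in> C k" using inC[OF x] by blast
      show ?thesis
      proof (cases "even k")
        case True
        then have 1: "finite {j. x \<in> Q1 j}" "card {j. x \<in> Q1 j} \<le> n + 1" using Q1(4)[of k x] k by auto
        have 2: "{j. x \<in> Q2 j} \<subseteq> {j. x \<in> Q1 j}" using Q2(2) by blast
        show ?thesis using 1(2) finite_subset[OF 2 1(1)] card_mono[OF 1(1) 2] by linarith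
      next
        case False then show ?thesis using Q2(4)[of k x] k by auto
      qed
    qed
    then show "finite {j. x \<in> Q2 j}" "card {j. x \<in> Q2 j} \<le> n + 1" if "x \<in> topspace X" for x
      using that by blast+
  qed (use Q2(1) in blast)
qed

text \<open>The dominance sets of \<open>p\<close> for index sets of one size \<open>m\<close> are
  disjoint, but \<open>m\<close> is unbounded. The countable cover by their unions
  \<open>Q m\<close> has a refinement of order at most \<open>n + 1\<close>, and the dominance sets
  of a partition of unity \<open>q\<close> for that refinement need only index sets of size 1 to
  \<open>n + 1\<close>. These sizes are the colours, and intersecting the two kinds of dominance
  sets gives disjointness within a colour.\<close>

lemma coloured_refinement:
  assumes X: "paracompact_space X" and dim: "covering_dim_le X n"
    and op: "\<And>j. j \<in> J \<Longrightarrow> openin X (U j)" and cov: "topspace X \<subseteq> (\<Union>j\<in>J. U j)"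
  obtains G :: "nat \<Rightarrow> 'j \<Rightarrow> 'a set" where
    "\<And>i j. openin X (G i j)" "\<And>i j. j \<in> J \<Longrightarrow> G i j \<subseteq> U j"
    "\<And>i j j'. j \<noteq> j' \<Longrightarrow> G i j \<inter> G i j' = {}"
    "topspace X \<subseteq> (\<Union>i\<le>n. \<Union>j\<in>J. G i j)"
proof -
  obtain p where p: "partition_of_unity X J U p"
    using paracompact_partition_of_unity[OF X op cov] .
  define W where "W = dominance_set X J p"
  define \<T> where "\<T> = (\<lambda>m. {T. finite T \<and> T \<noteq> {} \<and> T \<subseteq> J \<and> card T = m})"
  define Q where "Q = (\<lambda>m. \<Union>T\<in>\<T> m. W T)"
  have opW: "openin X (W T)" if "T \<in> \<T> m" for T m
    using that openin_dominance_set[OF p] unfolding W_def \<T>_def by blast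
  then have opQ: "openin X (Q m)" for m unfolding Q_def by blast
  have covQ: "topspace X \<subseteq> (\<Union>m. Q m)"
  proof
    fix x assume x: "x \<in> topspace X"
    obtain T where "finite T" "T \<noteq> {}" "T \<subseteq> J" "x \<in> dominance_set X J p T" "\<And>s. s \<in> T \<Longrightarrow> x \<in> U s"
      by (rule dominance_set_cover[OF p x]) (iprover intro: that)
    then show "x \<in> (\<Union>m. Q m)" unfolding Q_def W_def \<T>_def by blast
  qed
  obtain Q' where Q': "\<And>j. openin X (Q' j)" "\<And>j. Q' j \<subseteq> Q j" "topspace X \<subseteq> (\<Union>j. Q' j)"
    "\<And>x. x \<in> topspace X \<Longrightarrow> finite {j. x \<in> Q' j}"
    "\<And>x. x \<in> topspace X \<Longrightarrow> card {j. x \<in> Q' j} \<le> n + 1"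
    by (rule Dowker_countable_cover[OF X dim opQ covQ]) (iprover intro: that)
  obtain q where q: "partition_of_unity X UNIV Q' q"
    using paracompact_partition_of_unity[OF X, of UNIV Q'] Q'(1,3) by blast
  \<comment> \<open>The index sets are nonempty, so colour \<open>i\<close> collects those of size
    \<open>Suc i\<close>. Any element of \<open>T\<close> could be the label; \<open>Min T\<close>
    fixes one, which puts \<open>H i m\<close> inside \<open>Q' m\<close>.\<close>
  define \<S> where "\<S> = (\<lambda>i m. {T::nat set. finite T \<and> card T = Suc i \<and> Min T = m})"
  define H where "H = (\<lambda>i m. \<Union>T\<in>\<S> i m. dominance_set X UNIV q T)"
  have opH: "openin X (H i m)" for i m
    unfolding H_def \<S>_def using openin_dominance_set[OF q] by blast
  have HQ: "H i m \<subseteq> Q m" for i m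
  proof -
    have "dominance_set X UNIV q T \<subseteq> Q' m" if "T \<in> \<S> i m" for T
    proof -
      have "T \<noteq> {}" using that unfolding \<S>_def by auto
      then have "m \<in> T" using that Min_in unfolding \<S>_def by blast
      then show ?thesis by (intro dominance_set_subset[OF q]) auto
    qed
    then show ?thesis unfolding H_def using Q'(2) by blast
  qed
  have Hdis: "H i m \<inter> H i m' = {}" if "m \<noteq> m'" for i m m'
  proof -
    have "dominance_set X UNIV q T \<inter> dominance_set X UNIV q T' = {}" if "T \<in> \<S> i m" "T' \<in> \<S> i m'" for T T'
      by (rule dominance_set_disjoint) (use that \<open>m \<noteq> m'\<close> in \<open>auto simp: \<S>_def\<close>)
    then show ?thesis unfolding H_def by blast
  qed
  have Hcov: "\<exists>i\<le>n. \<exists>m. x \<in> H i m" if x: "x \<in> topspace X" for x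
  proof -
    obtain T where T: "finite T" "T \<noteq> {}" "T \<subseteq> UNIV" "x \<in> dominance_set X UNIV q T" "\<And>s. s \<in> T \<Longrightarrow> x \<in> Q' s"
      by (rule dominance_set_cover[OF q x]) (iprover intro: that)
    have fin: "finite {j. x \<in> Q' j}" and le: "card {j. x \<in> Q' j} \<le> n + 1" using Q'(4,5)[OF x] by auto
    have "T \<subseteq> {j. x \<in> Q' j}" using T(5) by blast
    then have "card T \<le> n + 1" by (rule order_trans[OF card_mono[OF fin] le])
    moreover have "card T > 0" using T(1,2) by (simp add: card_gt_0_iff)
    ultimately have "card T - 1 \<le> n" "card T = Suc (card T - 1)" by linarith+
    then show ?thesis using T(1,4) unfolding H_def \<S>_def by blast
  qed
  \<comment> \<open>\<open>W T\<close> lies in every \<open>U s\<close> with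
    \<open>s \<in> T\<close>; the choice function assigns it to one of them only, as disjointness
    requires.\<close>
  obtain c where c: "\<And>T::'j set. T \<noteq> {} \<Longrightarrow> c T \<in> T" by (metis ex_in_conv)
  define G where "G = (\<lambda>i j. \<Union>m. \<Union>T\<in>{T\<in>\<T> m. c T = j}. H i m \<inter> W T)"
  show ?thesis
  proof (rule that[of G])
    show "openin X (G i j)" for i j unfolding G_def using opH opW by blast
    show "G i j \<subseteq> U j" if "j \<in> J" for i j
    proof -
      have "W T \<subseteq> U (c T)" if "T \<in> \<T> m" for T m
        unfolding W_def by (rule dominance_set_subset[OF p]) (use that c in \<open>auto simp: \<T>_def\<close>)
      then show ?thesis unfolding G_def by blast
    qed
    show "G i j \<inter> G i j' = {}" if "j \<noteq> j'" for i j j'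
    proof -
      have "(H i m \<inter> W T) \<inter> (H i m' \<inter> W T') = {}"
        if "T \<in> \<T> m" "c T = j" "T' \<in> \<T> m'" "c T' = j'" for m m' T T'
      proof (cases "m = m'")
        case True
        have "W T \<inter> W T' = {}" unfolding W_def
          by (rule dominance_set_disjoint) (use that \<open>j \<noteq> j'\<close> True in \<open>auto simp: \<T>_def\<close>)
        then show ?thesis by blast
      qed (use Hdis in blast)
      then show ?thesis unfolding G_def by blast
    qed
    show "topspace X \<subseteq> (\<Union>i\<le>n. \<Union>j\<in>J. G i j)"
    proof
      fix x assume "x \<in> topspace X"
      then obtain i m where im: "i \<le> n" "x \<in> H i m" using Hcov by blast
      then obtain T where T: "T \<in> \<T> m" "x \<in> W T" using HQ unfolding Q_def by blast
      have "c T \<in> J" using T(1) c unfolding \<T>_def by blast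
      then show "x \<in> (\<Union>i\<le>n. \<Union>j\<in>J. G i j)" using im T unfolding G_def by blast
    qed
  qed
qed

text \<open>The covers have a common refinement indexed by the choices \<open>f\<close> of one
  member from each. In its coloured refinement, colour \<open>i\<close> reads only the value
  \<open>f i\<close>; sets of colour \<open>i\<close> with different values come from different
  \<open>f\<close> and are disjoint.\<close>

lemma simultaneous_coloured_refinement:
  assumes X: "paracompact_space X" and dim: "covering_dim_le X n"
    and op: "\<And>i j. i \<le> n \<Longrightarrow> j \<in> J \<Longrightarrow> openin X (U i j)"
    and cov: "\<And>i. i \<le> n \<Longrightarrow> topspace X \<subseteq> (\<Union>j\<in>J. U i j)"
  obtains G :: "nat \<Rightarrow> 'j \<Rightarrow> 'a set" where
    "\<And>i j. openin X (G i j)" "\<And>i j. i \<le> n \<Longrightarrow> j \<in> J \<Longrightarrow> G i j \<subseteq> U i j"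
    "\<And>i j j'. j \<noteq> j' \<Longrightarrow> G i j \<inter> G i j' = {}"
    "topspace X \<subseteq> (\<Union>i\<le>n. \<Union>j\<in>J. G i j)"
proof -
  let ?J = "PiE {..n} (\<lambda>_. J)"
  let ?U = "\<lambda>f. \<Inter>i\<le>n. U i (f i)"
  have 1: "openin X (?U f)" if "f \<in> ?J" for f
    using that op by (intro openin_INT2) (auto simp: PiE_iff)
  have 2: "topspace X \<subseteq> (\<Union>f\<in>?J. ?U f)"
  proof
    fix x assume "x \<in> topspace X"
    then have "\<forall>i\<in>{..n}. \<exists>j. j \<in> J \<and> x \<in> U i j" using cov by blast
    then obtain f where "\<forall>i\<in>{..n}. f i \<in> J \<and> x \<in> U i (f i)" by metis
    then show "x \<in> (\<Union>f\<in>?J. ?U f)" by (intro UN_I[of "restrict f {..n}"]) auto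
  qed
  show ?thesis
  proof (rule coloured_refinement[OF X dim 1 2])
    fix H :: "nat \<Rightarrow> (nat \<Rightarrow> 'j) \<Rightarrow> 'a set"
    assume H: "\<And>i f. openin X (H i f)" "\<And>i f. f \<in> ?J \<Longrightarrow> H i f \<subseteq> ?U f"
      "\<And>i f f'. f \<noteq> f' \<Longrightarrow> H i f \<inter> H i f' = {}" "topspace X \<subseteq> (\<Union>i\<le>n. \<Union>f\<in>?J. H i f)"
    define G where "G = (\<lambda>i j. \<Union>f\<in>{f\<in>?J. f i = j}. H i f)"
    show thesis
    proof (rule that[of G])
      show "openin X (G i j)" for i j unfolding G_def using H(1) by blast
      show "G i j \<subseteq> U i j" if "i \<le> n" "j \<in> J" for i j unfolding G_def using H(2) that by blast
      show "G i j \<inter> G i j' = {}" if "j \<noteq> j'" for i j j'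
      proof -
        have "H i f \<inter> H i f' = {}" if "f i = j" "f' i = j'" for f f'
          by (rule H(3)) (use that \<open>j \<noteq> j'\<close> in blast)
        then show ?thesis unfolding G_def by blast
      qed
      show "topspace X \<subseteq> (\<Union>i\<le>n. \<Union>j\<in>J. G i j)"
      proof
        fix x assume "x \<in> topspace X"
        then obtain i f where "i \<le> n" "f \<in> ?J" "x \<in> H i f" using H(4) by blast
        moreover from this have "f i \<in> J" by auto
        ultimately show "x \<in> (\<Union>i\<le>n. \<Union>j\<in>J. G i j)" unfolding G_def by blast
      qed
    qed
  qed
qed

section \<open>A complete metric on the product with convex balls\<close>

lemma continuous_map_scaleR:
  fixes f :: "'a \<Rightarrow> 'b::real_normed_vector"
  assumes "continuous_map X euclideanreal t" "continuous_map X euclidean f"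
  shows "continuous_map X euclidean (\<lambda>x. t x *\<^sub>R f x)"
  using assms by (simp add: continuous_map_atin tendsto_scaleR)

locale banach_product =
  fixes I :: "'i set" and E :: "'i \<Rightarrow> 'b::real_normed_vector set"
  assumes countable_I: "countable I"
    and banach: "\<And>i. i \<in> I \<Longrightarrow> banach_subspace (E i)"
begin

abbreviation "Y \<equiv> prod_space I E"

definition weight :: "'i \<Rightarrow> real" where "weight i = (1/2) ^ to_nat_on I i"

text \<open>The element \<open>0\<close> is inserted because the supremum of the empty set is unspecified
  and \<open>I\<close> may be empty.\<close>

definition pdist :: "('i \<Rightarrow> 'b) \<Rightarrow> ('i \<Rightarrow> 'b) \<Rightarrow> real" where
  "pdist y z = Sup (insert 0 ((\<lambda>i. min (weight i) (norm (y i - z i))) ` I))"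

lemma subspace_E: "i \<in> I \<Longrightarrow> subspace (E i)" and complete_E: "i \<in> I \<Longrightarrow> complete (E i)"
  using banach unfolding banach_subspace_def by blast+

lemma weight_pos: "0 < weight i"
  unfolding weight_def by simp

lemma pdist_le_iff: "pdist y z \<le> r \<longleftrightarrow> 0 \<le> r \<and> (\<forall>i\<in>I. min (weight i) (norm (y i - z i)) \<le> r)"
proof -
  have "weight i \<le> 1" for i unfolding weight_def by (simp add: power_le_one)
  then have "bdd_above (insert 0 ((\<lambda>i. min (weight i) (norm (y i - z i))) ` I))"
    unfolding bdd_above_def by (intro exI[of _ 1]) (auto intro: min.coboundedI1)
  then show ?thesis unfolding pdist_def by (subst cSup_le_iff) auto
qed

lemma pdist_component: "i \<in> I \<Longrightarrow> min (weight i) (norm (y i - z i)) \<le> pdist y z"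
  and pdist_nonneg: "0 \<le> pdist y z"
  using pdist_le_iff[of y z "pdist y z"] by auto

text \<open>The condition \<open>pdist y z \<le> r\<close> constrains only coordinates of weight
  above \<open>r\<close>; that these are finitely many ties the metric to the product
  topology.\<close>

lemma finite_weight_gt:
  assumes "0 < r" shows "finite {i\<in>I. r < weight i}"
proof -
  obtain N where N: "(1/2::real) ^ N < r" using real_arch_pow_inv[of r "1/2"] assms by auto
  have "to_nat_on I i < N" if "r < weight i" for i
  proof (rule ccontr)
    assume "\<not> to_nat_on I i < N"
    then have "weight i \<le> (1/2) ^ N" unfolding weight_def by (intro power_decreasing) auto
    then show False using that N by simp
  qed
  then have "to_nat_on I ` {i\<in>I. r < weight i} \<subseteq> {..<N}" by auto
  moreover have "inj_on (to_nat_on I) {i\<in>I. r < weight i}"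
    using inj_on_to_nat_on[OF countable_I] by (rule inj_on_subset) auto
  ultimately show ?thesis by (meson finite_imageD finite_lessThan finite_subset)
qed

sublocale P: Metric_space "topspace (prod_space I E)" pdist
proof
  fix x y z
  show "0 \<le> pdist x y" by (rule pdist_nonneg)
  show "pdist x y = pdist y x" unfolding pdist_def by (simp add: norm_minus_commute)
  show "pdist x y = 0 \<longleftrightarrow> x = y" if "x \<in> topspace Y" "y \<in> topspace Y"
  proof
    assume "pdist x y = 0"
    then have "norm (x i - y i) \<le> 0" if "i \<in> I" for i
      using pdist_component[OF that, of x y] weight_pos[of i] by (auto simp: min_def split: if_splits)
    then show "x = y" using that unfolding topspace_prod_space by (intro PiE_ext) auto
  next
    assume "x = y"
    then show "pdist x y = 0"
      using pdist_le_iff[of x y 0] pdist_nonneg[of x y] weight_pos by (auto simp: less_imp_le)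
  qed
  show "pdist x z \<le> pdist x y + pdist y z"
    unfolding pdist_le_iff[of x z]
  proof (intro conjI ballI)
    fix i assume i: "i \<in> I"
    have "norm (x i - z i) \<le> norm (x i - y i) + norm (y i - z i)"
      using norm_triangle_ineq[of "x i - y i" "y i - z i"] by simp
    then show "min (weight i) (norm (x i - z i)) \<le> pdist x y + pdist y z"
      using pdist_component[OF i, of x y] pdist_component[OF i, of y z] weight_pos[of i]
        pdist_nonneg[of x y] pdist_nonneg[of y z]
      by (auto simp: min_def split: if_splits)
  qed (simp add: pdist_nonneg)
qed

lemma mtopology_pdist: "P.mtopology = Y"
  unfolding topology_eq
proof (intro allI iffI)
  fix U assume U: "openin Y U"
  show "openin P.mtopology U"
    unfolding P.openin_mtopology
  proof (intro conjI allI impI)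
    show "U \<subseteq> topspace Y" using U by (rule openin_subset)
    fix x assume x: "x \<in> U"
    obtain V where V: "finite {i\<in>I. V i \<noteq> E i}" "\<And>i. i \<in> I \<Longrightarrow> openin (top_of_set (E i)) (V i)"
      "x \<in> PiE I V" "PiE I V \<subseteq> U"
      using U x unfolding prod_space_def openin_product_topology_alt by auto
    let ?K = "{i\<in>I. V i \<noteq> E i}"
    have "\<exists>e>0. \<forall>z\<in>E i. norm (x i - z) < e \<longrightarrow> z \<in> V i" if i: "i \<in> I" for i
    proof -
      have "x i \<in> V i" using V(3) i by auto
      then obtain e where "e > 0" "ball (x i) e \<inter> E i \<subseteq> V i"
        using V(2)[OF i] unfolding openin_contains_ball by blast
      then show ?thesis by (intro exI[of _ e]) (auto simp: dist_norm)
    qed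
    then obtain e where e: "\<And>i. i \<in> I \<Longrightarrow> e i > 0" "\<And>i z. i \<in> I \<Longrightarrow> z \<in> E i \<Longrightarrow> norm (x i - z) < e i \<Longrightarrow> z \<in> V i"
      by metis
    \<comment> \<open>Below \<open>weight i\<close> the truncation is inactive, and below
      \<open>e i\<close> the coordinate stays in \<open>V i\<close>; the 1 is for an empty set of
      constrained coordinates.\<close>
    define r where "r = Min (insert 1 ((\<lambda>i. min (e i) (weight i)) ` ?K))"
    have r0: "r > 0" unfolding r_def using V(1) e(1) weight_pos by auto
    have rK: "r \<le> min (e i) (weight i)" if "i \<in> ?K" for i
      unfolding r_def using V(1) that by (intro Min_le) auto
    have "P.mball x r \<subseteq> PiE I V"
    proof
      fix y assume "y \<in> P.mball x r"
      then have y: "y \<in> PiE I E" "pdist x y < r" by (auto simp: topspace_prod_space[symmetric])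
      have "y i \<in> V i" if i: "i \<in> I" for i
      proof (cases "i \<in> ?K")
        case True
        then have "norm (x i - y i) < e i"
          using rK[OF True] pdist_component[OF i, of x y] y(2) by (auto simp: min_def split: if_splits)
        then show ?thesis using e(2)[OF i] y(1) i by auto
      qed (use y i in auto)
      then show "y \<in> PiE I V" using y(1) by (auto simp: PiE_iff)
    qed
    then show "\<exists>r>0. P.mball x r \<subseteq> U" using r0 V(4) by blast
  qed
next
  fix U assume U: "openin P.mtopology U"
  show "openin Y U"
    unfolding prod_space_def openin_product_topology_alt
  proof
    fix x assume x: "x \<in> U"
    then obtain r where r: "r > 0" "P.mball x r \<subseteq> U" using U unfolding P.openin_mtopology by blast
    have xE: "x \<in> PiE I E" using U x unfolding P.openin_mtopology topspace_prod_space[symmetric] by blast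
    \<comment> \<open>Coordinates of weight at most \<open>r/2\<close> satisfy the bound
      \<open>r/2\<close> automatically and are left free.\<close>
    define V where "V = (\<lambda>i. if r/2 < weight i then E i \<inter> ball (x i) (r/2) else E i)"
    have "{i\<in>I. V i \<noteq> topspace (top_of_set (E i))} \<subseteq> {i\<in>I. r/2 < weight i}"
      unfolding V_def by auto
    then have "finite {i\<in>I. V i \<noteq> topspace (top_of_set (E i))}"
      by (rule finite_subset) (rule finite_weight_gt, use r in simp)
    moreover have "\<forall>i\<in>I. openin (top_of_set (E i)) (V i)"
      unfolding V_def by (auto intro: openin_open_Int)
    moreover have "x \<in> PiE I V" using xE r unfolding V_def by (auto simp: PiE_iff)
    moreover have "PiE I V \<subseteq> U"
    proof
      fix y assume y: "y \<in> PiE I V"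
      have "V i \<subseteq> E i" for i unfolding V_def by auto
      then have yE: "y \<in> PiE I E" using y by (auto simp: PiE_iff)
      have "min (weight i) (norm (x i - y i)) \<le> r/2" if "i \<in> I" for i
      proof -
        have "y i \<in> V i" using y that by auto
        then show ?thesis unfolding V_def by (auto simp: dist_norm min_def split: if_splits)
      qed
      then have "pdist x y \<le> r/2" unfolding pdist_le_iff using r(1) by auto
      then have "y \<in> P.mball x r" using xE yE r(1) by (auto simp: topspace_prod_space[symmetric])
      then show "y \<in> U" using r(2) by blast
    qed
    ultimately show "\<exists>V. finite {i\<in>I. V i \<noteq> topspace (top_of_set (E i))} \<and>
        (\<forall>i\<in>I. openin (top_of_set (E i)) (V i)) \<and> x \<in> PiE I V \<and> PiE I V \<subseteq> U" by blast
  qed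
qed

lemma mcomplete_pdist: "P.mcomplete"
  unfolding P.mcomplete_def
proof (intro allI impI)
  fix \<sigma> assume \<sigma>: "P.MCauchy \<sigma>"
  then have \<sigma>E: "\<sigma> n \<in> PiE I E" for n
    unfolding P.MCauchy_def topspace_prod_space[symmetric] by blast
  have "\<exists>l\<in>E i. (\<lambda>n. \<sigma> n i) \<longlonglongrightarrow> l" if i: "i \<in> I" for i
  proof -
    have "Cauchy (\<lambda>n. \<sigma> n i)"
      unfolding Cauchy_def
    proof (intro allI impI)
      fix e :: real assume "e > 0"
      \<comment> \<open>A distance below \<open>weight i\<close> bounds the norm itself and not only
        its truncation.\<close>
      then have "min e (weight i) > 0" using weight_pos by simp
      then obtain N where N: "\<And>n n'. N \<le> n \<Longrightarrow> N \<le> n' \<Longrightarrow> pdist (\<sigma> n) (\<sigma> n') < min e (weight i)"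
        using \<sigma> unfolding P.MCauchy_def by blast
      have "dist (\<sigma> n i) (\<sigma> n' i) < e" if "n \<ge> N" "n' \<ge> N" for n n'
        using N[OF that] pdist_component[OF i, of "\<sigma> n" "\<sigma> n'"]
        by (auto simp: min_def dist_norm split: if_splits)
      then show "\<exists>M. \<forall>m\<ge>M. \<forall>n\<ge>M. dist (\<sigma> m i) (\<sigma> n i) < e" by blast
    qed
    moreover have "\<sigma> n i \<in> E i" for n using \<sigma>E i by auto
    ultimately show ?thesis
      using complete_E[OF i, unfolded complete_def, rule_format, of "\<lambda>n. \<sigma> n i"] by simp
  qed
  then obtain l where l: "\<And>i. i \<in> I \<Longrightarrow> l i \<in> E i" "\<And>i. i \<in> I \<Longrightarrow> (\<lambda>n. \<sigma> n i) \<longlonglongrightarrow> l i" by metis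
  have "limitin (top_of_set (E i)) (\<lambda>n. \<sigma> n i) (l i) sequentially" if "i \<in> I" for i
    using l that \<sigma>E by (auto simp: limitin_subtopology PiE_iff)
  then have "limitin Y \<sigma> (restrict l I) sequentially"
    unfolding prod_space_def limitin_componentwise using \<sigma>E l(1)
    by (auto simp: PiE_iff extensional_def)
  then show "\<exists>x. limitin P.mtopology \<sigma> x sequentially" unfolding mtopology_pdist by blast
qed

section \<open>Convex combinations in the product\<close>

definition mix :: "real \<Rightarrow> ('i \<Rightarrow> 'b) \<Rightarrow> ('i \<Rightarrow> 'b) \<Rightarrow> 'i \<Rightarrow> 'b" where
  "mix t y z = (\<lambda>i\<in>I. (1 - t) *\<^sub>R y i + t *\<^sub>R z i)"

definition comb :: "'s set \<Rightarrow> ('s \<Rightarrow> real) \<Rightarrow> ('s \<Rightarrow> 'i \<Rightarrow> 'b) \<Rightarrow> 'i \<Rightarrow> 'b" where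
  "comb S p y = (\<lambda>i\<in>I. \<Sum>s\<in>S. p s *\<^sub>R y s i)"

lemma convex_in_prod_mix:
  "convex_in_prod I C \<longleftrightarrow> (\<forall>y\<in>C. \<forall>z\<in>C. \<forall>t\<in>{0..1}. mix t y z \<in> C)"
  unfolding convex_in_prod_def mix_def by blast

lemma restrict_topspace: "y \<in> topspace Y \<Longrightarrow> restrict y I = y"
  unfolding topspace_prod_space by (auto simp: PiE_iff extensional_restrict)

lemma mix_0: "y \<in> topspace Y \<Longrightarrow> mix 0 y z = y" and mix_1: "z \<in> topspace Y \<Longrightarrow> mix 1 y z = z"
  using restrict_topspace[of y] restrict_topspace[of z] by (auto simp: mix_def)

lemma mix_same: "y \<in> topspace Y \<Longrightarrow> mix t y y = y"
  using restrict_topspace[of y] by (auto simp: mix_def scaleR_left_distrib[symmetric])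

lemma mix_in_topspace: "y \<in> topspace Y \<Longrightarrow> z \<in> topspace Y \<Longrightarrow> mix t y z \<in> topspace Y"
  using subspace_E unfolding topspace_prod_space mix_def
  by (auto simp: PiE_iff intro!: subspace_add subspace_scale)

lemma comb_in_convex:
  assumes "finite S" and C: "convex_in_prod I C" "C \<subseteq> topspace Y"
  shows "(\<And>s. s \<in> S \<Longrightarrow> y s \<in> C) \<Longrightarrow> (\<And>s. s \<in> S \<Longrightarrow> 0 \<le> p s) \<Longrightarrow> sum p S = 1 \<Longrightarrow> comb S p y \<in> C"
  using assms(1)
proof (induction S arbitrary: p rule: finite_induct)
  case empty then show ?case by simp
next
  case (insert a S)
  have p0: "0 \<le> p s" if "s \<in> insert a S" for s using insert.prems(2)[OF that] .
  have sum1: "p a + sum p S = 1" using insert.prems(3) insert.hyps by simp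
  have Sn: "0 \<le> sum p S" using p0 by (intro sum_nonneg) auto
  have ya: "y a \<in> C" using insert.prems(1) by simp
  show ?case
  \<comment> \<open>The case \<open>p a = 1\<close> is separated because the remaining weights are
    rescaled by \<open>1 - p a\<close>.\<close>
  proof (cases "p a = 1")
    case True
    then have "sum p S = 0" using sum1 by simp
    then have "\<And>s. s \<in> S \<Longrightarrow> p s = 0" using p0 insert.hyps(1) by (simp add: sum_nonneg_eq_0_iff)
    then have "comb (insert a S) p y = restrict (y a) I"
      unfolding comb_def using insert.hyps True by auto
    also have "\<dots> = y a" using ya C(2) by (intro restrict_topspace) auto
    finally show ?thesis using ya by simp
  next
    case False
    then have lt: "p a < 1" using sum1 Sn by simp
    define q where "q = (\<lambda>s. p s / (1 - p a))"
    have "comb S q y \<in> C"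
    proof (rule insert.IH)
      show "sum q S = 1" unfolding q_def sum_divide_distrib[symmetric] using sum1 lt by simp
    qed (use insert.prems(1) p0 lt in \<open>auto simp: q_def\<close>)
    then have "mix (p a) (comb S q y) (y a) \<in> C"
      using C(1) ya lt p0[of a] unfolding convex_in_prod_mix by auto
    moreover have "mix (p a) (comb S q y) (y a) = comb (insert a S) p y"
      unfolding mix_def comb_def using insert.hyps lt
      by (auto simp: q_def scaleR_sum_right add.commute intro!: ext sum.cong)
    ultimately show ?thesis by simp
  qed
qed

text \<open>The bound \<open>r\<close> is checked one coordinate at a time: where
  \<open>weight i \<le> r\<close> it is void, and elsewhere it bounds the norm itself, so the
  triangle inequality applies. This is what the supremum in the metric is for.\<close>

lemma pdist_comb_le:
  assumes S: "finite S" "\<And>s. s \<in> S \<Longrightarrow> 0 \<le> p s" "sum p S = 1"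
    and r: "\<And>s. s \<in> S \<Longrightarrow> pdist (y s) (z s) \<le> r"
  shows "pdist (comb S p y) (comb S p z) \<le> r"
  unfolding pdist_le_iff
proof (intro conjI ballI)
  have "S \<noteq> {}" using S(3) by auto
  then show "0 \<le> r" using r pdist_nonneg order_trans by blast
  fix i assume i: "i \<in> I"
  show "min (weight i) (norm (comb S p y i - comb S p z i)) \<le> r"
  proof (cases "weight i \<le> r")
    case False
    have "norm (y s i - z s i) \<le> r" if "s \<in> S" for s
      using r[OF that] False pdist_component[OF i, of "y s" "z s"] by (auto simp: min_def split: if_splits)
    then have "norm (\<Sum>s\<in>S. p s *\<^sub>R (y s i - z s i)) \<le> (\<Sum>s\<in>S. p s * r)"
      using S(2) by (intro sum_norm_le) (auto intro: mult_left_mono)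
    also have "\<dots> = r" using S(3) by (simp add: sum_distrib_right[symmetric])
    finally show ?thesis
      using i by (simp add: comb_def sum_subtractf scaleR_diff_right min.coboundedI2)
  qed simp
qed

lemma pdist_mix_le:
  assumes "0 \<le> t" "t \<le> 1" "pdist y y' \<le> r" "pdist z z' \<le> r"
  shows "pdist (mix t y z) (mix t y' z') \<le> r"
proof -
  have eq: "mix t y z = comb {False, True} (\<lambda>b. if b then t else 1 - t) (\<lambda>b. if b then z else y)" for y z
    unfolding mix_def comb_def by simp
  show ?thesis unfolding eq by (rule pdist_comb_le) (use assms in auto)
qed

lemma convex_pdist_ball:
  assumes "c \<in> topspace Y"
  shows "convex_in_prod I {y\<in>topspace Y. pdist y c < r}"
proof -
  have "pdist (mix t y z) c < r" if "pdist y c < r" "pdist z c < r" "t \<in> {0..1}" for y z t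
    using pdist_mix_le[of t y c "max (pdist y c) (pdist z c)" z c] that mix_same[OF assms, of t] by auto
  then show ?thesis unfolding convex_in_prod_mix using mix_in_topspace by auto
qed

lemma convex_in_prod_Int: "convex_in_prod I C \<Longrightarrow> convex_in_prod I D \<Longrightarrow> convex_in_prod I (C \<inter> D)"
  unfolding convex_in_prod_def by blast

lemma continuous_map_mix:
  assumes "continuous_map X euclideanreal t" "continuous_map X Y f" "continuous_map X Y g"
  shows "continuous_map X Y (\<lambda>x. mix (t x) (f x) (g x))"
proof -
  have c: "continuous_map X (top_of_set (E i)) (\<lambda>x. f x i)" "continuous_map X (top_of_set (E i)) (\<lambda>x. g x i)"
    if "i \<in> I" for i
    using assms(2,3) that unfolding prod_space_def continuous_map_componentwise by blast+
  have "continuous_map X (top_of_set (E i)) (\<lambda>x. (1 - t x) *\<^sub>R f x i + t x *\<^sub>R g x i)" if i: "i \<in> I" for i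
  proof -
    have "continuous_map X euclidean (\<lambda>x. f x i)" "continuous_map X euclidean (\<lambda>x. g x i)"
      using c[OF i] by (auto intro: continuous_map_into_fulltopology)
    then have "continuous_map X euclidean (\<lambda>x. (1 - t x) *\<^sub>R f x i + t x *\<^sub>R g x i)"
      by (intro continuous_map_add continuous_map_scaleR continuous_map_diff assms(1)) auto
    moreover have "f x i \<in> E i" "g x i \<in> E i" if "x \<in> topspace X" for x
      using continuous_map_funspace[OF c(1)[OF i]] continuous_map_funspace[OF c(2)[OF i]] that by auto
    ultimately show ?thesis
      unfolding continuous_map_in_subtopology
      using subspace_E[OF i] by (auto intro!: subspace_add subspace_scale)
  qed
  then show ?thesis
    unfolding prod_space_def continuous_map_componentwise mix_def
    by (auto intro: continuous_map_eq)
qed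

lemma continuous_map_comb:
  assumes p: "partition_of_unity X J U p" and y: "\<And>j. j \<in> J \<Longrightarrow> y j \<in> topspace Y"
  shows "continuous_map X Y (\<lambda>x. comb {j\<in>J. p j x \<noteq> 0} (\<lambda>j. p j x) y)"
proof -
  note p = partition_of_unityD[OF p]
  have "continuous_map X (top_of_set (E i)) (\<lambda>x. \<Sum>j | j \<in> J \<and> p j x \<noteq> 0. p j x *\<^sub>R y j i)" if i: "i \<in> I" for i
  proof -
    have "continuous_map X euclidean (\<lambda>x. \<Sum>j | j \<in> J \<and> p j x \<noteq> 0. p j x *\<^sub>R y j i)"
      by (rule continuous_map_locally_finite_sum[OF p(2)]) (auto intro!: continuous_map_scaleR p(1))
    moreover have "y j i \<in> E i" if "j \<in> J" for j
      using y[OF that] i unfolding topspace_prod_space by auto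
    ultimately show ?thesis
      unfolding continuous_map_in_subtopology
      using subspace_E[OF i] by (auto intro!: subspace_sum subspace_scale)
  qed
  then show ?thesis
    unfolding prod_space_def continuous_map_componentwise comb_def
    by (auto intro: continuous_map_eq)
qed

end

section \<open>Michael's selection theorem\<close>

context banach_product
begin

lemma closed_convex_setsD:
  assumes "C \<in> closed_convex_sets I E"
  shows "C \<noteq> {}" "closedin Y C" "convex_in_prod I C" "C \<subseteq> topspace Y"
  using assms closedin_subset unfolding closed_convex_sets_def by auto

lemma lower_semicontinuous_subtopology:
  assumes "lower_semicontinuous X Y \<phi>"
  shows "lower_semicontinuous (subtopology X A) Y \<phi>"
  unfolding lower_semicontinuous_def
proof (intro allI impI)
  fix U assume "openin Y U"
  then have "openin X {x\<in>topspace X. \<phi> x \<inter> U \<noteq> {}}"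
    using assms unfolding lower_semicontinuous_def by blast
  moreover have "{x\<in>topspace (subtopology X A). \<phi> x \<inter> U \<noteq> {}} = {x\<in>topspace X. \<phi> x \<inter> U \<noteq> {}} \<inter> A"
    by auto
  ultimately show "openin (subtopology X A) {x\<in>topspace (subtopology X A). \<phi> x \<inter> U \<noteq> {}}"
    unfolding openin_subtopology by blast
qed

text \<open>At \<open>x\<close> only centres within \<open>e\<close> of \<open>\<phi> x\<close> are
  active; combining the corresponding points of \<open>\<phi> x\<close> with the same coefficients
  gives a point of \<open>\<phi> x\<close> close to \<open>f x\<close>. The values are merely convex
  because the lemma is applied to intersections with open balls.\<close>

lemma approximate_selection:
  assumes X: "paracompact_space X" and lsc: "lower_semicontinuous X Y \<phi>"
    and ne: "\<And>x. x \<in> topspace X \<Longrightarrow> \<phi> x \<noteq> {}"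
    and sub: "\<And>x. x \<in> topspace X \<Longrightarrow> \<phi> x \<subseteq> topspace Y"
    and conv: "\<And>x. x \<in> topspace X \<Longrightarrow> convex_in_prod I (\<phi> x)"
    and e: "0 < e"
  obtains f where "continuous_map X Y f" "\<And>x. x \<in> topspace X \<Longrightarrow> \<exists>y\<in>\<phi> x. pdist y (f x) < e"
proof -
  define U where "U = (\<lambda>y. {x\<in>topspace X. \<phi> x \<inter> P.mball y e \<noteq> {}})"
  have "openin X (U y)" for y
    using lsc P.openin_mball[of y e] unfolding lower_semicontinuous_def U_def mtopology_pdist by blast
  moreover have "topspace X \<subseteq> (\<Union>y\<in>topspace Y. U y)"
  proof
    fix x assume x: "x \<in> topspace X"
    then obtain y where y: "y \<in> \<phi> x" using ne by blast
    then have "y \<in> topspace Y" using sub[OF x] by blast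
    then show "x \<in> (\<Union>y\<in>topspace Y. U y)" unfolding U_def using x y e by (intro UN_I[of y]) auto
  qed
  ultimately obtain p where p: "partition_of_unity X (topspace Y) U p"
    using paracompact_partition_of_unity[OF X, of "topspace Y" U] by blast
  note p' = partition_of_unityD[OF p]
  define f where "f = (\<lambda>x. comb {j\<in>topspace Y. p j x \<noteq> 0} (\<lambda>j. p j x) (\<lambda>y. y))"
  show ?thesis
  proof (rule that[of f])
    show "continuous_map X Y f" unfolding f_def by (rule continuous_map_comb[OF p])
    fix x assume x: "x \<in> topspace X"
    let ?S = "{j\<in>topspace Y. p j x \<noteq> 0}"
    have fin: "finite ?S" using p'(5)[OF x] .
    have sum1: "(\<Sum>j\<in>?S. p j x) = 1" using p'(6)[OF x] .
    then have ne: "?S \<noteq> {}" by (metis sum.empty zero_neq_one)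
    have "\<exists>z. z \<in> \<phi> x \<and> pdist z s < e" if "s \<in> ?S" for s
    proof -
      have "x \<in> U s" using p'(4)[of s x] that x by blast
      then show ?thesis unfolding U_def by (auto simp: P.commute)
    qed
    then have "\<forall>s\<in>?S. \<exists>z. z \<in> \<phi> x \<and> pdist z s < e" by simp
    from bchoice[OF this] obtain z where "\<forall>s\<in>?S. z s \<in> \<phi> x \<and> pdist (z s) s < e" ..
    then have z: "z s \<in> \<phi> x" "pdist (z s) s < e" if "s \<in> ?S" for s using that by simp_all
    \<comment> \<open>The maximum over the finite set of active centres restores strictness, since
      \<open>pdist_comb_le\<close> has a weak bound.\<close>
    define r where "r = Max ((\<lambda>s. pdist (z s) s) ` ?S)"
    have "r < e" unfolding r_def using fin ne z(2) by (subst Max_less_iff) auto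
    moreover have "pdist (comb ?S (\<lambda>j. p j x) z) (f x) \<le> r"
      unfolding f_def
      by (rule pdist_comb_le[OF fin _ sum1]) (use p'(3)[OF _ x] fin in \<open>auto simp: r_def\<close>)
    moreover have "comb ?S (\<lambda>j. p j x) z \<in> \<phi> x"
      by (rule comb_in_convex[OF fin conv[OF x] sub[OF x]]) (use z(1) p'(3)[OF _ x] sum1 in auto)
    ultimately show "\<exists>y\<in>\<phi> x. pdist y (f x) < e"
      by (intro bexI[of _ "comb ?S (\<lambda>j. p j x) z"]) auto
  qed
qed

lemma lower_semicontinuous_Int_ball:
  assumes lsc: "lower_semicontinuous X Y \<phi>" and f: "continuous_map X Y f"
  shows "lower_semicontinuous X Y (\<lambda>x. \<phi> x \<inter> {y\<in>topspace Y. pdist y (f x) < e})"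
  unfolding lower_semicontinuous_def
proof (intro allI impI)
  fix U assume U: "openin Y U"
  let ?A = "{x\<in>topspace X. \<phi> x \<inter> {y\<in>topspace Y. pdist y (f x) < e} \<inter> U \<noteq> {}}"
  have fX: "f x \<in> topspace Y" if "x \<in> topspace X" for x
    using continuous_map_funspace[OF f] that by blast
  show "openin X ?A"
  proof (subst openin_subopen, intro ballI)
    fix x0 assume "x0 \<in> ?A"
    then obtain y0 where y0: "x0 \<in> topspace X" "y0 \<in> \<phi> x0" "y0 \<in> topspace Y" "pdist y0 (f x0) < e" "y0 \<in> U" by blast
    \<comment> \<open>Half of the slack: one \<open>r\<close> for moving \<open>y0\<close> to
      \<open>y\<close>, the other for moving \<open>f x0\<close> to \<open>f x\<close>.\<close>
    define r where "r = (e - pdist y0 (f x0)) / 2"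
    have r: "r > 0" "pdist y0 (f x0) + 2 * r = e" using y0(4) unfolding r_def by (auto simp: field_simps)
    let ?W1 = "{x\<in>topspace X. \<phi> x \<inter> (U \<inter> P.mball y0 r) \<noteq> {}}"
    let ?W2 = "{x\<in>topspace X. f x \<in> P.mball (f x0) r}"
    have ob: "openin Y (P.mball y r)" for y using P.openin_mball[of y r] by (simp add: mtopology_pdist)
    have "openin X ?W1"
      using lsc openin_Int[OF U ob[of y0]] unfolding lower_semicontinuous_def by blast
    moreover have "openin X ?W2" using ob by (rule openin_continuous_map_preimage[OF f])
    ultimately
    have "openin X (?W1 \<inter> ?W2)" by blast
    moreover have "x0 \<in> ?W1 \<inter> ?W2" using y0 r fX by auto
    moreover have "?W1 \<inter> ?W2 \<subseteq> ?A"
    proof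
      fix x assume "x \<in> ?W1 \<inter> ?W2"
      then obtain y where y: "x \<in> topspace X" "y \<in> \<phi> x" "y \<in> U" "y \<in> topspace Y" "pdist y0 y < r" "pdist (f x0) (f x) < r"
        by auto
      have "pdist y (f x) \<le> pdist y y0 + (pdist y0 (f x0) + pdist (f x0) (f x))"
        using P.triangle[of y y0 "f x"] P.triangle[of y0 "f x0" "f x"] y y0 fX by force
      then have "pdist y (f x) < e" using y(5,6) r(2) P.commute[of y y0] by linarith
      then show "x \<in> ?A" using y by blast
    qed
    ultimately show "\<exists>T. openin X T \<and> x0 \<in> T \<and> T \<subseteq> ?A" by blast
  qed
qed

theorem Michael_selection:
  assumes X: "paracompact_space X" and lsc: "lower_semicontinuous X Y \<phi>"
    and cc: "\<And>x. x \<in> topspace X \<Longrightarrow> \<phi> x \<in> closed_convex_sets I E"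
  obtains f where "continuous_map X Y f" "\<And>x. x \<in> topspace X \<Longrightarrow> f x \<in> \<phi> x"
proof -
  note cc = closed_convex_setsD[OF cc]
  let ?P = "\<lambda>n f. continuous_map X Y f \<and> (\<forall>x\<in>topspace X. \<exists>y\<in>\<phi> x. pdist y (f x) < (1/2)^n)"
  \<comment> \<open>The next approximation is within \<open>(1/2)^Suc n\<close> of a point of
    \<open>\<phi> x\<close> that is itself within \<open>(1/2)^n\<close> of \<open>f x\<close>, so
    consecutive ones differ by less than \<open>2 * (1/2)^n\<close>; the tails then sum to at most
    \<open>4 * (1/2)^n\<close>.\<close>
  let ?Q = "\<lambda>n f f'. \<forall>x\<in>topspace X. pdist (f x) (f' x) < 2 * (1/2)^n"
  have 0: "\<exists>f. ?P 0 f"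
    by (rule approximate_selection[OF X lsc cc(1,4,3), of 1]) (auto intro!: exI)
  have step: "\<exists>f'. ?P (Suc n) f' \<and> ?Q n f f'" if f: "?P n f" for n f
  proof -
    let ?B = "\<lambda>x. {y\<in>topspace Y. pdist y (f x) < (1/2)^n}"
    have fc: "continuous_map X Y f" using f by blast
    have fX: "f x \<in> topspace Y" if "x \<in> topspace X" for x
      using continuous_map_funspace[OF fc] that by blast
    have ne: "\<phi> x \<inter> ?B x \<noteq> {}" if "x \<in> topspace X" for x
      using f cc(4)[OF that] that by fastforce
    have conv: "convex_in_prod I (\<phi> x \<inter> ?B x)" if "x \<in> topspace X" for x
      by (intro convex_in_prod_Int cc(3)[OF that] convex_pdist_ball fX[OF that])
    obtain f' where f': "continuous_map X Y f'"
      "\<And>x. x \<in> topspace X \<Longrightarrow> \<exists>y\<in>\<phi> x \<inter> ?B x. pdist y (f' x) < (1/2)^Suc n"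
      by (rule approximate_selection[OF X lower_semicontinuous_Int_ball[OF lsc fc] ne _ conv, of "(1/2)^Suc n"])
        (use that in auto)
    have "pdist (f x) (f' x) < 2 * (1/2)^n" if x: "x \<in> topspace X" for x
    proof -
      obtain y where y: "y \<in> topspace Y" "pdist y (f x) < (1/2)^n" "pdist y (f' x) < (1/2)^Suc n"
        using f'(2)[OF x] by blast
      have "f' x \<in> topspace Y" using continuous_map_funspace[OF f'(1)] x by blast
      then have "pdist (f x) (f' x) \<le> pdist y (f x) + pdist y (f' x)"
        using P.triangle[of "f x" y "f' x"] y(1) fX[OF x] by (simp add: P.commute)
      moreover have "(1/2::real)^Suc n \<le> (1/2)^n" by simp
      ultimately show ?thesis using y by linarith
    qed
    then show ?thesis using f' by blast
  qed
  have "\<exists>f. \<forall>n. ?P n (f n) \<and> ?Q n (f n) (f (Suc n))"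
    using 0 step by (rule dependent_nat_choice)
  then obtain f where f': "\<forall>n. ?P n (f n) \<and> ?Q n (f n) (f (Suc n))" by (rule exE)
  have f: "?P n (f n)" "?Q n (f n) (f (Suc n))" for n
    using f'[rule_format, of n] by (rule conjunct1, rule conjunct2)
  have fY: "f n x \<in> topspace Y" if "x \<in> topspace X" for n x
    using f(1)[of n] continuous_map_funspace[of X Y "f n"] that by blast
  have tail: "pdist (f n x) (f (n + k) x) \<le> 4 * (1/2)^n - 4 * (1/2)^(n + k)" if x: "x \<in> topspace X" for n k x
  proof (induction k)
    case 0 then show ?case using fY[OF x, of n] by simp
  next
    case (Suc k)
    have "pdist (f n x) (f (n + Suc k) x) \<le> pdist (f n x) (f (n + k) x) + pdist (f (n + k) x) (f (Suc (n + k)) x)"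
      using P.triangle[of "f n x" "f (n + k) x" "f (Suc (n + k)) x"] fY[OF x] by simp
    also have "\<dots> \<le> (4 * (1/2)^n - 4 * (1/2)^(n + k)) + 2 * (1/2)^(n + k)"
      using Suc.IH f(2)[of "n + k"] x by (intro add_mono) (auto intro: less_imp_le)
    also have "\<dots> = 4 * (1/2)^n - 4 * (1/2)^(n + Suc k)" by simp
    finally show ?case .
  qed
  have tail': "pdist (f n x) (f m x) \<le> 4 * (1/2)^n" if "x \<in> topspace X" "n \<le> m" for n m x
  proof -
    have "0 \<le> 4 * (1/2::real)^m" by simp
    moreover have "pdist (f n x) (f m x) \<le> 4 * (1/2)^n - 4 * (1/2)^m"
      using tail[OF that(1), of n "m - n"] that(2) by simp
    ultimately show ?thesis by linarith
  qed
  have cau: "\<exists>N. \<forall>m n x. N \<le> m \<longrightarrow> N \<le> n \<longrightarrow> x \<in> topspace X \<longrightarrow> pdist (f m x) (f n x) < \<epsilon>" if e: "\<epsilon> > 0" for \<epsilon>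
  proof -
    obtain N where N: "(1/2::real)^N < \<epsilon> / 8" using real_arch_pow_inv[of "\<epsilon>/8" "1/2"] e by auto
    have "pdist (f m x) (f n x) < \<epsilon>" if "N \<le> m" "N \<le> n" "x \<in> topspace X" for m n x
      using P.triangle[of "f m x" "f N x" "f n x", OF fY[OF that(3)] fY[OF that(3)] fY[OF that(3)]]
        tail'[OF that(3,1)] tail'[OF that(3,2)] N P.commute[of "f m x" "f N x"] by linarith
    then show ?thesis by blast
  qed
  have fc: "\<forall>\<^sub>F n in sequentially. continuous_map X P.mtopology (f n)"
    using f(1) by (simp add: mtopology_pdist)
  obtain g where g: "continuous_map X P.mtopology g"
    "\<And>\<epsilon>. 0 < \<epsilon> \<Longrightarrow> \<forall>\<^sub>F n in sequentially. \<forall>x\<in>topspace X. pdist (f n x) (g x) < \<epsilon>"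
    by (rule P.continuous_map_uniformly_Cauchy_limit[OF mcomplete_pdist fc cau]) (iprover intro: that)+
  have "g x \<in> \<phi> x" if x: "x \<in> topspace X" for x
  proof -
    have gY: "g x \<in> topspace Y" using continuous_map_funspace[OF g(1)] x by auto
    have "\<exists>y\<in>\<phi> x. y \<in> P.mball (g x) r" if r: "r > 0" for r
    proof -
      have "\<forall>\<^sub>F n in sequentially. \<forall>x\<in>topspace X. pdist (f n x) (g x) < r/2"
        using r by (intro g(2)) simp
      then obtain N where "\<forall>n\<ge>N. \<forall>x\<in>topspace X. pdist (f n x) (g x) < r/2"
        unfolding eventually_sequentially ..
      then have N: "pdist (f n x) (g x) < r/2" if "n \<ge> N" for n using that x by simp
      obtain M where M: "(1/2::real)^M < r/2" using real_arch_pow_inv[of "r/2" "1/2"] r by auto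
      have "(1/2::real)^(max M N) \<le> (1/2)^M" by (intro power_decreasing) auto
      then have "(1/2::real)^(max M N) < r/2" using M by linarith
      moreover obtain y where y: "y \<in> \<phi> x" "pdist y (f (max M N) x) < (1/2)^(max M N)" using f(1) x by blast
      moreover have yY: "y \<in> topspace Y" using y(1) cc(4)[OF x] by blast
      moreover have "pdist (g x) y \<le> pdist (g x) (f (max M N) x) + pdist (f (max M N) x) y"
        using P.triangle[of "g x" "f (max M N) x" y] fY[OF x] gY yY by blast
      ultimately have "pdist (g x) y < r"
        using N[of "max M N"] by (simp add: P.commute)
      then show ?thesis using y(1) yY gY by (intro bexI[of _ y]) auto
    qed
    then have "g x \<in> P.mtopology closure_of \<phi> x" unfolding P.metric_closure_of using gY by blast
    then show ?thesis using closure_of_closedin[OF cc(2)[OF x]] by (simp add: mtopology_pdist)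
  qed
  then show ?thesis using g(1) by (intro that[of g]) (auto simp: mtopology_pdist)
qed

text \<open>The mapping with the single value \<open>g x\<close> on \<open>C\<close> and
  \<open>\<phi> x\<close> elsewhere is again lower semi-continuous: for open \<open>U\<close> the
  closed set of points \<open>x \<in> C\<close> with \<open>g x \<notin> U\<close> is removed from
  an open set.\<close>

theorem Michael_extension:
  assumes X: "paracompact_space X" and lsc: "lower_semicontinuous X Y \<phi>"
    and cc: "\<And>x. x \<in> topspace X \<Longrightarrow> \<phi> x \<in> closed_convex_sets I E"
    and C: "closedin X C" and g: "continuous_map (subtopology X C) Y g"
    and gx: "\<And>x. x \<in> C \<Longrightarrow> g x \<in> \<phi> x"
  obtains f where "continuous_map X Y f" "\<And>x. x \<in> topspace X \<Longrightarrow> f x \<in> \<phi> x" "\<And>x. x \<in> C \<Longrightarrow> f x = g x"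
proof -
  define \<phi>' where "\<phi>' = (\<lambda>x. if x \<in> C then {g x} else \<phi> x)"
  have CX: "C \<subseteq> topspace X" using C closedin_subset by blast
  have "lower_semicontinuous X Y \<phi>'"
    unfolding lower_semicontinuous_def
  proof (intro allI impI)
    fix U assume U: "openin Y U"
    have gY: "g x \<in> topspace Y" if "x \<in> C" for x
      using continuous_map_funspace[OF g] that CX by auto
    have "closedin (subtopology X C) {x\<in>topspace (subtopology X C). g x \<in> topspace Y - U}"
      using U by (intro closedin_continuous_map_preimage[OF g]) blast
    then have "closedin X {x\<in>topspace (subtopology X C). g x \<in> topspace Y - U}"
      using C closedin_trans_full by blast
    moreover have "openin X {x\<in>topspace X. \<phi> x \<inter> U \<noteq> {}}"
      using lsc U unfolding lower_semicontinuous_def by blast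
    ultimately have "openin X ({x\<in>topspace X. \<phi> x \<inter> U \<noteq> {}} - {x\<in>topspace (subtopology X C). g x \<in> topspace Y - U})"
      by blast
    moreover have "{x\<in>topspace X. \<phi>' x \<inter> U \<noteq> {}} =
       {x\<in>topspace X. \<phi> x \<inter> U \<noteq> {}} - {x\<in>topspace (subtopology X C). g x \<in> topspace Y - U}"
      using gx gY CX unfolding \<phi>'_def by (auto split: if_splits)
    ultimately show "openin X {x\<in>topspace X. \<phi>' x \<inter> U \<noteq> {}}" by simp
  qed
  moreover have "\<phi>' x \<in> closed_convex_sets I E" if x: "x \<in> topspace X" for x
  proof (cases "x \<in> C")
    case True
    have gY: "g x \<in> topspace Y" using gx[OF True] closed_convex_setsD(4)[OF cc[OF x]] by blast
    then have "closedin P.mtopology {g x}" by (intro closedin_Hausdorff_singleton P.Hausdorff_space_mtopology) simp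
    moreover have "convex_in_prod I {g x}" unfolding convex_in_prod_mix using mix_same[OF gY] by simp
    ultimately show ?thesis unfolding \<phi>'_def closed_convex_sets_def using True by (simp add: mtopology_pdist)
  qed (use cc[OF x] in \<open>simp add: \<phi>'_def\<close>)
  ultimately obtain f where f: "continuous_map X Y f" "\<And>x. x \<in> topspace X \<Longrightarrow> f x \<in> \<phi>' x"
    using Michael_selection[OF X, of \<phi>'] by blast
  show ?thesis
  proof (rule that[of f])
    show "f x \<in> \<phi> x" if "x \<in> topspace X" for x
      using f(2)[OF that] gx unfolding \<phi>'_def by (auto split: if_splits)
    show "f x = g x" if "x \<in> C" for x
      using f(2)[of x] that CX unfolding \<phi>'_def by auto
  qed (rule f(1))
qed

end

section \<open>Cells\<close>

abbreviation "R_UNIV \<equiv> product_topology (\<lambda>_. euclideanreal) UNIV"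

text \<open>\<open>cone_cell s\<close> is the cone with apex \<open>0\<close> over the simplex \<open>top_face s\<close> with vertex set \<open>s\<close>;
  its dimension is the cardinality of \<open>s\<close>.\<close>

definition cone_cell :: "'v set \<Rightarrow> ('v \<Rightarrow> real) set" where
  "cone_cell s = {t. (\<forall>v. 0 \<le> t v) \<and> (\<forall>v. v \<notin> s \<longrightarrow> t v = 0) \<and> sum t s \<le> 1}"

definition top_face :: "'v set \<Rightarrow> ('v \<Rightarrow> real) set" where
  "top_face s = {t \<in> cone_cell s. sum t s = 1}"

text \<open>The base \<open>top_face s\<close> opposite the apex together with the faces through the
  apex. For \<open>s = {}\<close> the cell is one point and the boundary is empty, so that extending
  over the cell means finding a point.\<close>

definition cell_boundary :: "'v set \<Rightarrow> ('v \<Rightarrow> real) set" where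
  "cell_boundary s = {t \<in> cone_cell s. sum t s = 1 \<or> (\<exists>v\<in>s. t v = 0)}"

lemma sum_cone_cell:
  assumes "t \<in> cone_cell s" "finite s'" "s \<subseteq> s'"
  shows "sum t s' = sum t s"
  using assms unfolding cone_cell_def by (intro sum.mono_neutral_right) auto

lemma cone_cell_mono:
  assumes "finite s'" "s \<subseteq> s'"
  shows "cone_cell s \<subseteq> cone_cell s'"
proof
  fix t assume t: "t \<in> cone_cell s"
  show "t \<in> cone_cell s'"
    using t sum_cone_cell[OF t assms] assms(2) unfolding cone_cell_def by auto
qed

lemma cone_cell_delete:
  assumes "t \<in> cone_cell s" "finite s" "t a = 0"
  shows "t \<in> cone_cell (s - {a})"
proof -
  have "sum t (s - {a}) = sum t s"
    using assms by (intro sum.mono_neutral_left) auto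
  then show ?thesis using assms unfolding cone_cell_def by auto
qed

lemma top_face_delete:
  assumes "t \<in> cone_cell (s - {a})" "finite s" "sum t s = 1"
  shows "t \<in> top_face (s - {a})"
  using assms sum_cone_cell[OF assms(1), of s] unfolding top_face_def by auto

lemma cell_boundary_eq:
  assumes "finite s"
  shows "cell_boundary s = top_face s \<union> (\<Union>a\<in>s. cone_cell (s - {a}))"
proof
  show "cell_boundary s \<subseteq> top_face s \<union> (\<Union>a\<in>s. cone_cell (s - {a}))"
    unfolding cell_boundary_def top_face_def using cone_cell_delete[OF _ assms] by blast
  have "t \<in> cell_boundary s" if "a \<in> s" "t \<in> cone_cell (s - {a})" for t a
  proof -
    have "t \<in> cone_cell s" using cone_cell_mono[OF assms, of "s - {a}"] that by blast
    moreover have "t a = 0" using that(2) unfolding cone_cell_def by blast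
    ultimately show ?thesis using that(1) unfolding cell_boundary_def by blast
  qed
  then show "top_face s \<union> (\<Union>a\<in>s. cone_cell (s - {a})) \<subseteq> cell_boundary s"
    unfolding cell_boundary_def top_face_def by blast
qed

lemma closedin_cone_cell:
  assumes "finite s" shows "closedin R_UNIV (cone_cell s)"
proof -
  have pr: "continuous_map R_UNIV euclideanreal (\<lambda>t. t v)" for v
    by (rule continuous_map_product_projection) simp
  have "closedin R_UNIV {t \<in> topspace R_UNIV. t v \<in> (if v \<in> s then {0..} else {0})}" for v
    by (intro closedin_continuous_map_preimage[OF pr]) auto
  moreover have "closedin R_UNIV {t \<in> topspace R_UNIV. sum t s \<in> {..1}}"
    by (intro closedin_continuous_map_preimage[of _ euclideanreal] continuous_map_sum assms pr) auto
  ultimately have "closedin R_UNIV ((\<Inter>v. {t \<in> topspace R_UNIV. t v \<in> (if v \<in> s then {0..} else {0})})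
      \<inter> {t \<in> topspace R_UNIV. sum t s \<in> {..1}})"
    by (intro closedin_Int closedin_Inter) auto
  moreover have "(\<Inter>v. {t \<in> topspace R_UNIV. t v \<in> (if v \<in> s then {0..} else {0})})
      \<inter> {t \<in> topspace R_UNIV. sum t s \<in> {..1}} = cone_cell s"
    unfolding cone_cell_def by (auto split: if_splits) (metis order_refl)
  ultimately show ?thesis by metis
qed

lemma closedin_top_face:
  assumes "finite s" shows "closedin R_UNIV (top_face s)"
proof -
  have "closedin R_UNIV {t \<in> topspace R_UNIV. sum t s \<in> {1}}"
    by (intro closedin_continuous_map_preimage[of _ euclideanreal] continuous_map_sum assms
        continuous_map_product_projection) auto
  then have "closedin R_UNIV (cone_cell s \<inter> {t \<in> topspace R_UNIV. sum t s \<in> {1}})"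
    by (intro closedin_Int closedin_cone_cell[OF assms])
  moreover have "cone_cell s \<inter> {t \<in> topspace R_UNIV. sum t s \<in> {1}} = top_face s"
    unfolding top_face_def by auto
  ultimately show ?thesis by metis
qed

lemma closedin_cell_boundary:
  assumes "finite s" shows "closedin R_UNIV (cell_boundary s)"
  unfolding cell_boundary_eq[OF assms]
  using assms by (intro closedin_Un closedin_top_face closedin_Union) (auto intro: closedin_cone_cell)

lemma cell_boundary_subset: "cell_boundary s \<subseteq> cone_cell s"
  unfolding cell_boundary_def by blast

lemma compactin_cone_cell:
  assumes "finite s" shows "compactin R_UNIV (cone_cell s)"
proof (rule closed_compactin)
  show "compactin R_UNIV (PiE UNIV (\<lambda>_. {0..1::real}))"
    by (subst compactin_PiE) auto
  show "cone_cell s \<subseteq> PiE UNIV (\<lambda>_. {0..1})"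
  proof
    fix t assume t: "t \<in> cone_cell s"
    have "t v \<le> 1" for v
    proof (cases "v \<in> s")
      case True
      then have "t v \<le> sum t s" using assms t unfolding cone_cell_def by (intro member_le_sum) auto
      then show ?thesis using t unfolding cone_cell_def by simp
    qed (use t in \<open>auto simp: cone_cell_def\<close>)
    then show "t \<in> PiE UNIV (\<lambda>_. {0..1})" using t unfolding cone_cell_def by auto
  qed
qed (rule closedin_cone_cell[OF assms])

lemma compact_space_cone_cell: "finite s \<Longrightarrow> compact_space (subtopology R_UNIV (cone_cell s))"
  by (rule compact_space_subtopology[OF compactin_cone_cell])

lemma Hausdorff_space_cone_cell: "Hausdorff_space (subtopology R_UNIV S)"
  by (intro Hausdorff_space_subtopology) (simp add: Hausdorff_space_product_topology)


section \<open>Selections avoiding a closed graph\<close>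

context banach_product
begin

text \<open>\<open>v\<close> over \<open>B \<times> topspace X\<close> and \<open>e\<close> over the
  slice at \<open>x0\<close> agree where they meet, so together they form a selection over a closed
  set of the product, to which Michael's theorem applies. The condition \<open>\<Omega>\<close>
  holds on the slice, and compactness of \<open>K\<close> spreads it to a tube.\<close>

lemma extend_compact_family:
  assumes X: "paracompact_space X" and lsc: "lower_semicontinuous X Y \<phi>"
    and cc: "\<And>x. x \<in> topspace X \<Longrightarrow> \<phi> x \<in> closed_convex_sets I E"
    and K: "compact_space K" "Hausdorff_space K" and B: "closedin K B" and x0: "x0 \<in> topspace X"
    and \<Omega>: "openin (prod_topology X Y) \<Omega>"
    and v: "continuous_map (subtopology (prod_topology K X) (B \<times> topspace X)) Y v"
    and v\<phi>: "\<And>t x. t \<in> B \<Longrightarrow> x \<in> topspace X \<Longrightarrow> v (t, x) \<in> \<phi> x"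
    and e: "continuous_map K Y e"
    and e\<phi>: "\<And>t. t \<in> topspace K \<Longrightarrow> e t \<in> \<phi> x0" and e\<Omega>: "\<And>t. t \<in> topspace K \<Longrightarrow> (x0, e t) \<in> \<Omega>"
    and ev: "\<And>t. t \<in> B \<Longrightarrow> e t = v (t, x0)"
  obtains W z where "openin X W" "x0 \<in> W" "continuous_map (prod_topology K X) Y z"
    "\<And>t x. t \<in> topspace K \<Longrightarrow> x \<in> topspace X \<Longrightarrow> z (t, x) \<in> \<phi> x"
    "\<And>t x. t \<in> B \<Longrightarrow> x \<in> topspace X \<Longrightarrow> z (t, x) = v (t, x)"
    "\<And>t x. t \<in> topspace K \<Longrightarrow> x \<in> W \<Longrightarrow> (x, z (t, x)) \<in> \<Omega>"
proof -
  let ?P = "prod_topology K X"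
  have BK: "B \<subseteq> topspace K" using closedin_subset[OF B] .
  have "closedin X {x0}"
    by (rule closedin_Hausdorff_singleton[OF _ x0]) (use X in \<open>simp add: paracompact_space_def\<close>)
  then have cl: "closedin ?P (B \<times> topspace X)" "closedin ?P (topspace K \<times> {x0})"
    using B by (simp_all add: closedin_prod_Times_iff)
  define C where "C = B \<times> topspace X \<union> topspace K \<times> {x0}"
  have clC: "closedin ?P C" unfolding C_def using cl by (rule closedin_Un)
  define g where "g = (\<lambda>p. if snd p = x0 then e (fst p) else v p)"
  have g: "continuous_map (subtopology ?P C) Y g"
  proof (rule pasting_lemma_closed[where I = UNIV and
        T = "\<lambda>b. if b then B \<times> topspace X else topspace K \<times> {x0}" and f = "\<lambda>b. if b then v else e \<circ> fst"])
    show "closedin (subtopology ?P C) (if b then B \<times> topspace X else topspace K \<times> {x0})" for b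
      using cl by (cases b) (auto simp: C_def intro!: closedin_subset_topspace)
    have "continuous_map (subtopology ?P (topspace K \<times> {x0})) Y (e \<circ> fst)"
      by (rule continuous_map_compose[OF continuous_map_from_subtopology[OF continuous_map_fst] e])
    moreover have "C \<inter> B \<times> topspace X = B \<times> topspace X" "C \<inter> topspace K \<times> {x0} = topspace K \<times> {x0}"
      unfolding C_def by auto
    ultimately show "continuous_map (subtopology (subtopology ?P C) (if b then B \<times> topspace X else topspace K \<times> {x0})) Y
        (if b then v else e \<circ> fst)" for b
      using v by (cases b) (simp_all add: subtopology_subtopology)
    show "(if b then v else e \<circ> fst) p = (if c then v else e \<circ> fst) p"
      if "p \<in> topspace (subtopology ?P C) \<inter> (if b then B \<times> topspace X else topspace K \<times> {x0})
         \<inter> (if c then B \<times> topspace X else topspace K \<times> {x0})" for b c p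
      using that ev by (cases b; cases c) auto
    show "\<exists>b. b \<in> UNIV \<and> p \<in> (if b then B \<times> topspace X else topspace K \<times> {x0}) \<and> g p = (if b then v else e \<circ> fst) p"
      if "p \<in> topspace (subtopology ?P C)" for p
    proof (cases "snd p = x0")
      case True
      then show ?thesis using that by (intro exI[of _ False]) (auto simp: g_def C_def)
    next
      case False
      then show ?thesis using that by (intro exI[of _ True]) (auto simp: g_def C_def)
    qed
  qed simp
  have "lower_semicontinuous ?P Y (\<lambda>p. \<phi> (snd p))"
    unfolding lower_semicontinuous_def
  proof (intro allI impI)
    fix U assume "openin Y U"
    then have "openin X {x\<in>topspace X. \<phi> x \<inter> U \<noteq> {}}" using lsc unfolding lower_semicontinuous_def by blast
    then have "openin ?P (topspace K \<times> {x\<in>topspace X. \<phi> x \<inter> U \<noteq> {}})" by (simp add: openin_prod_Times_iff)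
    moreover have "{p\<in>topspace ?P. \<phi> (snd p) \<inter> U \<noteq> {}} = topspace K \<times> {x\<in>topspace X. \<phi> x \<inter> U \<noteq> {}}"
      by auto
    ultimately show "openin ?P {p\<in>topspace ?P. \<phi> (snd p) \<inter> U \<noteq> {}}" by metis
  qed
  moreover have "\<phi> (snd p) \<in> closed_convex_sets I E" if "p \<in> topspace ?P" for p
    using that cc by auto
  moreover have "g p \<in> \<phi> (snd p)" if "p \<in> C" for p
    using that v\<phi> e\<phi> BK unfolding C_def g_def by auto
  ultimately obtain z where z: "continuous_map ?P Y z"
    "\<And>p. p \<in> topspace ?P \<Longrightarrow> z p \<in> \<phi> (snd p)" "\<And>p. p \<in> C \<Longrightarrow> z p = g p"
    using Michael_extension[OF paracompact_space_compact_prod[OF K X] _ _ clC g, of "\<lambda>p. \<phi> (snd p)"] by blast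
  let ?O = "{p \<in> topspace ?P. (snd p, z p) \<in> \<Omega>}"
  have "continuous_map ?P (prod_topology X Y) (\<lambda>p. (snd p, z p))"
    using z(1) by (simp add: continuous_map_paired continuous_map_snd)
  then have "openin ?P ?O" by (rule openin_continuous_map_preimage[OF _ \<Omega>])
  moreover have "z (t, x0) = e t" if "t \<in> topspace K" for t
    using z(3)[of "(t, x0)"] that unfolding C_def g_def by auto
  then have "topspace K \<times> {x0} \<subseteq> ?O" using x0 e\<Omega> by auto
  ultimately obtain U W where UW: "openin X W" "topspace K \<subseteq> U" "x0 \<in> W" "U \<times> W \<subseteq> ?O"
    using tube_lemma_left[of K X ?O "topspace K" x0] K(1) x0 unfolding compact_space_def by blast
  show ?thesis
  proof (rule that[of W z])
    show "z (t, x) \<in> \<phi> x" if "t \<in> topspace K" "x \<in> topspace X" for t x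
      using z(2)[of "(t, x)"] that by simp
    show "z (t, x) = v (t, x)" if "t \<in> B" "x \<in> topspace X" for t x
      using z(3)[of "(t, x)"] that ev[of t] unfolding C_def g_def by auto
    show "(x, z (t, x)) \<in> \<Omega>" if "t \<in> topspace K" "x \<in> W" for t x
    proof -
      have "(t, x) \<in> ?O" using UW that by blast
      then show ?thesis by simp
    qed
  qed (use UW z(1) in auto)
qed

end

text \<open>The locale isolates \<open>cell_extension\<close>, the filling of cells of dimension at
  most \<open>n\<close> in a single fibre, from its source in the avoidance of small sets. A vertex
  \<open>(i, y)\<close> stands for the member \<open>y\<close> of the cover of colour
  \<open>i\<close>, the covers being indexed by points. The locale is later interpreted in a closed
  subspace of dimension at most \<open>n\<close>.\<close>

locale cell_selection = banach_product I E
  for I :: "'i set" and E :: "'i \<Rightarrow> 'b::real_normed_vector set" +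
  fixes X :: "'x topology" and \<phi> :: "'x \<Rightarrow> ('i \<Rightarrow> 'b) set" and \<Omega> :: "('x \<times> ('i \<Rightarrow> 'b)) set" and n :: nat
  assumes X: "paracompact_space X" and lsc: "lower_semicontinuous X Y \<phi>"
    and cc: "\<And>x. x \<in> topspace X \<Longrightarrow> \<phi> x \<in> closed_convex_sets I E"
    and \<Omega>: "openin (prod_topology X Y) \<Omega>"
    and cell_extension: "\<And>x (s :: (nat \<times> 'x) set) b. \<lbrakk>x \<in> topspace X; finite s; card s \<le> n;
        continuous_map (subtopology R_UNIV (cell_boundary s)) Y b;
        \<And>t. t \<in> cell_boundary s \<Longrightarrow> b t \<in> \<phi> x \<and> (x, b t) \<in> \<Omega>\<rbrakk>
      \<Longrightarrow> \<exists>e. continuous_map (subtopology R_UNIV (cone_cell s)) Y e \<and>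
            (\<forall>t\<in>cone_cell s. e t \<in> \<phi> x \<and> (x, e t) \<in> \<Omega>) \<and> (\<forall>t\<in>cell_boundary s. e t = b t)"
begin

text \<open>Joint continuity in the parameter and the point is required because the final selection
  evaluates \<open>u\<close> at a parameter that varies with the point.\<close>

definition good :: "((nat \<times> 'x \<Rightarrow> real) \<times> 'x) set \<Rightarrow> ((nat \<times> 'x \<Rightarrow> real) \<times> 'x \<Rightarrow> 'i \<Rightarrow> 'b) \<Rightarrow> bool" where
  "good D u \<longleftrightarrow> continuous_map (subtopology (prod_topology R_UNIV X) D) Y u \<and>
     (\<forall>t x. (t, x) \<in> D \<longrightarrow> u (t, x) \<in> \<phi> x \<and> (x, u (t, x)) \<in> \<Omega>)"

lemma good_mono: "good D u \<Longrightarrow> D' \<subseteq> D \<Longrightarrow> good D' u"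
  unfolding good_def by (meson continuous_map_from_subtopology_mono subsetD)

lemma good_cong:
  assumes "good D u" "\<And>p. p \<in> D \<Longrightarrow> u p = w p"
  shows "good D w"
proof -
  have "continuous_map (subtopology (prod_topology R_UNIV X) D) Y w"
    using assms unfolding good_def by (auto intro: continuous_map_eq)
  then show ?thesis using assms unfolding good_def by auto
qed

lemma good_empty: "good {} u"
  unfolding good_def by simp

lemma good_compose:
  assumes u: "good D u" and h: "continuous_map R_UNIV R_UNIV h"
    and D': "\<And>t x. (t, x) \<in> D' \<Longrightarrow> (h t, x) \<in> D"
  shows "good D' (\<lambda>(t, x). u (h t, x))"
proof -
  have "continuous_map (prod_topology R_UNIV X) (prod_topology R_UNIV X) (\<lambda>p. (h (fst p), snd p))"
    unfolding continuous_map_paired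
    using continuous_map_compose[OF continuous_map_fst h, of X] by (simp add: o_def continuous_map_snd)
  then have "continuous_map (subtopology (prod_topology R_UNIV X) D') (subtopology (prod_topology R_UNIV X) D)
      (\<lambda>p. (h (fst p), snd p))"
    using D' by (auto simp: continuous_map_in_subtopology continuous_map_from_subtopology)
  from continuous_map_compose[OF this, of Y u]
  have "continuous_map (subtopology (prod_topology R_UNIV X) D') Y (\<lambda>(t, x). u (h t, x))"
    using u unfolding good_def by (simp add: o_def case_prod_unfold)
  then show ?thesis using u D' unfolding good_def by auto
qed

text \<open>The boundary family is filled in the fibre over \<open>x0\<close> alone by
  \<open>cell_extension\<close>; \<open>extend_compact_family\<close> on the closed subspace
  \<open>Q\<close> then carries the filling to the points near \<open>x0\<close>.\<close>

lemma good_extend_cell: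
  assumes s: "finite s" "card s \<le> n" and Q: "closedin X Q" and x0: "x0 \<in> Q"
    and v: "good (cell_boundary s \<times> Q) v"
  obtains W z where "openin X W" "x0 \<in> W" "good (cone_cell s \<times> (Q \<inter> W)) z"
    "\<And>t x. t \<in> cell_boundary s \<Longrightarrow> x \<in> Q \<Longrightarrow> z (t, x) = v (t, x)"
proof -
  have QX: "Q \<subseteq> topspace X" using Q closedin_subset by blast
  then have x0X: "x0 \<in> topspace X" using x0 by blast
  let ?K = "subtopology R_UNIV (cone_cell s)" and ?Q = "subtopology X Q" and ?B = "cell_boundary s"
  have topK: "topspace ?K = cone_cell s" by simp
  have topQ: "topspace ?Q = Q" using QX by auto
  have "continuous_map (subtopology R_UNIV ?B) (subtopology (prod_topology R_UNIV X) (?B \<times> Q)) (\<lambda>t. (t, x0))"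
    using x0 x0X by (auto simp: continuous_map_in_subtopology continuous_map_paired)
  from continuous_map_compose[OF this, of Y v]
  have "continuous_map (subtopology R_UNIV ?B) Y (\<lambda>t. v (t, x0))"
    using v unfolding good_def by (simp add: o_def)
  then obtain e where e: "continuous_map ?K Y e"
      "\<And>t. t \<in> cone_cell s \<Longrightarrow> e t \<in> \<phi> x0 \<and> (x0, e t) \<in> \<Omega>" "\<And>t. t \<in> ?B \<Longrightarrow> e t = v (t, x0)"
    using cell_extension[OF x0X s, of "\<lambda>t. v (t, x0)"] v x0 unfolding good_def by blast
  have prodeq: "prod_topology ?K ?Q = subtopology (prod_topology R_UNIV X) (cone_cell s \<times> Q)"
    by (simp add: subtopology_Times)
  have lscQ: "lower_semicontinuous ?Q Y \<phi>" using lsc by (rule lower_semicontinuous_subtopology)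
  have \<Omega>Q: "openin (prod_topology ?Q Y) (\<Omega> \<inter> Q \<times> topspace Y)"
  proof -
    have "prod_topology ?Q Y = subtopology (prod_topology X Y) (Q \<times> topspace Y)"
      by (simp add: subtopology_Times)
    then show ?thesis using \<Omega> by (simp add: openin_subtopology_Int)
  qed
  have BK: "closedin ?K ?B"
    using closedin_cell_boundary[OF s(1)] cell_boundary_subset by (rule closedin_subset_topspace)
  have cv: "continuous_map (subtopology (prod_topology ?K ?Q) (?B \<times> topspace ?Q)) Y v"
  proof -
    have "subtopology (prod_topology ?K ?Q) (?B \<times> topspace ?Q) = subtopology (prod_topology R_UNIV X) (?B \<times> Q)"
      unfolding prodeq subtopology_subtopology topQ
      using cell_boundary_subset[of s] by (intro arg_cong2[where f=subtopology] refl) blast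
    then show ?thesis using v unfolding good_def by simp
  qed
  have eY: "e t \<in> topspace Y" if "t \<in> cone_cell s" for t
    using e(2)[OF that] closed_convex_setsD(4)[OF cc[OF x0X]] by blast
  obtain W z where Wz: "openin ?Q W" "x0 \<in> W" "continuous_map (prod_topology ?K ?Q) Y z"
    "\<And>t x. t \<in> topspace ?K \<Longrightarrow> x \<in> topspace ?Q \<Longrightarrow> z (t, x) \<in> \<phi> x"
    "\<And>t x. t \<in> ?B \<Longrightarrow> x \<in> topspace ?Q \<Longrightarrow> z (t, x) = v (t, x)"
    "\<And>t x. t \<in> topspace ?K \<Longrightarrow> x \<in> W \<Longrightarrow> (x, z (t, x)) \<in> \<Omega> \<inter> Q \<times> topspace Y"
  proof (rule extend_compact_family[OF paracompact_space_closed_subtopology[OF X Q] lscQ _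
        compact_space_cone_cell[OF s(1)] Hausdorff_space_cone_cell BK _ \<Omega>Q cv _ e(1), of x0])
    show "\<phi> x \<in> closed_convex_sets I E" if "x \<in> topspace ?Q" for x using that cc by auto
    show "x0 \<in> topspace ?Q" using x0 topQ by simp
    show "v (t, x) \<in> \<phi> x" if "t \<in> ?B" "x \<in> topspace ?Q" for t x
      using v that topQ unfolding good_def by blast
    show "e t \<in> \<phi> x0" if "t \<in> topspace ?K" for t using e(2) that by simp
    show "(x0, e t) \<in> \<Omega> \<inter> Q \<times> topspace Y" if "t \<in> topspace ?K" for t using e(2) that x0 eY by simp
    show "e t = v (t, x0)" if "t \<in> ?B" for t using e(3) that by simp
  qed (iprover intro: that)+
  obtain W' where W': "openin X W'" "W = W' \<inter> Q" using Wz(1) unfolding openin_subtopology by blast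
  show ?thesis
  proof (rule that[of W' z])
    have "continuous_map (subtopology (prod_topology R_UNIV X) (cone_cell s \<times> (Q \<inter> W'))) Y z"
      using Wz(3) unfolding prodeq by (rule continuous_map_from_subtopology_mono) blast
    moreover have "z (t, x) \<in> \<phi> x \<and> (x, z (t, x)) \<in> \<Omega>" if "t \<in> cone_cell s" "x \<in> Q \<inter> W'" for t x
      using Wz(4)[of t x] Wz(6)[of t x] that topQ W'(2) by auto
    ultimately show "good (cone_cell s \<times> (Q \<inter> W')) z" unfolding good_def by blast
    show "z (t, x) = v (t, x)" if "t \<in> ?B" "x \<in> Q" for t x
      using Wz(5)[of t x] that QX by auto
  qed (use W' Wz(2) in auto)
qed

text \<open>\<open>L\<close> is a finite simplicial complex and the cells of its cone are filled in
  order of size: with a largest simplex \<open>s\<close> removed, induction supplies the sides of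
  \<open>cone_cell s\<close> and \<open>u\<close> its base, hence a map on the whole boundary. Since
  \<open>C\<close> is antitone, the families on the faces of \<open>s\<close> are available over
  \<open>C s\<close> near \<open>x0\<close>.\<close>

lemma good_cone:
  fixes L :: "(nat \<times> 'x) set set"
  assumes "finite L" and down: "\<And>s s'. s \<in> L \<Longrightarrow> s' \<subseteq> s \<Longrightarrow> s' \<in> L"
    and L: "\<And>s. s \<in> L \<Longrightarrow> finite s \<and> card s \<le> n"
    and x0: "x0 \<in> topspace X"
    and C: "\<And>s. s \<in> L \<Longrightarrow> closedin X (C s)" "\<And>s. s \<in> L \<Longrightarrow> x0 \<in> C s"
      "\<And>s s'. s \<in> L \<Longrightarrow> s' \<subseteq> s \<Longrightarrow> C s \<subseteq> C s'"
    and u: "\<And>s. s \<in> L \<Longrightarrow> good (top_face s \<times> C s) u"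
  shows "\<exists>W v. openin X W \<and> x0 \<in> W \<and>
    (\<forall>s\<in>L. good (cone_cell s \<times> (C s \<inter> W)) v \<and> (\<forall>t\<in>top_face s. \<forall>x\<in>C s \<inter> W. v (t, x) = u (t, x)))"
  using assms
proof (induction "card L" arbitrary: L)
  case 0
  then have "L = {}" by simp
  then show ?case using x0 by (intro exI[of _ "topspace X"]) auto
next
  case (Suc k)
  then have "L \<noteq> {}" by auto
  have "Max (card ` L) \<in> card ` L" using \<open>L \<noteq> {}\<close> Suc.prems(1) by (intro Max_in) auto
  then obtain s where s: "s \<in> L" and "card s = Max (card ` L)" by force
  then have smax: "card s' \<le> card s" if "s' \<in> L" for s' using that Suc.prems(1) by simp
  have max: "s' = s" if "s' \<in> L" "s \<subseteq> s'" for s'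
    using smax[OF that(1)] Suc.prems(3)[OF that(1)] that(2) by (metis card_seteq)
  have fs: "finite s" and cs: "card s \<le> n" using Suc.prems(3)[OF s] by auto
  let ?L = "L - {s}"
  have "\<exists>W v. openin X W \<and> x0 \<in> W \<and>
    (\<forall>s\<in>?L. good (cone_cell s \<times> (C s \<inter> W)) v \<and> (\<forall>t\<in>top_face s. \<forall>x\<in>C s \<inter> W. v (t, x) = u (t, x)))"
  proof (rule Suc.hyps(1))
    show "k = card ?L" using Suc.hyps(2) s Suc.prems(1) by simp
    show "s'' \<in> ?L" if "s' \<in> ?L" "s'' \<subseteq> s'" for s' s''
      using that Suc.prems(2)[of s' s''] max[of s'] by blast
  qed (use Suc.prems in auto)
  then obtain W v where W: "openin X W" "x0 \<in> W"
    and v': "\<forall>s\<in>?L. good (cone_cell s \<times> (C s \<inter> W)) v \<and> (\<forall>t\<in>top_face s. \<forall>x\<in>C s \<inter> W. v (t, x) = u (t, x))"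
    by blast
  have v: "good (cone_cell s' \<times> (C s' \<inter> W)) v" "\<And>t x. t \<in> top_face s' \<Longrightarrow> x \<in> C s' \<Longrightarrow> x \<in> W \<Longrightarrow> v (t, x) = u (t, x)"
    if "s' \<in> L" "s' \<noteq> s" for s' using v' that by auto
  \<comment> \<open>The induction hypothesis holds over the open set \<open>W\<close> only, but
    \<open>good_extend_cell\<close> needs a closed set of points; \<open>Q\<close> is such a set
    inside \<open>W\<close>.\<close>
  obtain V where V: "openin X V" "x0 \<in> V" "X closure_of V \<subseteq> W"
    using regular_space_shrink[OF paracompact_imp_regular_space[OF X] W] .
  have VX: "V \<subseteq> X closure_of V" using V(1) by (intro closure_of_subset openin_subset)
  define Q where "Q = C s \<inter> X closure_of V"
  have Q: "closedin X Q" "x0 \<in> Q" unfolding Q_def using Suc.prems(5,6)[OF s] V VX by auto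
  have face: "s - {a} \<in> L" "s - {a} \<noteq> s" "C s \<subseteq> C (s - {a})" if "a \<in> s" for a
    using Suc.prems(2)[OF s, of "s - {a}"] Suc.prems(7)[OF s, of "s - {a}"] that by auto
  \<comment> \<open>Where a side meets the base, \<open>v\<close> agrees with \<open>u\<close> over
    \<open>Q\<close>, so the two descriptions of \<open>b\<close> coincide there; \<open>bv\<close>
    records this.\<close>
  define b where "b = (\<lambda>(t, x). if sum t s = 1 then u (t, x) else v (t, x))"
  have bv: "b (t, x) = v (t, x)" if "a \<in> s" "t \<in> cone_cell (s - {a})" "x \<in> Q" for a t x
  proof (cases "sum t s = 1")
    case True
    then have "t \<in> top_face (s - {a})" using top_face_delete[OF that(2) fs] by blast
    then show ?thesis using v(2)[OF face(1,2)[OF that(1)], of t x] subsetD[OF face(3)[OF that(1)], of x] that(3) subsetD[OF V(3), of x] True unfolding b_def Q_def by auto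
  qed (simp add: b_def)
  have bu: "b (t, x) = u (t, x)" if "t \<in> top_face s" for t x
    using that unfolding b_def top_face_def by simp
  have "good (cell_boundary s \<times> Q) b"
  proof -
    let ?T = "case_option (top_face s \<times> Q) (\<lambda>a. cone_cell (s - {a}) \<times> Q)"
    have gT: "good (?T i) b" if "i \<in> insert None (Some ` s)" for i
    proof (cases i)
      case None
      have "good (top_face s \<times> Q) u"
        using Suc.prems(8)[OF s] by (rule good_mono) (auto simp: Q_def)
      then show ?thesis unfolding None option.case by (rule good_cong) (auto simp: bu)
    next
      case (Some a)
      then have a: "a \<in> s" using that by auto
      have "good (cone_cell (s - {a}) \<times> Q) v"
        using v(1)[OF face(1,2)[OF a]] by (rule good_mono) (use face(3)[OF a] V in \<open>auto simp: Q_def\<close>)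
      then show ?thesis unfolding Some option.case by (rule good_cong) (use bv[OF a] in auto)
    qed
    have U: "cell_boundary s \<times> Q = (\<Union>i\<in>insert None (Some ` s). ?T i)"
      unfolding cell_boundary_eq[OF fs] by auto
    have "continuous_map (subtopology (prod_topology R_UNIV X) (cell_boundary s \<times> Q)) Y b"
    proof (rule pasting_lemma_closed[where I = "insert None (Some ` s)" and T = ?T and f = "\<lambda>_. b"])
      show "closedin (subtopology (prod_topology R_UNIV X) (cell_boundary s \<times> Q)) (?T i)"
        if "i \<in> insert None (Some ` s)" for i
      proof (rule closedin_subset_topspace)
        show "closedin (prod_topology R_UNIV X) (?T i)"
          using Q(1) closedin_top_face[OF fs] closedin_cone_cell[of "s - {a}" for a] fs
          by (cases i) (simp_all add: closedin_prod_Times_iff)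
        show "?T i \<subseteq> cell_boundary s \<times> Q" unfolding U using that by blast
      qed
      show "continuous_map (subtopology (subtopology (prod_topology R_UNIV X) (cell_boundary s \<times> Q)) (?T i)) Y b"
        if "i \<in> insert None (Some ` s)" for i
      proof -
        have "(cell_boundary s \<times> Q) \<inter> ?T i = ?T i" unfolding U using that by blast
        then show ?thesis using gT[OF that] unfolding good_def by (simp add: subtopology_subtopology)
      qed
      show "\<exists>j. j \<in> insert None (Some ` s) \<and> p \<in> ?T j \<and> b p = b p"
        if "p \<in> topspace (subtopology (prod_topology R_UNIV X) (cell_boundary s \<times> Q))" for p
      proof -
        have "p \<in> (\<Union>i\<in>insert None (Some ` s). ?T i)" using that U by auto
        then show ?thesis by blast
      qed
    qed (use fs in auto)
    moreover have "b (t, x) \<in> \<phi> x \<and> (x, b (t, x)) \<in> \<Omega>" if tx: "(t, x) \<in> cell_boundary s \<times> Q" for t x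
    proof -
      obtain i where i: "i \<in> insert None (Some ` s)" "(t, x) \<in> ?T i" using tx unfolding U by blast
      show ?thesis using gT[OF i(1)] i(2) unfolding good_def by blast
    qed
    ultimately show ?thesis unfolding good_def by blast
  qed
  then obtain W2 z where z: "openin X W2" "x0 \<in> W2" "good (cone_cell s \<times> (Q \<inter> W2)) z"
    "\<And>t x. t \<in> cell_boundary s \<Longrightarrow> x \<in> Q \<Longrightarrow> z (t, x) = b (t, x)"
    by (rule good_extend_cell[OF fs cs Q]) (iprover intro: that)
  \<comment> \<open>\<open>z\<close> replaces \<open>v\<close> only in the part of the cell off its
    sides. A simplex of \<open>L\<close> other than \<open>s\<close> does not contain
    \<open>s\<close>, so its cell meets \<open>cone_cell s\<close> only in the sides, and
    \<open>w\<close> equals \<open>v\<close> on it.\<close>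
  define w where "w = (\<lambda>(t, x). if t \<in> cone_cell s - (\<Union>a\<in>s. cone_cell (s - {a})) \<and> x \<in> Q then z (t, x) else v (t, x))"
  define W' where "W' = V \<inter> W2"
  have wz: "w (t, x) = z (t, x)" if "t \<in> cone_cell s" "x \<in> Q" for t x
  proof (cases "\<exists>a\<in>s. t \<in> cone_cell (s - {a})")
    case True
    then obtain a where a: "a \<in> s" "t \<in> cone_cell (s - {a})" by blast
    then have "t \<in> cell_boundary s" unfolding cell_boundary_eq[OF fs] by blast
    then have "z (t, x) = v (t, x)" using z(4) bv[OF a] that(2) by auto
    then show ?thesis unfolding w_def by simp
  next
    case False then show ?thesis using that unfolding w_def by simp
  qed
  have wv: "w (t, x) = v (t, x)" if "s' \<in> L" "s' \<noteq> s" "t \<in> cone_cell s'" for s' t x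
  proof (cases "t \<in> cone_cell s")
    case True
    have "\<not> s \<subseteq> s'" using max[OF that(1)] that(2) by blast
    then obtain a where a: "a \<in> s" "a \<notin> s'" by blast
    then have "t a = 0" using that(3) unfolding cone_cell_def by blast
    then have "t \<in> cone_cell (s - {a})" using cone_cell_delete[OF True fs] by blast
    then show ?thesis using a(1) unfolding w_def by auto
  qed (simp add: w_def)
  have W'Q: "C s \<inter> W' \<subseteq> Q \<inter> W2" unfolding Q_def W'_def using VX by blast
  have W'W: "W' \<subseteq> W" unfolding W'_def using VX V(3) by blast
  have "good (cone_cell s' \<times> (C s' \<inter> W')) w" if "s' \<in> L" for s'
  proof (cases "s' = s")
    case True
    have "good (cone_cell s \<times> (C s \<inter> W')) z"
      using z(3) by (rule good_mono) (use W'Q in blast)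
    then show ?thesis unfolding True by (rule good_cong) (use wz W'Q in auto)
  next
    case False
    have "good (cone_cell s' \<times> (C s' \<inter> W')) v"
      using v(1)[OF that False] by (rule good_mono) (use W'W in blast)
    then show ?thesis by (rule good_cong) (use wv[OF that False] in auto)
  qed
  moreover have "w (t, x) = u (t, x)" if "s' \<in> L" "t \<in> top_face s'" "x \<in> C s' \<inter> W'" for s' t x
  proof (cases "s' = s")
    case True
    have "x \<in> Q" using that(3) W'Q True by blast
    moreover have "t \<in> cone_cell s" "t \<in> cell_boundary s"
      using that(2) True unfolding top_face_def cell_boundary_def by auto
    ultimately show ?thesis using wz z(4) bu that(2) True by simp
  next
    case False
    then show ?thesis
      using wv[OF that(1) False] v(2)[OF that(1) False that(2)] that(2,3) W'W unfolding top_face_def by auto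
  qed
  moreover have "openin X W'" "x0 \<in> W'" unfolding W'_def using V z by auto
  ultimately show ?case by blast
qed

end

section \<open>Induction on the number of colours\<close>

context cell_selection
begin

definition rainbow :: "nat \<Rightarrow> (nat \<times> 'x) set \<Rightarrow> bool" where
  "rainbow k s \<longleftrightarrow> finite s \<and> inj_on fst s \<and> fst ` s \<subseteq> {..<k} \<and> snd ` s \<subseteq> topspace X"

text \<open>Closures, because the filling of cells needs closed sets of points;
  \<open>topspace X\<close> is the value for \<open>s = {}\<close>.\<close>

definition common_closure :: "(nat \<times> 'x \<Rightarrow> 'x set) \<Rightarrow> (nat \<times> 'x) set \<Rightarrow> 'x set" where
  "common_closure V s = topspace X \<inter> (\<Inter>v\<in>s. X closure_of V v)"

text \<open>The vertices of colour \<open>i\<close> are the members of the \<open>i\<close>-th cover, and a point of a simplex all of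
  whose vertices have different colours parametrizes selections on the intersection of the closures
  of its vertices.\<close>

definition stage :: "nat \<Rightarrow> (nat \<times> 'x \<Rightarrow> 'x set) \<Rightarrow> ((nat \<times> 'x \<Rightarrow> real) \<times> 'x \<Rightarrow> 'i \<Rightarrow> 'b) \<Rightarrow> bool" where
  "stage k V u \<longleftrightarrow>
     (\<forall>i<k. (\<forall>y\<in>topspace X. openin X (V (i, y))) \<and> (\<Union>y\<in>topspace X. V (i, y)) = topspace X \<and>
        locally_finite_family X (topspace X) (\<lambda>y. V (i, y))) \<and>
     (\<forall>s. rainbow k s \<longrightarrow> good (top_face s \<times> common_closure V s) u)"

lemma rainbow_card: "rainbow k s \<Longrightarrow> card s \<le> k"
  unfolding rainbow_def by (metis card_image card_lessThan card_mono finite_lessThan)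

lemma rainbow_subset: "rainbow k s \<Longrightarrow> s' \<subseteq> s \<Longrightarrow> rainbow k s'"
  unfolding rainbow_def by (meson finite_subset image_mono inj_on_subset order_trans)

lemma closedin_common_closure: "closedin X (common_closure V s)"
proof (cases "s = {}")
  case False
  have "common_closure V s = (\<Inter>v\<in>s. X closure_of V v)"
    unfolding common_closure_def using False closure_of_subset_topspace[of X] by fast
  then show ?thesis using False by (auto intro!: closedin_Inter)
qed (simp add: common_closure_def)

text \<open>The simplices over whole covers may form an infinite complex, but local finiteness
  leaves finitely many vertices whose closures contain \<open>x0\<close>, and the closures of all
  others miss a neighbourhood of \<open>x0\<close>. A rainbow simplex of \<open>k\<close> colours
  has at most \<open>k \<le> n\<close> vertices, which bounds the dimension of its cone.\<close>

lemma stage_cone: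
  assumes st: "stage k V u" and k: "k \<le> n" and x0: "x0 \<in> topspace X"
  shows "\<exists>W v. openin X W \<and> x0 \<in> W \<and>
    (\<forall>s. rainbow k s \<longrightarrow> good (cone_cell s \<times> (common_closure V s \<inter> W)) v \<and>
       (\<forall>t\<in>top_face s. \<forall>x\<in>common_closure V s \<inter> W. v (t, x) = u (t, x)))"
proof -
  let ?S0 = "{v. fst v < k \<and> snd v \<in> topspace X \<and> x0 \<in> X closure_of V v}"
  have lf: "locally_finite_family X (topspace X) (\<lambda>y. X closure_of V (i, y))" if "i < k" for i
    using st that unfolding stage_def by (intro locally_finite_family_closure) blast
  have "finite {y\<in>topspace X. x0 \<in> X closure_of V (i, y)}" if "i < k" for i
    using locally_finite_family_finite_at[OF lf[OF that] x0] .
  then have "finite (SIGMA i:{..<k}. {y\<in>topspace X. x0 \<in> X closure_of V (i, y)})" by (intro finite_SigmaI) auto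
  moreover have "?S0 = (SIGMA i:{..<k}. {y\<in>topspace X. x0 \<in> X closure_of V (i, y)})" by auto
  ultimately have finS0: "finite ?S0" by metis
  \<comment> \<open>Replacing the closures that contain \<open>x0\<close> by \<open>{}\<close> keeps
    the index set of the locally finite family; \<open>A\<close> is closed and omits
    \<open>x0\<close>.\<close>
  define A where "A = (\<Union>i\<in>{..<k}. \<Union>y\<in>topspace X. if x0 \<in> X closure_of V (i, y) then {} else X closure_of V (i, y))"
  have "closedin X (\<Union>y\<in>topspace X. if x0 \<in> X closure_of V (i, y) then {} else X closure_of V (i, y))" if "i < k" for i
    by (rule closedin_locally_finite_family_Union[OF locally_finite_family_mono[OF lf[OF that]]]) auto
  then have "closedin X A" unfolding A_def by (intro closedin_Union) auto
  then have opA: "openin X (topspace X - A)" by blast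
  have x0A: "x0 \<notin> A" unfolding A_def by auto
  let ?L = "{s. s \<subseteq> ?S0 \<and> rainbow k s}"
  have "\<exists>W v. openin X W \<and> x0 \<in> W \<and>
    (\<forall>s\<in>?L. good (cone_cell s \<times> (common_closure V s \<inter> W)) v \<and>
      (\<forall>t\<in>top_face s. \<forall>x\<in>common_closure V s \<inter> W. v (t, x) = u (t, x)))"
  proof (rule good_cone[OF _ _ _ x0])
    show "finite ?L" using finS0 by simp
    show "s' \<in> ?L" if "s \<in> ?L" "s' \<subseteq> s" for s s'
      using that rainbow_subset[of k s s'] by blast
    show "finite s \<and> card s \<le> n" if "s \<in> ?L" for s
      using that rainbow_card[of k s] k unfolding rainbow_def by auto
    show "x0 \<in> common_closure V s" if "s \<in> ?L" for s using that x0 unfolding common_closure_def by blast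
    show "common_closure V s \<subseteq> common_closure V s'" if "s' \<subseteq> s" for s s'
      using that unfolding common_closure_def by blast
    show "good (top_face s \<times> common_closure V s) u" if "s \<in> ?L" for s
      using st that unfolding stage_def by blast
  qed (rule closedin_common_closure)
  then obtain W v where W: "openin X W" "x0 \<in> W" and
    v: "\<forall>s\<in>?L. good (cone_cell s \<times> (common_closure V s \<inter> W)) v \<and>
      (\<forall>t\<in>top_face s. \<forall>x\<in>common_closure V s \<inter> W. v (t, x) = u (t, x))" by blast
  let ?W = "W \<inter> (topspace X - A)"
  have "good (cone_cell s \<times> (common_closure V s \<inter> ?W)) v \<and>
       (\<forall>t\<in>top_face s. \<forall>x\<in>common_closure V s \<inter> ?W. v (t, x) = u (t, x))" if s: "rainbow k s" for s
  proof (cases "common_closure V s \<inter> ?W = {}")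
    case True
    then show ?thesis by (simp add: good_empty)
  next
    case False
    then obtain x where x: "x \<in> common_closure V s" "x \<notin> A" by blast
    have "v \<in> ?S0" if "v \<in> s" for v
    proof -
      obtain i y where v: "v = (i, y)" by (cases v)
      have iy: "i < k" "y \<in> topspace X" using s that unfolding rainbow_def v by force+
      have "x \<in> X closure_of V (i, y)" using x(1) that unfolding common_closure_def v by blast
      then have "x0 \<in> X closure_of V (i, y)"
        using x(2) iy unfolding A_def by (auto split: if_splits)
      then show ?thesis using iy v by simp
    qed
    then have sL: "s \<in> ?L" using s by blast
    have "good (cone_cell s \<times> (common_closure V s \<inter> ?W)) v"
      by (rule good_mono[of "cone_cell s \<times> (common_closure V s \<inter> W)"]) (use v sL in auto)
    then show ?thesis using v sL by blast
  qed
  moreover have "openin X ?W" "x0 \<in> ?W" using W opA x0 x0A by auto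
  ultimately show ?thesis by blast
qed

text \<open>A new vertex \<open>(k, y)\<close> plays the apex of the cone over the old rainbow
  simplices, on which the family \<open>v y\<close> lives over \<open>W y\<close>. Choosing the new
  cover with closures inside the sets \<open>W y\<close> makes \<open>v y\<close> available wherever
  the vertex is used.\<close>

lemma stage_Suc:
  assumes st: "stage k V u" and k: "k \<le> n"
  shows "\<exists>V u. stage (Suc k) V u"
proof -
  let ?R = "\<lambda>x0 W v. openin X W \<and> x0 \<in> W \<and>
    (\<forall>s. rainbow k s \<longrightarrow> good (cone_cell s \<times> (common_closure V s \<inter> W)) v \<and>
       (\<forall>t\<in>top_face s. \<forall>x\<in>common_closure V s \<inter> W. v (t, x) = u (t, x)))"
  have "\<forall>x0\<in>topspace X. \<exists>W v. ?R x0 W v" using stage_cone[OF st k] by blast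
  then obtain W where "\<forall>x0\<in>topspace X. \<exists>v. ?R x0 (W x0) v" using bchoice by metis
  then obtain v where R: "\<forall>x0\<in>topspace X. ?R x0 (W x0) (v x0)" using bchoice by metis
  have W: "openin X (W y)" "y \<in> W y" if "y \<in> topspace X" for y using R that by simp_all
  have gv: "good (cone_cell s \<times> (common_closure V s \<inter> W y)) (v y)" if "rainbow k s" "y \<in> topspace X" for s y
    using R that by simp
  have vu: "v y (t, x) = u (t, x)"
    if "rainbow k s" "y \<in> topspace X" "t \<in> top_face s" "x \<in> common_closure V s" "x \<in> W y" for s y t x
    using R that by simp
  have covW: "topspace X \<subseteq> (\<Union>y\<in>topspace X. W y)" using W(2) by blast
  obtain V' where V': "\<And>y. y \<in> topspace X \<Longrightarrow> openin X (V' y)" "\<And>y. y \<in> topspace X \<Longrightarrow> X closure_of (V' y) \<subseteq> W y"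
    "(\<Union>y\<in>topspace X. V' y) = topspace X" "locally_finite_family X (topspace X) V'"
    by (rule paracompact_closure_refinement[OF X W(1) covW]) (iprover intro: that)+
  define V2 where "V2 = (\<lambda>(i, y). if i = k then V' y else V (i, y))"
  \<comment> \<open>Resetting the coordinate of the new vertex to 0 turns a point of a simplex with
    that vertex into a point of the cone with apex 0. A rainbow simplex has at most one vertex of
    colour \<open>k\<close>, so \<open>SOME\<close> finds it; where its coordinate vanishes,
    \<open>v y\<close> agrees with \<open>u\<close>.\<close>
  define u2 where "u2 = (\<lambda>(t :: nat \<times> 'x \<Rightarrow> real, x). if \<exists>y. t (k, y) \<noteq> 0
     then let y = (SOME y. t (k, y) \<noteq> 0) in v y (t((k, y) := 0), x) else u (t, x))"
  have V2V: "common_closure V2 s = common_closure V s" if "rainbow k s" for s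
  proof -
    have "V2 v = V v" if "v \<in> s" for v
      using that \<open>rainbow k s\<close> unfolding rainbow_def V2_def by (cases v) auto
    then show ?thesis unfolding common_closure_def by simp
  qed
  have "good (top_face s \<times> common_closure V2 s) u2" if s: "rainbow (Suc k) s" for s
  proof (cases "\<exists>y. (k, y) \<in> s")
    case False
    then have "fst v < k" if "v \<in> s" for v
      using s that unfolding rainbow_def by (cases v) (force simp: less_Suc_eq)
    then have s': "rainbow k s" using s unfolding rainbow_def by auto
    have "good (top_face s \<times> common_closure V s) u" using st s' unfolding stage_def by blast
    then have "good (top_face s \<times> common_closure V s) u2"
    proof (rule good_cong)
      fix p assume "p \<in> top_face s \<times> common_closure V s"
      then obtain t x where p: "p = (t, x)" "t \<in> top_face s" by blast
      have "t (k, y) = 0" for y using p(2) False unfolding top_face_def cone_cell_def by blast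
      then show "u p = u2 p" unfolding u2_def p(1) by simp
    qed
    then show ?thesis unfolding V2V[OF s'] .
  next
    case True
    then obtain y where y: "(k, y) \<in> s" by blast
    have fs: "finite s" using s unfolding rainbow_def by blast
    have yX: "y \<in> topspace X" using s y unfolding rainbow_def by force
    have uniq: "y' = y" if "(k, y') \<in> s" for y'
      using s y that inj_onD[of fst s "(k, y)" "(k, y')"] unfolding rainbow_def by simp
    let ?s = "s - {(k, y)}"
    have s': "rainbow k ?s"
    proof -
      have "fst v < k" if v: "v \<in> ?s" for v
      proof -
        obtain i y' where "v = (i, y')" by (cases v)
        moreover have "fst v < Suc k" using s v unfolding rainbow_def by blast
        moreover have "i \<noteq> k" using uniq v calculation(1) by auto
        ultimately show ?thesis by simp
      qed
      moreover have "rainbow (Suc k) ?s" using s by (rule rainbow_subset) blast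
      ultimately show ?thesis unfolding rainbow_def by auto
    qed
    have cc: "x \<in> common_closure V ?s" "x \<in> W y" if "x \<in> common_closure V2 s" for x
    proof -
      have "x \<in> common_closure V2 ?s" using that unfolding common_closure_def by blast
      then show "x \<in> common_closure V ?s" using V2V[OF s'] by simp
      have "x \<in> X closure_of V2 (k, y)" using that y unfolding common_closure_def by blast
      then show "x \<in> W y" using V'(2)[OF yX] unfolding V2_def by auto
    qed
    have del: "t((k, y) := 0) \<in> cone_cell ?s" if "t \<in> top_face s" for t
    proof -
      have t: "\<And>v. 0 \<le> t v" "\<And>v. v \<notin> s \<Longrightarrow> t v = 0" "sum t s \<le> 1"
        using that unfolding top_face_def cone_cell_def by auto
      have "sum (t((k, y) := 0)) ?s = sum t ?s" by (rule sum.cong) auto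
      also have "\<dots> \<le> sum t s" using fs t(1) by (intro sum_mono2) auto
      finally show ?thesis using t unfolding cone_cell_def by auto
    qed
    have cont: "continuous_map R_UNIV R_UNIV (\<lambda>t. t((k, y) := 0))"
      unfolding continuous_map_componentwise_UNIV
      by (auto simp: fun_upd_def intro!: continuous_map_product_projection)
    have "good (top_face s \<times> common_closure V2 s) (\<lambda>(t, x). v y (t((k, y) := 0), x))"
      by (rule good_compose[OF gv[OF s' yX] cont]) (use del cc in auto)
    moreover have "v y (t((k, y) := 0), x) = u2 (t, x)"
      if t: "t \<in> top_face s" and x: "x \<in> common_closure V2 s" for t x
    proof (cases "t (k, y) = 0")
      case True
      have "t (k, y') = 0" for y'
      proof (cases "y' = y")
        case False
        then have "(k, y') \<notin> s" using uniq by blast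
        then show ?thesis using t unfolding top_face_def cone_cell_def by blast
      qed (use True in simp)
      then have "u2 (t, x) = u (t, x)" unfolding u2_def by simp
      moreover have "t \<in> top_face ?s"
        using t True cone_cell_delete[of t s "(k, y)"] fs unfolding top_face_def
        by (auto simp: sum_diff1)
      moreover have "t((k, y) := 0) = t" using True by auto
      ultimately show ?thesis using vu[OF s' yX, of t x] cc[OF x] by simp
    next
      case False
      have "y' = y" if "t (k, y') \<noteq> 0" for y'
        using that t uniq unfolding top_face_def cone_cell_def by blast
      then have "(SOME y. t (k, y) \<noteq> 0) = y" using False by blast
      then show ?thesis unfolding u2_def using False by (auto simp: Let_def)
    qed
    ultimately show ?thesis by (elim good_cong) auto
  qed
  moreover have "(\<forall>y\<in>topspace X. openin X (V2 (i, y))) \<and> (\<Union>y\<in>topspace X. V2 (i, y)) = topspace X \<and>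
        locally_finite_family X (topspace X) (\<lambda>y. V2 (i, y))" if "i < Suc k" for i
  proof (cases "i = k")
    case True
    then show ?thesis unfolding V2_def using V'(1,3,4) by simp
  next
    case False
    then show ?thesis unfolding V2_def using st that unfolding stage_def by simp
  qed
  ultimately have "stage (Suc k) V2 u2" unfolding stage_def by simp
  then show ?thesis by blast
qed

lemma stage_exists: "k \<le> Suc n \<Longrightarrow> \<exists>V u. stage k V u"
proof (induction k)
  case 0
  \<comment> \<open>Only \<open>s = {}\<close> is rainbow when there are no colours, and its empty
    sum is not 1.\<close>
  have "top_face s = {}" if "rainbow 0 s" for s
    using that unfolding rainbow_def top_face_def by auto
  then have "stage 0 V u" for V u unfolding stage_def by (simp add: good_empty)
  then show ?case by blast
next
  case (Suc k) then show ?case using stage_Suc by (meson Suc_leD Suc_le_mono)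
qed

text \<open>Since the refinement is disjoint within each colour, the vertices active at a point form
  a rainbow simplex and the point lies in all the corresponding cover members; so
  \<open>\<tau> x\<close> is in a face on which \<open>u\<close> is good over that point.\<close>

theorem selection_in_open_graph:
  assumes dim: "covering_dim_le X n"
  obtains g where "continuous_map X Y g" "\<And>x. x \<in> topspace X \<Longrightarrow> g x \<in> \<phi> x"
    "\<And>x. x \<in> topspace X \<Longrightarrow> (x, g x) \<in> \<Omega>"
proof -
  obtain V u where st: "stage (Suc n) V u" using stage_exists by blast
  have V: "openin X (V (i, y))" if "i \<le> n" "y \<in> topspace X" for i y
    using st that unfolding stage_def by (simp add: less_Suc_eq_le)
  have covV: "topspace X \<subseteq> (\<Union>y\<in>topspace X. V (i, y))" if "i \<le> n" for i
    using st that unfolding stage_def by (simp add: less_Suc_eq_le)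
  show ?thesis
  proof (rule simultaneous_coloured_refinement[OF X dim V covV])
    fix G :: "nat \<Rightarrow> 'x \<Rightarrow> 'x set"
    assume G: "\<And>i y. openin X (G i y)" "\<And>i y. i \<le> n \<Longrightarrow> y \<in> topspace X \<Longrightarrow> G i y \<subseteq> V (i, y)"
      "\<And>i y y'. y \<noteq> y' \<Longrightarrow> G i y \<inter> G i y' = {}" "topspace X \<subseteq> (\<Union>i\<le>n. \<Union>y\<in>topspace X. G i y)"
    let ?J = "{..n} \<times> topspace X"
    obtain p where "partition_of_unity X ?J (\<lambda>v. G (fst v) (snd v)) p"
      by (rule paracompact_partition_of_unity[OF X, of ?J "\<lambda>v. G (fst v) (snd v)"])
        (use G(1,4) in \<open>auto, blast\<close>)
    note p = partition_of_unityD[OF this]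
    define \<tau> where "\<tau> = (\<lambda>x v. if v \<in> ?J then p v x else 0)"
    define \<sigma> where "\<sigma> = (\<lambda>x. {v\<in>?J. p v x \<noteq> 0})"
    define g where "g = (\<lambda>x. u (\<tau> x, x))"
    have \<tau>c: "continuous_map X R_UNIV \<tau>"
      unfolding continuous_map_componentwise_UNIV \<tau>_def using p(1) by auto
    have \<sigma>r: "rainbow (Suc n) (\<sigma> x)" and \<sigma>c: "x \<in> common_closure V (\<sigma> x)" if x: "x \<in> topspace X" for x
    proof -
      have xG: "x \<in> G i y" "i \<le> n" "y \<in> topspace X" if "(i, y) \<in> \<sigma> x" for i y
        using p(4)[of "(i, y)" x] that x unfolding \<sigma>_def by auto
      have "inj_on fst (\<sigma> x)"
      proof (rule inj_onI)
        fix v w assume vw: "v \<in> \<sigma> x" "w \<in> \<sigma> x" "fst v = fst w"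
        obtain i y y' where "v = (i, y)" "w = (i, y')" using vw(3) by (cases v; cases w) auto
        then show "v = w" using xG(1) vw G(3)[of y y' i] by blast
      qed
      moreover have "fst ` \<sigma> x \<subseteq> {..<Suc n}" "snd ` \<sigma> x \<subseteq> topspace X" unfolding \<sigma>_def by auto
      ultimately show "rainbow (Suc n) (\<sigma> x)" using p(5)[OF x] unfolding rainbow_def \<sigma>_def by blast
      have "x \<in> X closure_of V (i, y)" if "(i, y) \<in> \<sigma> x" for i y
        using xG[OF that] G(2) closure_of_subset[OF openin_subset[OF V]] by blast
      then show "x \<in> common_closure V (\<sigma> x)" using x unfolding common_closure_def by auto
    qed
    have face: "\<tau> x \<in> top_face s"
      if x: "x \<in> topspace X" and "\<sigma> x \<subseteq> s" "finite s" "s \<subseteq> ?J" for x s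
    proof -
      have "sum (\<tau> x) s = sum (\<lambda>v. p v x) s" using that(4) unfolding \<tau>_def by (intro sum.cong) auto
      also have "\<dots> = sum (\<lambda>v. p v x) (\<sigma> x)"
        using that unfolding \<sigma>_def by (intro sum.mono_neutral_right) auto
      also have "\<dots> = 1" using p(6)[OF x] unfolding \<sigma>_def .
      finally show ?thesis
        using that(2) p(3)[OF _ x] unfolding top_face_def cone_cell_def \<tau>_def \<sigma>_def by auto
    qed
    have gu: "good (top_face s \<times> common_closure V s) u" if "rainbow (Suc n) s" for s
      using st that unfolding stage_def by blast
    have "\<exists>N. openin X N \<and> x \<in> N \<and> continuous_map (subtopology X N) Y g" if x: "x \<in> topspace X" for x
    proof -
      obtain N where N: "openin X N" "x \<in> N" "finite {v\<in>?J. {x\<in>topspace X. p v x \<noteq> 0} \<inter> N \<noteq> {}}"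
        using p(2) x unfolding locally_finite_family_def by blast
      define F where "F = {v\<in>?J. {x\<in>topspace X. p v x \<noteq> 0} \<inter> N \<noteq> {}}"
      have NX: "N \<subseteq> topspace X" using openin_subset[OF N(1)] .
      have \<sigma>F: "\<sigma> x \<subseteq> F" if "x \<in> N" for x using that NX unfolding \<sigma>_def F_def by blast
      define \<L> where "\<L> = {s. s \<subseteq> F \<and> rainbow (Suc n) s}"
      have fin\<L>: "finite \<L>" unfolding \<L>_def using N(3) F_def by simp
      \<comment> \<open>\<open>u\<close> is continuous only face by face. The points of
        \<open>N\<close> that lie in \<open>common_closure V s\<close> and have all active vertices
        in \<open>s\<close> form a relatively closed piece on which \<open>g\<close> uses the one
        face \<open>top_face s\<close>; finitely many such pieces cover \<open>N\<close>.\<close>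
      define T where "T = (\<lambda>s. N \<inter> (common_closure V s \<inter> (topspace X \<inter> (\<Inter>v\<in>F - s. {x\<in>topspace X. p v x \<in> {0}}))))"
      have Tcl: "closedin (subtopology X N) (T s)" for s
      proof -
        have "closedin X {x\<in>topspace X. p v x \<in> {0}}" if "v \<in> F - s" for v
          using that p(1)[of v] unfolding F_def
          by (intro closedin_continuous_map_preimage[of X euclideanreal]) auto
        then have "closedin X (\<Inter>(insert (topspace X) ((\<lambda>v. {x\<in>topspace X. p v x \<in> {0}}) ` (F - s))))"
          by (intro closedin_Inter) auto
        then have cl: "closedin X (topspace X \<inter> (\<Inter>v\<in>F - s. {x\<in>topspace X. p v x \<in> {0}}))"
          by (simp only: Inter_insert)
        show ?thesis
          unfolding T_def
          by (rule closedin_subtopology_Int_closed[OF closedin_Int[OF closedin_common_closure cl]])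
      qed
      have \<sigma>s: "\<sigma> x \<subseteq> s" "x \<in> N" "x \<in> common_closure V s" if "x \<in> T s" for x s
      proof -
        show "x \<in> N" "x \<in> common_closure V s" using that unfolding T_def by blast+
        have "p v x = 0" if "v \<in> F - s" for v using that \<open>x \<in> T s\<close> unfolding T_def by blast
        then show "\<sigma> x \<subseteq> s" using \<sigma>F[OF \<open>x \<in> N\<close>] unfolding \<sigma>_def by blast
      qed
      have "continuous_map (subtopology X N) Y g"
      proof (rule pasting_lemma_closed[where I = \<L> and T = T and f = "\<lambda>_. g"])
        show "continuous_map (subtopology (subtopology X N) (T s)) Y g" if s: "s \<in> \<L>" for s
        proof -
          have sr: "rainbow (Suc n) s" "s \<subseteq> ?J" "finite s" using s unfolding \<L>_def F_def rainbow_def by auto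
          have "continuous_map (subtopology X (T s)) (prod_topology R_UNIV X) (\<lambda>x. (\<tau> x, x))"
            using \<tau>c by (auto simp: continuous_map_paired intro: continuous_map_from_subtopology)
          moreover have "(\<tau> x, x) \<in> top_face s \<times> common_closure V s" if "x \<in> T s" for x
            using face[of x s] \<sigma>s[OF that] NX sr by auto
          ultimately have "continuous_map (subtopology X (T s))
              (subtopology (prod_topology R_UNIV X) (top_face s \<times> common_closure V s)) (\<lambda>x. (\<tau> x, x))"
            by (auto simp: continuous_map_in_subtopology)
          from continuous_map_compose[OF this, of Y u]
          have "continuous_map (subtopology X (T s)) Y g"
            using gu[OF sr(1)] unfolding good_def g_def by (simp add: o_def)
          moreover have "N \<inter> T s = T s" unfolding T_def by blast
          ultimately show ?thesis by (simp add: subtopology_subtopology)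
        qed
        show "\<exists>s. s \<in> \<L> \<and> x \<in> T s \<and> g x = g x" if "x \<in> topspace (subtopology X N)" for x
        proof -
          have xN: "x \<in> N" "x \<in> topspace X" using that by auto
          have "x \<in> {x\<in>topspace X. p v x \<in> {0}}" if "v \<in> F - \<sigma> x" for v
            using that xN unfolding F_def \<sigma>_def by blast
          then have "x \<in> T (\<sigma> x)" unfolding T_def using xN \<sigma>c by blast
          moreover have "\<sigma> x \<in> \<L>" unfolding \<L>_def using \<sigma>F[OF xN(1)] \<sigma>r[OF xN(2)] by blast
          ultimately show ?thesis by blast
        qed
      qed (use fin\<L> Tcl in auto)
      then show ?thesis using N by blast
    qed
    then have "\<forall>x\<in>topspace X. \<exists>N. openin X N \<and> x \<in> N \<and> continuous_map (subtopology X N) Y g" by blast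
    from bchoice[OF this] obtain N where N: "\<forall>x\<in>topspace X. openin X (N x) \<and> x \<in> N x \<and> continuous_map (subtopology X (N x)) Y g" ..
    have "continuous_map X Y g"
      by (rule pasting_lemma[where I = "topspace X" and T = N and f = "\<lambda>_. g"]) (use N in auto)
    moreover have "g x \<in> \<phi> x \<and> (x, g x) \<in> \<Omega>" if x: "x \<in> topspace X" for x
    proof -
      have "\<tau> x \<in> top_face (\<sigma> x)"
        using face[OF x subset_refl] p(5)[OF x] unfolding \<sigma>_def by blast
      then show ?thesis using gu[OF \<sigma>r[OF x]] \<sigma>c[OF x] unfolding good_def g_def by blast
    qed
    ultimately show thesis by (intro that[of g]) blast+
  qed
qed

end

section \<open>Avoiding \<open>\<sigma>Z\<^sub>n\<close>-sets\<close>

lemma topspace_ball_space: "topspace (ball_space n) = {x. (\<forall>i\<ge>n. x i = 0) \<and> (\<Sum>i<n. x i ^ 2) \<le> 1}"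
  unfolding ball_space_def by (auto simp: topspace_Euclidean_space)

lemma ball_space_eq: "ball_space n = subtopology R_UNIV (topspace (ball_space n))"
  unfolding topspace_ball_space unfolding ball_space_def Euclidean_space_def subtopology_subtopology
  by (rule arg_cong2[where f = subtopology]) auto

lemma compact_space_ball_space: "compact_space (ball_space n)"
proof -
  have pr: "continuous_map R_UNIV euclideanreal (\<lambda>t. t v)" for v
    by (rule continuous_map_product_projection) simp
  have "closedin R_UNIV {t \<in> topspace R_UNIV. t i \<in> (if n \<le> i then {0} else UNIV)}" for i
    by (intro closedin_continuous_map_preimage[OF pr]) auto
  moreover have "closedin R_UNIV {t \<in> topspace R_UNIV. (\<Sum>i<n. t i ^ 2) \<in> {..1}}"
    by (intro closedin_continuous_map_preimage[of _ euclideanreal] continuous_map_sum continuous_map_real_pow pr) auto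
  ultimately have "closedin R_UNIV ((\<Inter>i. {t \<in> topspace R_UNIV. t i \<in> (if n \<le> i then {0} else UNIV)})
      \<inter> {t \<in> topspace R_UNIV. (\<Sum>i<n. t i ^ 2) \<in> {..1}})"
    by (intro closedin_Int closedin_Inter) auto
  moreover have "(\<Inter>i. {t \<in> topspace R_UNIV. t i \<in> (if n \<le> i then {0} else UNIV)})
      \<inter> {t \<in> topspace R_UNIV. (\<Sum>i<n. t i ^ 2) \<in> {..1}} = topspace (ball_space n)"
    unfolding topspace_ball_space by (auto split: if_splits)
  ultimately have cl: "closedin R_UNIV (topspace (ball_space n))" by metis
  have "topspace (ball_space n) \<subseteq> PiE UNIV (\<lambda>_. {-1..1})"
  proof
    fix x assume "x \<in> topspace (ball_space n)"
    then have x: "\<forall>i\<ge>n. x i = 0" "(\<Sum>i<n. x i ^ 2) \<le> 1" unfolding topspace_ball_space by auto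
    have "\<bar>x i\<bar> \<le> 1" for i
    proof (cases "i < n")
      case True
      then have "x i ^ 2 \<le> (\<Sum>i<n. x i ^ 2)" by (intro member_le_sum) auto
      then have "x i ^ 2 \<le> 1" using x(2) by linarith
      then show ?thesis by (simp add: abs_square_le_1)
    qed (use x(1) in simp)
    then show "x \<in> PiE UNIV (\<lambda>_. {-1..1})" by (auto simp: abs_le_iff minus_le_iff)
  qed
  moreover have "compactin R_UNIV (PiE UNIV (\<lambda>_. {-1..1::real}))"
    by (subst compactin_PiE) auto
  ultimately have "compactin R_UNIV (topspace (ball_space n))"
    using cl closed_compactin by blast
  then show ?thesis
    by (subst ball_space_eq) (rule compact_space_subtopology)
qed

section \<open>Baire category in the space of maps from the ball\<close>

lemma Lebesgue_number_open:
  assumes "compactin (mtopology_of m) K" "K \<subseteq> O'" "openin (mtopology_of m) O'"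
  obtains d where "0 < d" "\<And>x y. x \<in> K \<Longrightarrow> y \<in> mspace m \<Longrightarrow> mdist m x y < d \<Longrightarrow> y \<in> O'"
proof -
  interpret M: Metric_space "mspace m" "mdist m" by (rule Metric_space_mspace_mdist)
  have "\<exists>\<epsilon>>0. \<forall>x\<in>K. \<exists>U\<in>{O'}. M.mball x \<epsilon> \<subseteq> U"
    by (rule M.lebesgue_number) (use assms in \<open>auto simp: mtopology_of_def\<close>)
  then obtain \<epsilon> where e: "\<epsilon> > 0" "\<And>x. x \<in> K \<Longrightarrow> M.mball x \<epsilon> \<subseteq> O'" by blast
  have "y \<in> O'" if "x \<in> K" "y \<in> mspace m" "mdist m x y < \<epsilon>" for x y
  proof -
    have "x \<in> mspace m" using compactin_subset_topspace[OF assms(1)] that(1) by auto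
    then have "y \<in> M.mball x \<epsilon>" using that by simp
    then show ?thesis using e(2)[OF that(1)] by blast
  qed
  then show ?thesis using e(1) that by blast
qed

text \<open>A Lebesgue number in \<open>m'\<close> for a cover by balls of \<open>m\<close> compares
  the two metrics uniformly near a compact set. It links the metric supplied by
  \<open>Zn_set\<close> with a complete one; \<open>y\<close> ranges over the whole space because
  nearby maps leave the compact image.\<close>

lemma compact_image_uniform_comparison:
  assumes top: "mtopology_of m = mtopology_of m'" and K: "compactin (mtopology_of m) K" and r: "0 < r"
  obtains d where "0 < d" "\<And>x y. x \<in> K \<Longrightarrow> y \<in> mspace m \<Longrightarrow> mdist m' x y < d \<Longrightarrow> mdist m x y < r"
proof -
  interpret M: Metric_space "mspace m" "mdist m" by (rule Metric_space_mspace_mdist)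
  interpret M': Metric_space "mspace m'" "mdist m'" by (rule Metric_space_mspace_mdist)
  have ms: "mspace m = mspace m'" using top by (metis topspace_mtopology_of)
  have tM: "mtopology_of m = M.mtopology" "mtopology_of m = M'.mtopology"
    using top by (auto simp: mtopology_of_def)
  have KM: "K \<subseteq> mspace m" using compactin_subset_topspace[OF K] by simp
  have "\<exists>\<epsilon>>0. \<forall>x\<in>K. \<exists>U\<in>(\<lambda>c. M.mball c (r/2)) ` mspace m. M'.mball x \<epsilon> \<subseteq> U"
  proof (rule M'.lebesgue_number)
    show "compactin M'.mtopology K" using K tM by simp
    show "K \<subseteq> \<Union>((\<lambda>c. M.mball c (r/2)) ` mspace m)" using KM r by auto
    show "openin M'.mtopology U" if "U \<in> (\<lambda>c. M.mball c (r/2)) ` mspace m" for U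
      using that M.openin_mball tM by auto
  qed
  then obtain \<epsilon> where e: "\<epsilon> > 0" "\<And>x. x \<in> K \<Longrightarrow> \<exists>c\<in>mspace m. M'.mball x \<epsilon> \<subseteq> M.mball c (r/2)" by blast
  have "mdist m x y < r" if "x \<in> K" "y \<in> mspace m" "mdist m' x y < \<epsilon>" for x y
  proof -
    obtain c where c: "c \<in> mspace m" "M'.mball x \<epsilon> \<subseteq> M.mball c (r/2)" using e(2)[OF \<open>x \<in> K\<close>] by blast
    have xM: "x \<in> mspace m" using KM that(1) by blast
    then have "x \<in> M'.mball x \<epsilon>" "y \<in> M'.mball x \<epsilon>" using that e(1) ms by auto
    then have "x \<in> M.mball c (r/2)" "y \<in> M.mball c (r/2)" using c(2) by blast+
    then have "mdist m c x < r/2" "mdist m c y < r/2" by auto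
    then show ?thesis using M.triangle[of x c y] c(1) xM that(2) M.commute[of x c] by linarith
  qed
  then show ?thesis using e(1) that by blast
qed

text \<open>Compactness of the ball makes avoiding one closed set an open condition, and
  \<open>Zn_set\<close> makes it dense; completeness of \<open>cfunspace\<close> then allows all
  members of the countable union to be avoided at once.\<close>

lemma sigma_Zn_set_avoid:
  assumes top: "mtopology_of m = Z" and complete: "mcomplete_of m" and S: "sigma_Zn_set n Z S"
    and w: "continuous_map (ball_space n) Z w" and e: "0 < e"
  obtains w' where "continuous_map (ball_space n) Z w'"
    "\<And>t. t \<in> topspace (ball_space n) \<Longrightarrow> mdist m (w' t) (w t) < e"
    "\<And>t. t \<in> topspace (ball_space n) \<Longrightarrow> w' t \<notin> S"
proof -
  let ?B = "ball_space n"
  let ?CF = "cfunspace ?B m"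
  interpret M: Metric_space "mspace m" "mdist m" by (rule Metric_space_mspace_mdist)
  interpret CF: Metric_space "mspace ?CF" "mdist ?CF" by (rule Metric_space_mspace_mdist)
  have compB: "compactin ?B (topspace ?B)" using compact_space_ball_space by (simp add: compact_space_def)
  have "M.Self = m" unfolding M.Self_def by (simp add: mspace_def mdist_def dest_metric_inverse)
  then have CFcomplete: "CF.mcomplete"
    using M.mcomplete_cfunspace[of ?B] complete by (simp add: mcomplete_of_def)
  have mspaceZ: "mspace m' = topspace Z" if "mtopology_of m' = Z" for m'
    using that by (metis topspace_mtopology_of)
  have CFspace: "mspace (cfunspace ?B m') =
      {f. f \<in> extensional (topspace ?B) \<and> continuous_map ?B Z f}" if "mtopology_of m' = Z" for m'
    unfolding compactin_mspace_cfunspace[OF compB] that mspaceZ[OF that]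
    using continuous_map_funspace[of ?B Z] by fast
  have img: "compactin Z (f ` topspace ?B)" if "f \<in> mspace ?CF" for f
    using that compB unfolding CFspace[OF top] by (blast intro: image_compactin)
  obtain \<F> where \<F>: "countable \<F>" "\<And>F. F \<in> \<F> \<Longrightarrow> Zn_set n Z F" "\<Union>\<F> = S"
    using S unfolding sigma_Zn_set_def by blast
  define G where "G = (\<lambda>F. {f \<in> mspace ?CF. f ` topspace ?B \<subseteq> topspace Z - F})"
  have "openin CF.mtopology (G F)" if F: "F \<in> \<F>" for F
    unfolding CF.openin_mtopology
  proof (intro conjI allI impI)
    show "G F \<subseteq> mspace ?CF" unfolding G_def by blast
    fix f assume f: "f \<in> G F"
    have "closedin Z F" using \<F>(2)[OF F] unfolding Zn_set_def by blast
    then obtain d where d: "0 < d"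
      "\<And>x y. x \<in> f ` topspace ?B \<Longrightarrow> y \<in> mspace m \<Longrightarrow> mdist m x y < d \<Longrightarrow> y \<in> topspace Z - F"
      using Lebesgue_number_open[of m "f ` topspace ?B" "topspace Z - F"] img[of f] f top
      unfolding G_def by blast
    have "CF.mball f d \<subseteq> G F"
    proof
      fix g assume g: "g \<in> CF.mball f d"
      then have fg: "f \<in> mspace ?CF" "g \<in> mspace ?CF" "mdist ?CF f g < d" unfolding CF.in_mball by blast+
      have "g t \<in> topspace Z - F" if t: "t \<in> topspace ?B" for t
      proof (rule d(2))
        show "f t \<in> f ` topspace ?B" using t by blast
        show "g t \<in> mspace m" using fg(2) t by (auto simp: mspaceZ[OF top])
        show "mdist m (f t) (g t) < d"
          using mdist_cfunspace_imp_mdist_le[OF fg(1,2) order_refl t] fg(3) by linarith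
      qed
      then show "g \<in> G F" unfolding G_def using fg(2) by blast
    qed
    then show "\<exists>r>0. CF.mball f r \<subseteq> G F" using d(1) by blast
  qed
  moreover have "CF.mtopology closure_of (G F) = mspace ?CF" if F: "F \<in> \<F>" for F
  proof -
    obtain m' where m': "mtopology_of m' = Z"
      "mtopology_of (cfunspace ?B m') closure_of
            {f \<in> mspace (cfunspace ?B m'). f ` topspace ?B \<subseteq> topspace Z - F} = mspace (cfunspace ?B m')"
      using \<F>(2)[OF F] unfolding Zn_set_def by blast
    interpret CF': Metric_space "mspace (cfunspace ?B m')" "mdist (cfunspace ?B m')"
      by (rule Metric_space_mspace_mdist)
    have sp: "mspace (cfunspace ?B m') = mspace ?CF" using CFspace[OF m'(1)] CFspace[OF top] by simp
    have "\<exists>g\<in>G F. g \<in> CF.mball f r" if f: "f \<in> mspace ?CF" and r: "r > 0" for f r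
    proof -
      obtain d where d: "0 < d"
        "\<And>x y. x \<in> f ` topspace ?B \<Longrightarrow> y \<in> mspace m \<Longrightarrow> mdist m' x y < d \<Longrightarrow> mdist m x y < r/2"
        by (rule compact_image_uniform_comparison[of m m' "f ` topspace ?B" "r/2"])
          (use m'(1) top img[OF f] r in auto)
      have "f \<in> CF'.mtopology closure_of (G F)"
        using m'(2) f unfolding G_def sp mtopology_of_def by blast
      then obtain g where g: "g \<in> G F" "g \<in> CF'.mball f d"
        unfolding CF'.metric_closure_of using d(1) by blast
      then have fg: "f \<in> mspace (cfunspace ?B m')" "g \<in> mspace (cfunspace ?B m')" "mdist (cfunspace ?B m') f g < d"
        unfolding CF'.in_mball by blast+
      have gCF: "g \<in> mspace ?CF" using fg(2) unfolding sp .
      have "mdist m (f t) (g t) \<le> r/2" if t: "t \<in> topspace ?B" for t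
      proof (rule less_imp_le[OF d(2)])
        show "f t \<in> f ` topspace ?B" using t by blast
        show "g t \<in> mspace m" using gCF t by (auto simp: mspaceZ[OF top])
        show "mdist m' (f t) (g t) < d"
          using mdist_cfunspace_imp_mdist_le[OF fg(1,2) order_refl t] fg(3) by linarith
      qed
      then have "mdist ?CF f g \<le> r/2" using r by (intro mdist_cfunspace_le) auto
      then have "g \<in> CF.mball f r" using f gCF r unfolding CF.in_mball by simp
      then show ?thesis using g(1) by blast
    qed
    then show ?thesis unfolding CF.metric_closure_of by blast
  qed
  ultimately have dense: "CF.mtopology closure_of \<Inter>(G ` \<F>) = mspace ?CF"
    using \<F>(1) by (intro CF.metric_Baire_category[OF CFcomplete]) auto
  \<comment> \<open>Elements of \<open>cfunspace\<close> are extensional, so \<open>w\<close> is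
    first restricted to the ball.\<close>
  define w0 where "w0 = restrict w (topspace ?B)"
  have "continuous_map ?B Z w0" using w unfolding w0_def by (auto intro: continuous_map_eq)
  then have "w0 \<in> mspace ?CF" unfolding CFspace[OF top] w0_def by auto
  then have "w0 \<in> CF.mtopology closure_of \<Inter>(G ` \<F>)" using dense by simp
  then obtain w' where w': "w' \<in> \<Inter>(G ` \<F>)" "w' \<in> CF.mball w0 e"
    unfolding CF.metric_closure_of using e by blast
  then have ww: "w0 \<in> mspace ?CF" "w' \<in> mspace ?CF" "mdist ?CF w0 w' < e" unfolding CF.in_mball by blast+
  show ?thesis
  proof (rule that[of w'])
    show "continuous_map ?B Z w'" using ww(2) unfolding CFspace[OF top] by blast
    fix t assume t: "t \<in> topspace ?B"
    show "mdist m (w' t) (w t) < e"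
      using mdist_cfunspace_imp_mdist_le[OF ww(1,2) order_refl t] ww(3) t M.commute[of "w' t" "w t"]
      unfolding w0_def by simp
    show "w' t \<notin> S" using w'(1) t \<F>(3) unfolding G_def by blast
  qed
qed

text \<open>\<open>i\<close> writes the coordinates of \<open>s\<close> into the first places; the
  image is in the ball because squares of numbers between 0 and 1 do not exceed them.
  \<open>r\<close> clips negative coordinates and divides by \<open>q\<close>, which is 1 on the
  image of the cell. The retraction transfers results from the \<open>n\<close>-ball to all cells of
  dimension at most \<open>n\<close>.\<close>

lemma cone_cell_retract_of_ball_space:
  fixes s :: "'v set"
  assumes s: "finite s" "card s \<le> n"
  obtains i r where "continuous_map (subtopology R_UNIV (cone_cell s)) (ball_space n) i"
    "continuous_map (ball_space n) (subtopology R_UNIV (cone_cell s)) r"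
    "\<And>t. t \<in> cone_cell s \<Longrightarrow> r (i t) = t"
proof -
  obtain h where h: "bij_betw h {0..<card s} s" using ex_bij_betw_nat_finite[OF s(1)] by blast
  define k where "k = inv_into {0..<card s} h"
  have hs: "h j \<in> s" if "j < card s" for j using h that unfolding bij_betw_def by auto
  have ks: "k v < card s" "h (k v) = v" if "v \<in> s" for v
    using bij_betw_inv_into_right[OF h that] bij_betw_inv_into[OF h] that unfolding k_def bij_betw_def by auto
  define i where "i = (\<lambda>t j. if j < card s then (t (h j) :: real) else 0)"
  define q where "q = (\<lambda>x::nat \<Rightarrow> real. max 1 (\<Sum>v\<in>s. max 0 (x (k v))))"
  define r where "r = (\<lambda>x v. if v \<in> s then max 0 (x (k v)) / q x else 0)"
  have q1: "1 \<le> q x" for x unfolding q_def by simp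
  show ?thesis
  proof (rule that[of i r])
    have "continuous_map R_UNIV R_UNIV i"
      unfolding continuous_map_componentwise_UNIV i_def by (auto intro!: continuous_map_product_projection)
    moreover have "i t \<in> topspace (ball_space n)" if t: "t \<in> cone_cell s" for t
    proof -
      have t01: "0 \<le> t v" "t v \<le> 1" for v
      proof -
        show "0 \<le> t v" using t unfolding cone_cell_def by blast
        show "t v \<le> 1"
        proof (cases "v \<in> s")
          case True
          then have "t v \<le> sum t s" using s t unfolding cone_cell_def by (intro member_le_sum) auto
          then show ?thesis using t unfolding cone_cell_def by simp
        qed (use t in \<open>auto simp: cone_cell_def\<close>)
      qed
      have "(\<Sum>j<n. i t j ^ 2) = (\<Sum>j\<in>{0..<card s}. t (h j) ^ 2)"
        unfolding i_def using s(2) by (intro sum.mono_neutral_cong_right) auto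
      also have "\<dots> = (\<Sum>v\<in>s. t v ^ 2)" by (rule sum.reindex_bij_betw[OF h])
      also have "\<dots> \<le> sum t s"
        using t01 by (intro sum_mono) (simp add: power2_eq_square mult_left_le)
      also have "\<dots> \<le> 1" using t unfolding cone_cell_def by blast
      finally show ?thesis unfolding topspace_ball_space i_def using s(2) by auto
    qed
    ultimately show "continuous_map (subtopology R_UNIV (cone_cell s)) (ball_space n) i"
      by (subst ball_space_eq) (auto simp: continuous_map_in_subtopology continuous_map_from_subtopology)
    have pr: "continuous_map R_UNIV euclideanreal (\<lambda>x. x j)" for j :: nat
      by (rule continuous_map_product_projection) simp
    have cq: "continuous_map R_UNIV euclideanreal q"
      unfolding q_def by (intro continuous_map_real_max continuous_map_sum pr s(1)) auto
    have "continuous_map R_UNIV R_UNIV r"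
      unfolding continuous_map_componentwise_UNIV
    proof
      fix v
      show "continuous_map R_UNIV euclideanreal (\<lambda>x. r x v)"
      proof (cases "v \<in> s")
        case True
        have "q x \<noteq> 0" for x using q1[of x] by linarith
        then have "continuous_map R_UNIV euclideanreal (\<lambda>x. max 0 (x (k v)) / q x)"
          by (intro continuous_map_real_divide continuous_map_real_max cq pr) auto
        then show ?thesis using True by (simp add: r_def)
      qed (simp add: r_def)
    qed
    moreover have "r x \<in> cone_cell s" for x
    proof -
      have "sum (r x) s = (\<Sum>v\<in>s. max 0 (x (k v))) / q x"
        unfolding r_def sum_divide_distrib by (rule sum.cong) auto
      also have "\<dots> \<le> 1" using q1[of x] by (subst divide_le_eq_1_pos) (auto simp: q_def)
      finally show ?thesis using q1[of x] unfolding cone_cell_def r_def by (auto intro!: divide_nonneg_nonneg)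
    qed
    ultimately show "continuous_map (ball_space n) (subtopology R_UNIV (cone_cell s)) r"
      by (subst ball_space_eq) (auto simp: continuous_map_in_subtopology continuous_map_from_subtopology)
    show "r (i t) = t" if t: "t \<in> cone_cell s" for t
    proof
      fix v
      have ik: "max 0 (i t (k v)) = t v" if "v \<in> s" for v
        using ks[OF that] t unfolding i_def cone_cell_def by simp
      have "(\<Sum>v\<in>s. max 0 (i t (k v))) = sum t s" using ik by (intro sum.cong) auto
      then have "q (i t) = 1" using t unfolding q_def cone_cell_def by simp
      then show "r (i t) v = t v" using ik t unfolding r_def cone_cell_def by auto
    qed
  qed
qed

section \<open>Filling cells away from a closed set\<close>

context banach_product
begin

lemma mtopology_of_Self: "mtopology_of P.Self = Y"
  by (simp add: mtopology_of_def mtopology_pdist)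

lemma convex_pdist_cball:
  assumes "c \<in> topspace Y"
  shows "convex_in_prod I {y\<in>topspace Y. pdist y c \<le> r}"
proof -
  have "pdist (mix t y z) c \<le> r" if "pdist y c \<le> r" "pdist z c \<le> r" "t \<in> {0..1}" for y z t
    using pdist_mix_le[of t y c r z c] that mix_same[OF assms, of t] by auto
  then show ?thesis unfolding convex_in_prod_mix using mix_in_topspace by auto
qed

text \<open>\<open>w\<close> is pulled back to the ball along the retraction, perturbed there, and
  restricted to the cell again. Since \<open>C\<close> is closed, the metric restricted to it is
  complete.\<close>

lemma cone_cell_avoid:
  fixes s :: "'v set"
  assumes C: "closedin Y C" and S: "sigma_Zn_set n (subtopology Y C) S"
    and s: "finite s" "card s \<le> n" and w: "continuous_map (subtopology R_UNIV (cone_cell s)) Y w"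
    and wC: "\<And>t. t \<in> cone_cell s \<Longrightarrow> w t \<in> C" and e: "0 < e"
  obtains w' where "continuous_map (subtopology R_UNIV (cone_cell s)) Y w'"
    "\<And>t. t \<in> cone_cell s \<Longrightarrow> w' t \<in> C" "\<And>t. t \<in> cone_cell s \<Longrightarrow> pdist (w' t) (w t) < e"
    "\<And>t. t \<in> cone_cell s \<Longrightarrow> w' t \<notin> S"
proof -
  let ?K = "subtopology R_UNIV (cone_cell s)" and ?Z = "subtopology Y C"
  obtain i r where i: "continuous_map ?K (ball_space n) i" and r: "continuous_map (ball_space n) ?K r"
    and ri: "\<And>t. t \<in> cone_cell s \<Longrightarrow> r (i t) = t"
    by (rule cone_cell_retract_of_ball_space[OF s]) (iprover intro: that)
  interpret Sub: Submetric "topspace (prod_space I E)" pdist C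
    by unfold_locales (use closedin_subset[OF C] in simp)
  have top: "mtopology_of Sub.sub.Self = ?Z"
    using Sub.mtopology_submetric by (simp add: mtopology_of_def mtopology_pdist)
  have "mcomplete_of Sub.sub.Self"
    using Sub.closedin_eq_mcomplete[OF mcomplete_pdist] C by (simp add: mcomplete_of_def mtopology_pdist)
  note avoid = sigma_Zn_set_avoid[OF top this S _ e]
  have wZ: "continuous_map ?K ?Z w"
    using w wC by (auto simp: continuous_map_in_subtopology)
  have wr: "continuous_map (ball_space n) ?Z (w \<circ> r)"
    by (rule continuous_map_compose[OF r wZ])
  have it: "i t \<in> topspace (ball_space n)" if "t \<in> cone_cell s" for t
    using continuous_map_funspace[OF i] that by auto
  obtain w1 where w1: "continuous_map (ball_space n) ?Z w1"
    "\<And>t. t \<in> topspace (ball_space n) \<Longrightarrow> mdist Sub.sub.Self (w1 t) ((w \<circ> r) t) < e"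
    "\<And>t. t \<in> topspace (ball_space n) \<Longrightarrow> w1 t \<notin> S"
    by (rule avoid[OF wr]) (iprover intro: that)
  have wi: "continuous_map ?K ?Z (w1 \<circ> i)" by (rule continuous_map_compose[OF i w1(1)])
  show ?thesis
  proof (rule that[of "w1 \<circ> i"])
    show "continuous_map ?K Y (w1 \<circ> i)" using wi continuous_map_into_fulltopology by blast
    show "(w1 \<circ> i) t \<in> C" if "t \<in> cone_cell s" for t
      using continuous_map_funspace[OF wi] that by auto
    show "pdist ((w1 \<circ> i) t) (w t) < e" if "t \<in> cone_cell s" for t
      using w1(2)[OF it[OF that]] ri[OF that] by simp
    show "(w1 \<circ> i) t \<notin> S" if "t \<in> cone_cell s" for t
      using w1(3)[OF it[OF that]] by simp
  qed
qed

text \<open>Michael's theorem extends \<open>b\<close> inside a smaller closed ball, but the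
  extension may hit \<open>F\<close>; a perturbation that avoids \<open>S\<close> may change the
  boundary values. The two are blended: the extension on the boundary, the perturbation off a
  neighbourhood \<open>N\<close> of it, and in \<open>N\<close> every blend stays near the compact
  image of \<open>b\<close> and hence outside \<open>F\<close>.\<close>

lemma cell_extension_avoiding:
  fixes s :: "'v set"
  assumes C: "C \<in> closed_convex_sets I E" and S: "sigma_Zn_set n (subtopology Y C) S"
    and c: "c \<in> C" and a: "0 < a" and F: "closedin Y F" and FS: "F \<inter> C \<subseteq> S"
    and s: "finite s" "card s \<le> n"
    and b: "continuous_map (subtopology R_UNIV (cell_boundary s)) Y b"
    and bP: "\<And>t. t \<in> cell_boundary s \<Longrightarrow> b t \<in> C \<and> pdist (b t) c < a \<and> b t \<notin> F"
  shows "\<exists>e. continuous_map (subtopology R_UNIV (cone_cell s)) Y e \<and>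
    (\<forall>t\<in>cone_cell s. e t \<in> C \<and> pdist (e t) c < a \<and> e t \<notin> F) \<and> (\<forall>t\<in>cell_boundary s. e t = b t)"
proof -
  note C' = closed_convex_setsD[OF C]
  let ?K = "subtopology R_UNIV (cone_cell s)" and ?bd = "cell_boundary s"
  have cY: "c \<in> topspace Y" using c C'(4) by blast
  have parK: "paracompact_space ?K"
    by (intro compact_imp_paracompact_space compact_space_cone_cell s(1) Hausdorff_space_cone_cell)
  have clbd: "closedin ?K ?bd"
    using closedin_cell_boundary[OF s(1)] cell_boundary_subset by (rule closedin_subset_topspace)
  have compbd: "compactin R_UNIV ?bd"
    by (rule closed_compactin[OF compactin_cone_cell[OF s(1)] cell_boundary_subset closedin_cell_boundary[OF s(1)]])
  then have compb: "compactin Y (b ` ?bd)"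
    by (intro image_compactin[OF _ b]) (simp add: compactin_subtopology)
  \<comment> \<open>Michael's theorem needs closed values, hence a closed ball; compactness of the
    boundary leaves the room \<open>a - r\<close> for the perturbation. When the boundary is empty,
    \<open>r = 0\<close> serves.\<close>
  obtain r where r: "r < a" "0 \<le> r" "\<And>t. t \<in> ?bd \<Longrightarrow> pdist (b t) c \<le> r"
  proof (cases "?bd = {}")
    case True then show ?thesis using that[of 0] a by simp
  next
    case False
    have "continuous_map (subtopology R_UNIV ?bd) euclideanreal (\<lambda>t. pdist (b t) c)"
      using continuous_map_mdist[of "subtopology R_UNIV ?bd" P.Self b "\<lambda>_. c"] b cY by (simp add: mtopology_of_Self)
    then have "compactin euclideanreal ((\<lambda>t. pdist (b t) c) ` ?bd)"
      by (rule image_compactin[rotated]) (simp add: compactin_subtopology compbd)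
    then have "compact ((\<lambda>t. pdist (b t) c) ` ?bd)" by simp
    then obtain t0 where "t0 \<in> ?bd" "\<And>t. t \<in> ?bd \<Longrightarrow> pdist (b t) c \<le> pdist (b t0) c"
      using compact_attains_sup[of "(\<lambda>t. pdist (b t) c) ` ?bd"] False by blast
    then show ?thesis using that[of "pdist (b t0) c"] bP pdist_nonneg by blast
  qed
  let ?C = "C \<inter> {y\<in>topspace Y. pdist y c \<le> r}"
  have "closedin P.mtopology (P.mcball c r)" by (rule P.closedin_mcball)
  moreover have "P.mcball c r = {y\<in>topspace Y. pdist y c \<le> r}" using cY by (auto simp: P.commute)
  ultimately have "closedin Y {y\<in>topspace Y. pdist y c \<le> r}" by (simp add: mtopology_pdist)
  then have "closedin Y ?C" using C'(2) by (rule closedin_Int[rotated])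
  moreover have "convex_in_prod I ?C" by (intro convex_in_prod_Int C'(3) convex_pdist_cball cY)
  moreover have "c \<in> ?C" using c cY r(2) by simp
  ultimately have CC: "?C \<in> closed_convex_sets I E" unfolding closed_convex_sets_def by blast
  have lscC: "lower_semicontinuous ?K Y (\<lambda>_. ?C)"
    unfolding lower_semicontinuous_def
  proof (intro allI impI)
    fix U
    show "openin ?K {x\<in>topspace ?K. ?C \<inter> U \<noteq> {}}"
    proof (cases "?C \<inter> U = {}")
      case True
      then have "{x\<in>topspace ?K. ?C \<inter> U \<noteq> {}} = {}" by simp
      then show ?thesis by (simp only: openin_empty)
    next
      case False
      then have "{x\<in>topspace ?K. ?C \<inter> U \<noteq> {}} = topspace ?K" by simp
      then show ?thesis by (simp only: openin_topspace)
    qed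
  qed
  have b': "continuous_map (subtopology ?K ?bd) Y b"
    using b cell_boundary_subset[of s] by (simp add: subtopology_subtopology Int_absorb1)
  have bC: "b t \<in> ?C" if "t \<in> ?bd" for t using bP[OF that] r(3)[OF that] C'(4) by blast
  obtain e where e: "continuous_map ?K Y e" "\<And>t. t \<in> topspace ?K \<Longrightarrow> e t \<in> ?C" "\<And>t. t \<in> ?bd \<Longrightarrow> e t = b t"
    by (rule Michael_extension[OF parK lscC CC clbd b' bC]) (iprover intro: that)+
  have eC: "e t \<in> C" "e t \<in> topspace Y" "pdist (e t) c \<le> r" if "t \<in> cone_cell s" for t using e(2)[of t] that by auto
  obtain \<epsilon> where \<epsilon>: "0 < \<epsilon>" "\<And>x y. x \<in> b ` ?bd \<Longrightarrow> y \<in> topspace Y \<Longrightarrow> pdist x y < \<epsilon> \<Longrightarrow> y \<in> topspace Y - F"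
  proof -
    have "b ` ?bd \<subseteq> topspace Y - F" using bP C'(4) by blast
    moreover have "openin Y (topspace Y - F)" using F by blast
    ultimately show ?thesis
      using Lebesgue_number_open[of P.Self "b ` ?bd" "topspace Y - F"] compb that
      by (auto simp: mtopology_of_Self)
  qed
  \<comment> \<open>Half of \<open>\<epsilon>\<close>, because in \<open>N\<close> two errors add
    up: from a boundary value to \<open>e t\<close> and from \<open>e t\<close> to
    \<open>e' t\<close>. The bound \<open>a - r\<close> keeps \<open>e' t\<close> in the open
    ball.\<close>
  define \<delta> where "\<delta> = min (\<epsilon>/2) (a - r)"
  have \<delta>: "0 < \<delta>" "2 * \<delta> \<le> \<epsilon>" "\<delta> \<le> a - r" unfolding \<delta>_def using \<epsilon>(1) r(1) by (auto simp: min_def)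
  define N where "N = {t\<in>topspace ?K. e t \<in> (\<Union>t'\<in>?bd. P.mball (e t') \<delta>)}"
  have "openin Y (\<Union>t'\<in>?bd. P.mball (e t') \<delta>)"
    using P.openin_mball by (auto simp: mtopology_pdist)
  then have Nop: "openin ?K N" unfolding N_def by (rule openin_continuous_map_preimage[OF e(1)])
  have bdN: "?bd \<subseteq> N" unfolding N_def using cell_boundary_subset[of s] eC \<delta>(1) by fastforce
  have disj: "disjnt (topspace ?K - N) ?bd" using bdN by (auto simp: disjnt_def)
  have clN: "closedin ?K (topspace ?K - N)" using Nop by (rule openin_closedin_eq[THEN iffD1, THEN conjunct2])
  obtain \<mu> where \<mu>: "continuous_map ?K (top_of_set {0..1::real}) \<mu>" "\<mu> ` (topspace ?K - N) \<subseteq> {0}" "\<mu> ` ?bd \<subseteq> {1}"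
    by (rule Urysohn_lemma[OF paracompact_imp_normal_space[OF parK] clN clbd disj zero_le_one]) (iprover intro: that)
  obtain w where w: "continuous_map ?K Y w" "\<And>t. t \<in> cone_cell s \<Longrightarrow> w t \<in> C"
    "\<And>t. t \<in> cone_cell s \<Longrightarrow> pdist (w t) (e t) < \<delta>" "\<And>t. t \<in> cone_cell s \<Longrightarrow> w t \<notin> S"
    by (rule cone_cell_avoid[OF C'(2) S s e(1) eC(1) \<delta>(1)]) (iprover intro: that)+
  define e' where "e' = (\<lambda>t. mix (\<mu> t) (w t) (e t))"
  have "continuous_map ?K Y e'"
    unfolding e'_def using \<mu>(1) by (intro continuous_map_mix w(1) e(1)) (auto intro: continuous_map_into_fulltopology)
  moreover have "e' t \<in> C \<and> pdist (e' t) c < a \<and> e' t \<notin> F" if t: "t \<in> cone_cell s" for t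
  proof -
    have \<mu>01: "\<mu> t \<in> {0..1}" using continuous_map_funspace[OF \<mu>(1)] t by auto
    have e'C: "e' t \<in> C" unfolding e'_def using C'(3) w(2)[OF t] eC(1)[OF t] \<mu>01 unfolding convex_in_prod_mix by blast
    then have e'Y: "e' t \<in> topspace Y" using C'(4) by blast
    have "pdist (e' t) (mix (\<mu> t) (e t) (e t)) \<le> pdist (w t) (e t)"
      unfolding e'_def using \<mu>01 P.zero[OF eC(2)[OF t] eC(2)[OF t]] pdist_nonneg by (intro pdist_mix_le) auto
    then have close: "pdist (e' t) (e t) < \<delta>" using w(3)[OF t] mix_same[OF eC(2)[OF t]] by simp
    have "pdist (e' t) c \<le> pdist (e' t) (e t) + pdist (e t) c" using P.triangle e'Y eC(2)[OF t] cY by blast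
    then have "pdist (e' t) c < a" using close eC(3)[OF t] \<delta>(3) by linarith
    moreover have "e' t \<notin> F"
    proof (cases "t \<in> N")
      case True
      then obtain t' where t': "t' \<in> ?bd" "pdist (e t') (e t) < \<delta>" unfolding N_def by auto
      have t'Y: "e t' \<in> topspace Y" using eC(2) t'(1) cell_boundary_subset by blast
      have "pdist (e t') (e' t) \<le> pdist (e t') (e t) + pdist (e t) (e' t)"
        using P.triangle t'Y e'Y eC(2)[OF t] by blast
      then have "pdist (e t') (e' t) < \<epsilon>" using t'(2) close \<delta>(2) P.commute[of "e t" "e' t"] by linarith
      then show ?thesis using \<epsilon>(2)[of "e t'" "e' t"] e(3)[OF t'(1)] t'(1) e'Y by auto
    next
      case False
      then have "\<mu> t = 0" using \<mu>(2) t by auto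
      then have "e' t = w t" unfolding e'_def using mix_0 w(2)[OF t] C'(4) by auto
      then show ?thesis using w(2,4)[OF t] FS by auto
    qed
    ultimately show ?thesis using e'C by blast
  qed
  moreover have "e' t = b t" if t: "t \<in> ?bd" for t
  proof -
    have "\<mu> t = 1" using \<mu>(3) t by auto
    moreover have "e t \<in> topspace Y" using eC(2) t cell_boundary_subset by blast
    ultimately show ?thesis unfolding e'_def using mix_1 e(3)[OF t] by simp
  qed
  ultimately show ?thesis by blast
qed

end

section \<open>The fine topology\<close>

text \<open>Openness in the product gives a constant radius near each point, half of it being spent
  on the movement of \<open>f\<close>; \<open>paracompact_positive_function\<close> joins these
  constants. Open sets around a graph thus become fine neighbourhoods.\<close>

lemma graph_neighbourhood:
  assumes X: "paracompact_space X" and f: "continuous_map X (mtopology_of m) f"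
    and O: "openin (prod_topology X (mtopology_of m)) O'"
    and graph: "\<And>x. x \<in> topspace X \<Longrightarrow> (x, f x) \<in> O'"
  obtains \<beta> where "\<beta> \<in> pos_cmaps X"
    "\<And>x y. x \<in> topspace X \<Longrightarrow> y \<in> mspace m \<Longrightarrow> mdist m y (f x) < \<beta> x \<Longrightarrow> (x, y) \<in> O'"
proof -
  interpret M: Metric_space "mspace m" "mdist m" by (rule Metric_space_mspace_mdist)
  let ?P = "\<lambda>x e. \<forall>y\<in>mspace m. mdist m y (f x) < e \<longrightarrow> (x, y) \<in> O'"
  have fm: "f x \<in> mspace m" if "x \<in> topspace X" for x
    using continuous_map_funspace[OF f] that by auto
  have loc: "\<exists>W e. openin X W \<and> x0 \<in> W \<and> 0 < e \<and> (\<forall>x\<in>W. ?P x e)" if x0: "x0 \<in> topspace X" for x0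
  proof -
    obtain U V where UV: "openin X U" "openin (mtopology_of m) V" "x0 \<in> U" "f x0 \<in> V" "U \<times> V \<subseteq> O'"
      using O[unfolded openin_prod_topology_alt, rule_format, OF graph[OF x0]] by blast
    obtain r where r: "0 < r" "M.mball (f x0) r \<subseteq> V"
      using UV(2,4) unfolding mtopology_of_def M.openin_mtopology by blast
    let ?W = "U \<inter> {x\<in>topspace X. f x \<in> M.mball (f x0) (r/2)}"
    have "openin (mtopology_of m) (M.mball (f x0) (r/2))" by (simp add: mtopology_of_def)
    then have "openin X {x\<in>topspace X. f x \<in> M.mball (f x0) (r/2)}"
      by (rule openin_continuous_map_preimage[OF f])
    then have "openin X ?W" using UV(1) by blast
    moreover have "x0 \<in> ?W" using x0 UV(3) r(1) fm by simp
    moreover have "(x, y) \<in> O'" if x: "x \<in> ?W" and y: "y \<in> mspace m" "mdist m y (f x) < r/2" for x y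
    proof -
      have "mdist m (f x0) y \<le> mdist m (f x0) (f x) + mdist m (f x) y"
        using M.triangle[of "f x0" "f x" y] fm x0 x y(1) by blast
      then have "mdist m (f x0) y < r" using x y(2) M.commute[of y "f x"] by auto
      then have "y \<in> M.mball (f x0) r" using y(1) fm[OF x0] by simp
      then have "y \<in> V" using r(2) by blast
      then show ?thesis using UV(5) x by blast
    qed
    ultimately show ?thesis using r(1) by (intro exI[of _ ?W] exI[of _ "r/2"]) auto
  qed
  show ?thesis
  proof (rule paracompact_positive_function[of X ?P, OF X loc])
    show "?P x e'" if "?P x e" "0 < e'" "e' \<le> e" for x e e' using that by auto
    fix \<beta> assume "\<beta> \<in> pos_cmaps X" "\<And>x. x \<in> topspace X \<Longrightarrow> ?P x (\<beta> x)"
    then show thesis by (intro that[of \<beta>]) auto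
  qed
qed

lemma openin_dist_less_function:
  assumes f: "continuous_map X (mtopology_of m) f" and \<alpha>: "continuous_map X euclideanreal \<alpha>"
  shows "openin (prod_topology X (mtopology_of m))
    {p \<in> topspace (prod_topology X (mtopology_of m)). mdist m (snd p) (f (fst p)) < \<alpha> (fst p)}"
proof -
  let ?P = "prod_topology X (mtopology_of m)"
  have 1: "continuous_map ?P (mtopology_of m) (\<lambda>p. f (fst p))"
    using continuous_map_compose[OF continuous_map_fst f] by (simp add: o_def)
  have 2: "continuous_map ?P euclideanreal (\<lambda>p. \<alpha> (fst p))"
    using continuous_map_compose[OF continuous_map_fst \<alpha>] by (simp add: o_def)
  have "continuous_map ?P euclideanreal (\<lambda>p. \<alpha> (fst p) - mdist m (snd p) (f (fst p)))"
    by (intro continuous_map_diff 2 continuous_map_mdist continuous_map_snd 1)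
  then have "openin ?P {p \<in> topspace ?P. \<alpha> (fst p) - mdist m (snd p) (f (fst p)) \<in> {0<..}}"
    by (rule openin_continuous_map_preimage) auto
  then show ?thesis by (simp add: less_diff_eq)
qed

text \<open>The \<open>\<alpha>\<close>-tube of \<open>f\<close> for \<open>m\<close> is an open set
  around the graph, which is a condition on the topology alone, so it contains a tube for
  \<open>m'\<close>.\<close>

lemma fine_nbhd_compare:
  assumes X: "paracompact_space X" and top: "mtopology_of m = mtopology_of m'"
    and f: "f \<in> cmaps X (mtopology_of m)" and \<alpha>: "\<alpha> \<in> pos_cmaps X"
  shows "\<exists>\<beta>\<in>pos_cmaps X. fine_nbhd X m' f \<beta> \<subseteq> fine_nbhd X m f \<alpha>"
proof -
  have fc: "continuous_map X (mtopology_of m) f" using f unfolding cmaps_def by blast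
  have fm: "f x \<in> mspace m" if "x \<in> topspace X" for x
    using continuous_map_funspace[OF fc] that by auto
  let ?O = "{p \<in> topspace (prod_topology X (mtopology_of m)). mdist m (snd p) (f (fst p)) < \<alpha> (fst p)}"
  have "openin (prod_topology X (mtopology_of m')) ?O"
    using openin_dist_less_function[OF fc, of \<alpha>] \<alpha> unfolding pos_cmaps_def top by blast
  moreover have "(x, f x) \<in> ?O" if "x \<in> topspace X" for x
    using that fm[OF that] \<alpha> unfolding pos_cmaps_def
    by (simp add: Metric_space.mdist_zero[OF Metric_space_mspace_mdist])
  moreover have "continuous_map X (mtopology_of m') f" using fc top by simp
  ultimately obtain \<beta> where \<beta>: "\<beta> \<in> pos_cmaps X"
    "\<And>x y. x \<in> topspace X \<Longrightarrow> y \<in> mspace m' \<Longrightarrow> mdist m' y (f x) < \<beta> x \<Longrightarrow> (x, y) \<in> ?O"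
    using graph_neighbourhood[OF X, of m' f ?O] by blast
  have "fine_nbhd X m' f \<beta> \<subseteq> fine_nbhd X m f \<alpha>"
  proof
    fix g assume g: "g \<in> fine_nbhd X m' f \<beta>"
    then have gc: "g \<in> cmaps X (mtopology_of m')" unfolding fine_nbhd_def by blast
    have "mdist m (g x) (f x) < \<alpha> x" if x: "x \<in> topspace X" for x
    proof -
      have "continuous_map X (mtopology_of m') g" using gc unfolding cmaps_def by blast
      then have "g x \<in> mspace m'" using continuous_map_funspace[of X "mtopology_of m'" g] x by auto
      moreover have "mdist m' (g x) (f x) < \<beta> x" using g x unfolding fine_nbhd_def by blast
      ultimately have "(x, g x) \<in> ?O" using \<beta>(2)[OF x] by blast
      then show ?thesis by simp
    qed
    then show "g \<in> fine_nbhd X m f \<alpha>" using gc top unfolding fine_nbhd_def by simp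
  qed
  then show ?thesis using \<beta>(1) by blast
qed

lemma fine_topology_metric_independent:
  assumes X: "paracompact_space X" and top: "mtopology_of m = mtopology_of m'"
  shows "fine_topology X m = fine_topology X m'"
proof -
  have "openin (fine_topology X m') W" if W: "openin (fine_topology X m) W"
    and top: "mtopology_of m = mtopology_of m'" for W and m m' :: "'b metric"
    unfolding openin_fine_topology
  proof (intro conjI ballI)
    show "W \<subseteq> cmaps X (mtopology_of m')" using W top unfolding openin_fine_topology by simp
    fix f assume f: "f \<in> W"
    then obtain \<alpha> where "\<alpha> \<in> pos_cmaps X" "fine_nbhd X m f \<alpha> \<subseteq> W"
      using W unfolding openin_fine_topology by blast
    moreover have "f \<in> cmaps X (mtopology_of m)" using f W unfolding openin_fine_topology by blast
    ultimately show "\<exists>\<alpha>\<in>pos_cmaps X. fine_nbhd X m' f \<alpha> \<subseteq> W"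
      using fine_nbhd_compare[OF X top, of f \<alpha>] by blast
  qed
  from this[OF _ top] this[OF _ top[symmetric]] show ?thesis unfolding topology_eq by blast
qed

section \<open>Baire property of the selections; density and openness of avoidance\<close>

context banach_product
begin

definition close_selections :: "'x topology \<Rightarrow> ('x \<Rightarrow> ('i \<Rightarrow> 'b) set) \<Rightarrow> ('x \<Rightarrow> 'i \<Rightarrow> 'b) \<Rightarrow> ('x \<Rightarrow> real) \<Rightarrow> ('x \<Rightarrow> 'i \<Rightarrow> 'b) set" where
  "close_selections X \<phi> f \<alpha> = {g \<in> selections X Y \<phi>. \<forall>x\<in>topspace X. pdist (g x) (f x) < \<alpha> x}"

lemma selectionsD:
  assumes "f \<in> selections X Y \<phi>"
  shows "continuous_map X Y f" "\<And>x. x \<in> topspace X \<Longrightarrow> f x \<in> \<phi> x" "\<And>x. x \<in> topspace X \<Longrightarrow> f x \<in> topspace Y"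
proof -
  show c: "continuous_map X Y f" using assms unfolding selections_def cmaps_def by blast
  show "\<And>x. x \<in> topspace X \<Longrightarrow> f x \<in> \<phi> x" using assms unfolding selections_def by blast
  show "\<And>x. x \<in> topspace X \<Longrightarrow> f x \<in> topspace Y" using continuous_map_funspace[OF c] by auto
qed

lemma restrict_in_selections:
  assumes "continuous_map X Y f" "\<And>x. x \<in> topspace X \<Longrightarrow> f x \<in> \<phi> x"
  shows "restrict f (topspace X) \<in> selections X Y \<phi>"
proof -
  have "continuous_map X Y (restrict f (topspace X))"
    using assms(1) by (rule continuous_map_eq) simp
  then show ?thesis using assms(2) unfolding selections_def cmaps_def by simp
qed

text \<open>Nested closed tubes with radius functions bounded by \<open>(1/2)^j\<close> have
  uniformly Cauchy centres; completeness of \<open>pdist\<close> gives a continuous limit, and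
  closed values keep it a selection. The limit lies in all the tubes, and the tube chosen at step
  \<open>j\<close> lies in \<open>D j\<close>.\<close>

lemma selections_Baire:
  fixes D :: "nat \<Rightarrow> ('x \<Rightarrow> 'i \<Rightarrow> 'b) set"
  assumes cl: "\<And>x. x \<in> topspace X \<Longrightarrow> closedin Y (\<phi> x)"
    and op: "\<And>j g. g \<in> D j \<Longrightarrow> \<exists>\<beta>\<in>pos_cmaps X. close_selections X \<phi> g \<beta> \<subseteq> D j"
    and dense: "\<And>j f \<alpha>. f \<in> selections X Y \<phi> \<Longrightarrow> \<alpha> \<in> pos_cmaps X \<Longrightarrow> D j \<inter> close_selections X \<phi> f \<alpha> \<noteq> {}"
    and f0: "f0 \<in> selections X Y \<phi>" and \<alpha>0: "\<alpha>0 \<in> pos_cmaps X"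
  shows "(\<Inter>j. D j) \<inter> close_selections X \<phi> f0 \<alpha>0 \<noteq> {}"
proof -
  let ?Sel = "selections X Y \<phi>"
  \<comment> \<open>A state is a centre with a radius function. Halving \<open>\<alpha>0\<close> at
    the start turns the weak estimate for the limit into the strict one of
    \<open>close_selections\<close>.\<close>
  let ?P = "\<lambda>j p. fst p \<in> ?Sel \<and> snd p \<in> pos_cmaps X \<and> (\<forall>x\<in>topspace X. snd p x \<le> (1/2)^j)
     \<and> (j = 0 \<longrightarrow> fst p = f0 \<and> (\<forall>x\<in>topspace X. snd p x \<le> \<alpha>0 x / 2))"
  \<comment> \<open>The centre moves by less than half the radius and the radius is at least halved,
    so the closed tubes are nested; the second part puts the new closed tube into
    \<open>D j\<close>.\<close>
  let ?Q = "\<lambda>j p p'. (\<forall>x\<in>topspace X. pdist (fst p' x) (fst p x) < snd p x / 2 \<and> snd p' x \<le> snd p x / 2)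
     \<and> (\<forall>h\<in>?Sel. (\<forall>x\<in>topspace X. pdist (h x) (fst p' x) \<le> snd p' x) \<longrightarrow> h \<in> D j)"
  have posD: "continuous_map X euclideanreal \<alpha>" "\<And>x. x \<in> topspace X \<Longrightarrow> 0 < \<alpha> x" if "\<alpha> \<in> pos_cmaps X" for \<alpha>
    using that unfolding pos_cmaps_def by blast+
  have posI: "\<alpha> \<in> pos_cmaps X"
    if "continuous_map X euclideanreal \<alpha>" "\<And>x. x \<in> topspace X \<Longrightarrow> 0 < \<alpha> x" for \<alpha>
    using that unfolding pos_cmaps_def by blast
  have "(\<lambda>x. min 1 (\<alpha>0 x / 2)) \<in> pos_cmaps X"
    using posD[OF \<alpha>0] by (intro posI continuous_map_real_min continuous_map_real_divide) auto
  then have 0: "\<exists>p. ?P 0 p" using f0 by (intro exI[of _ "(f0, \<lambda>x. min 1 (\<alpha>0 x / 2))"]) auto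
  have step: "\<exists>p'. ?P (Suc j) p' \<and> ?Q j p p'" if p: "?P j p" for j p
  proof -
    obtain f \<alpha> where fa: "p = (f, \<alpha>)" by (cases p)
    then have f: "f \<in> ?Sel" and \<alpha>: "\<alpha> \<in> pos_cmaps X" and \<alpha>j: "\<And>x. x \<in> topspace X \<Longrightarrow> \<alpha> x \<le> (1/2)^j"
      using p by auto
    have \<alpha>2: "(\<lambda>x. \<alpha> x / 2) \<in> pos_cmaps X"
      using posD[OF \<alpha>] by (intro posI continuous_map_real_divide) auto
    then obtain g where g: "g \<in> D j" "g \<in> close_selections X \<phi> f (\<lambda>x. \<alpha> x / 2)" using dense[OF f \<alpha>2, of j] by blast
    obtain \<beta> where \<beta>: "\<beta> \<in> pos_cmaps X" "close_selections X \<phi> g \<beta> \<subseteq> D j" using op[OF g(1)] by blast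
    \<comment> \<open>Half of \<open>\<beta>\<close> makes the closed tube of radius
      \<open>\<gamma>\<close> lie in the open one of radius \<open>\<beta>\<close>.\<close>
    define \<gamma> where "\<gamma> = (\<lambda>x. min (\<alpha> x / 2) (\<beta> x / 2))"
    have \<gamma>: "\<gamma> \<in> pos_cmaps X" unfolding \<gamma>_def
      using posD[OF \<alpha>] posD[OF \<beta>(1)] by (intro posI continuous_map_real_min continuous_map_real_divide) auto
    have "h \<in> D j" if "h \<in> ?Sel" "\<forall>x\<in>topspace X. pdist (h x) (g x) \<le> \<gamma> x" for h
    proof -
      have "pdist (h x) (g x) < \<beta> x" if x: "x \<in> topspace X" for x
      proof -
        have "pdist (h x) (g x) \<le> \<gamma> x" using \<open>\<forall>x\<in>topspace X. _\<close> x by blast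
        then show ?thesis using posD(2)[OF \<beta>(1) x] unfolding \<gamma>_def by linarith
      qed
      then show ?thesis using that(1) \<beta>(2) unfolding close_selections_def by blast
    qed
    moreover have "\<gamma> x \<le> (1/2)^Suc j" "\<gamma> x \<le> \<alpha> x / 2" if "x \<in> topspace X" for x
      using \<alpha>j[OF that] unfolding \<gamma>_def by auto
    ultimately show ?thesis
      using g(2) \<gamma> unfolding fa close_selections_def by (intro exI[of _ "(g, \<gamma>)"]) auto
  qed
  have "\<exists>p. \<forall>j. ?P j (p j) \<and> ?Q j (p j) (p (Suc j))"
    using 0 step by (rule dependent_nat_choice)
  then obtain p where p: "\<forall>j. ?P j (p j) \<and> ?Q j (p j) (p (Suc j))" by (rule exE)
  define f where "f = (\<lambda>j. fst (p j))"
  define \<alpha> where "\<alpha> = (\<lambda>j. snd (p j))"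
  have P: "?P j (f j, \<alpha> j)" and Q: "?Q j (f j, \<alpha> j) (f (Suc j), \<alpha> (Suc j))" for j
    using p[rule_format, of j] unfolding f_def \<alpha>_def prod.collapse by (rule conjunct1, rule conjunct2)
  have fSel: "f j \<in> ?Sel" for j using P[of j] by simp
  note fY = selectionsD(3)[OF fSel]
  have \<alpha>pos: "0 < \<alpha> j x" if "x \<in> topspace X" for j x using P[of j] posD(2) that by simp
  have \<alpha>le: "\<alpha> j x \<le> (1/2)^j" if "x \<in> topspace X" for j x using P[of j] that by simp
  have nest: "pdist (f j x) (f (j + k) x) \<le> \<alpha> j x - \<alpha> (j + k) x" if x: "x \<in> topspace X" for j k x
  proof (induction k)
    case 0 show ?case using fY[OF x, of j] by simp
  next
    case (Suc k)
    have "pdist (f j x) (f (Suc (j + k)) x) \<le> pdist (f j x) (f (j + k) x) + pdist (f (j + k) x) (f (Suc (j + k)) x)"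
      using P.triangle fY[OF x] by blast
    moreover have "pdist (f (Suc (j + k)) x) (f (j + k) x) < \<alpha> (j + k) x / 2" "\<alpha> (Suc (j + k)) x \<le> \<alpha> (j + k) x / 2"
      using Q[of "j + k"] x by auto
    ultimately show ?case
      using Suc.IH P.commute[of "f (Suc (j + k)) x" "f (j + k) x"] by simp
  qed
  have nest': "pdist (f j x) (f m x) \<le> \<alpha> j x" if "x \<in> topspace X" "j \<le> m" for j m x
    using nest[OF that(1), of j "m - j"] \<alpha>pos[OF that(1), of m] that(2) by simp
  have cau: "\<exists>N. \<forall>m n x. N \<le> m \<longrightarrow> N \<le> n \<longrightarrow> x \<in> topspace X \<longrightarrow> pdist (f m x) (f n x) < \<epsilon>" if e: "\<epsilon> > 0" for \<epsilon>
  proof -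
    obtain N where N: "(1/2::real)^N < \<epsilon> / 2" using real_arch_pow_inv[of "\<epsilon>/2" "1/2"] e by auto
    have "pdist (f m x) (f n x) < \<epsilon>" if "N \<le> m" "N \<le> n" "x \<in> topspace X" for m n x
      using P.triangle[of "f m x" "f N x" "f n x", OF fY[OF that(3)] fY[OF that(3)] fY[OF that(3)]]
        nest'[OF that(3,1)] nest'[OF that(3,2)] \<alpha>le[OF that(3), of N] N P.commute[of "f m x" "f N x"] by linarith
    then show ?thesis by blast
  qed
  have fc: "\<forall>\<^sub>F n in sequentially. continuous_map X P.mtopology (f n)"
    using selectionsD(1)[OF fSel] by (simp add: mtopology_pdist)
  obtain g where g: "continuous_map X P.mtopology g"
    "\<And>\<epsilon>. 0 < \<epsilon> \<Longrightarrow> \<forall>\<^sub>F n in sequentially. \<forall>x\<in>topspace X. pdist (f n x) (g x) < \<epsilon>"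
    by (rule P.continuous_map_uniformly_Cauchy_limit[OF mcomplete_pdist fc cau]) (iprover intro: that)+
  have gY: "g x \<in> topspace Y" if "x \<in> topspace X" for x
    using continuous_map_funspace[OF g(1)] that by auto
  have near: "\<exists>m\<ge>j. pdist (f m x) (g x) < \<epsilon>" if "x \<in> topspace X" "\<epsilon> > 0" for x \<epsilon> j
  proof -
    obtain N where "\<forall>m\<ge>N. \<forall>x\<in>topspace X. pdist (f m x) (g x) < \<epsilon>"
      using g(2)[OF \<open>\<epsilon> > 0\<close>] unfolding eventually_sequentially ..
    then have "pdist (f (max j N) x) (g x) < \<epsilon>" using \<open>x \<in> topspace X\<close> by simp
    then show ?thesis by (intro exI[of _ "max j N"]) simp
  qed
  have fg: "pdist (f j x) (g x) \<le> \<alpha> j x" if x: "x \<in> topspace X" for j x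
  proof (rule field_le_epsilon)
    fix \<epsilon> :: real assume "\<epsilon> > 0"
    then obtain m where m: "m \<ge> j" "pdist (f m x) (g x) < \<epsilon>" using near[OF x] by blast
    have "pdist (f j x) (g x) \<le> pdist (f j x) (f m x) + pdist (f m x) (g x)"
      using P.triangle fY[OF x] gY[OF x] by blast
    then show "pdist (f j x) (g x) \<le> \<alpha> j x + \<epsilon>" using m(2) nest'[OF x m(1)] by linarith
  qed
  have g\<phi>: "g x \<in> \<phi> x" if x: "x \<in> topspace X" for x
  proof -
    have "\<exists>y\<in>\<phi> x. y \<in> P.mball (g x) r" if r: "r > 0" for r
    proof -
      obtain m where "pdist (f m x) (g x) < r" using near[OF x r] by blast
      then have "f m x \<in> P.mball (g x) r" using fY[OF x] gY[OF x] by (simp add: P.commute)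
      then show ?thesis using selectionsD(2)[OF fSel x] by blast
    qed
    then have "g x \<in> P.mtopology closure_of \<phi> x" unfolding P.metric_closure_of using gY[OF x] by blast
    then show ?thesis using closure_of_closedin[OF cl[OF x]] by (simp add: mtopology_pdist)
  qed
  define h where "h = restrict g (topspace X)"
  have hSel: "h \<in> ?Sel"
    unfolding h_def using g(1) g\<phi> by (intro restrict_in_selections) (auto simp: mtopology_pdist)
  have hf: "pdist (h x) (f j x) \<le> \<alpha> j x" if "x \<in> topspace X" for j x
    using fg[OF that, of j] that by (simp add: h_def P.commute)
  have "h \<in> D j" for j
    using Q[of j] hSel hf[of _ "Suc j"] by simp
  moreover have "pdist (h x) (f0 x) < \<alpha>0 x" if x: "x \<in> topspace X" for x
  proof -
    have "f 0 = f0" "\<alpha> 0 x \<le> \<alpha>0 x / 2" using P[of 0] x by auto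
    then show ?thesis using hf[OF x, of 0] posD(2)[OF \<alpha>0 x] by simp
  qed
  ultimately show ?thesis using hSel unfolding close_selections_def by blast
qed

text \<open>The selection found over \<open>A\<close> inside the tube around \<open>f\<close> is
  extended to \<open>X\<close> without control of its distance to \<open>f\<close>. Convexity of
  values and balls repairs this: blending with \<open>f\<close> by a Urysohn function that is 1 on
  \<open>A\<close> and 0 where the extension leaves the tube gives a selection close to
  \<open>f\<close> everywhere.\<close>

lemma selection_avoiding_dense:
  fixes X :: "'x topology"
  assumes X: "paracompact_space X" and A: "closedin X A" and dim: "covering_dim_le (subtopology X A) n"
    and cc: "\<And>x. x \<in> topspace X \<Longrightarrow> \<phi> x \<in> closed_convex_sets I E"
    and lsc: "lower_semicontinuous X Y \<phi>"
    and F: "closedin (prod_topology X Y) F"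
    and S: "\<And>x. x \<in> A \<Longrightarrow> sigma_Zn_set n (subtopology Y (\<phi> x)) (S x)"
    and FS: "\<And>x y. x \<in> A \<Longrightarrow> y \<in> \<phi> x \<Longrightarrow> (x, y) \<in> F \<Longrightarrow> y \<in> S x"
    and f: "f \<in> selections X Y \<phi>" and \<alpha>: "\<alpha> \<in> pos_cmaps X"
  shows "\<exists>g\<in>close_selections X \<phi> f \<alpha>. \<forall>x\<in>A. (x, g x) \<notin> F"
proof -
  note f' = selectionsD[OF f]
  have AX: "A \<subseteq> topspace X" using closedin_subset[OF A] .
  let ?Z = "subtopology X A"
  have topZ: "topspace ?Z = A" using AX by auto
  have \<alpha>c: "continuous_map X euclideanreal \<alpha>" and \<alpha>0: "\<And>x. x \<in> topspace X \<Longrightarrow> 0 < \<alpha> x"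
    using \<alpha> unfolding pos_cmaps_def by blast+
  have fm: "continuous_map X (mtopology_of P.Self) f" using f'(1) by (simp add: mtopology_of_Self)
  define \<Omega>0 where "\<Omega>0 = {p \<in> topspace (prod_topology X Y). pdist (snd p) (f (fst p)) < \<alpha> (fst p)} - F"
  have "openin (prod_topology X Y) \<Omega>0"
    unfolding \<Omega>0_def using openin_dist_less_function[OF fm \<alpha>c] F by (simp add: mtopology_of_Self openin_diff)
  then have "openin (subtopology (prod_topology X Y) (A \<times> topspace Y)) (\<Omega>0 \<inter> A \<times> topspace Y)"
    by (rule openin_subtopology_Int)
  then have \<Omega>: "openin (prod_topology ?Z Y) (\<Omega>0 \<inter> A \<times> topspace Y)"
    by (simp add: subtopology_Times)
  interpret S: cell_selection I E ?Z \<phi> "\<Omega>0 \<inter> A \<times> topspace Y" n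
  proof
    show "paracompact_space ?Z" by (rule paracompact_space_closed_subtopology[OF X A])
    show "lower_semicontinuous ?Z Y \<phi>" using lsc by (rule lower_semicontinuous_subtopology)
    show "\<phi> x \<in> closed_convex_sets I E" if "x \<in> topspace ?Z" for x using cc that by simp
    show "openin (prod_topology ?Z Y) (\<Omega>0 \<inter> A \<times> topspace Y)" by (rule \<Omega>)
    fix x and s :: "(nat \<times> 'x) set" and b
    assume x: "x \<in> topspace ?Z" and s: "finite s" "card s \<le> n"
      and b: "continuous_map (subtopology R_UNIV (cell_boundary s)) Y b"
      and b\<Omega>: "\<And>t. t \<in> cell_boundary s \<Longrightarrow> b t \<in> \<phi> x \<and> (x, b t) \<in> \<Omega>0 \<inter> A \<times> topspace Y"
    have xA: "x \<in> A" "x \<in> topspace X" using x by auto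
    note \<phi>x = closed_convex_setsD[OF cc[OF xA(2)]]
    define Fx where "Fx = {y\<in>topspace Y. (x, y) \<in> F}"
    have "continuous_map Y (prod_topology X Y) (\<lambda>y. (x, y))"
      using xA(2) by (simp add: continuous_map_paired)
    then have Fx: "closedin Y Fx"
      unfolding Fx_def by (rule closedin_continuous_map_preimage[OF _ F])
    have in\<Omega>: "(x, y) \<in> \<Omega>0 \<inter> A \<times> topspace Y \<longleftrightarrow> pdist y (f x) < \<alpha> x \<and> y \<notin> Fx" if "y \<in> \<phi> x" for y
      using that xA \<phi>x(4) unfolding \<Omega>0_def Fx_def by auto
    have FxS: "Fx \<inter> \<phi> x \<subseteq> S x" unfolding Fx_def using FS[OF xA(1)] by blast
    have bP: "b t \<in> \<phi> x \<and> pdist (b t) (f x) < \<alpha> x \<and> b t \<notin> Fx" if "t \<in> cell_boundary s" for t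
      using b\<Omega>[OF that] in\<Omega> by blast
    obtain e where "continuous_map (subtopology R_UNIV (cone_cell s)) Y e"
      "\<forall>t\<in>cone_cell s. e t \<in> \<phi> x \<and> pdist (e t) (f x) < \<alpha> x \<and> e t \<notin> Fx" "\<forall>t\<in>cell_boundary s. e t = b t"
      using cell_extension_avoiding[OF cc[OF xA(2)] S[OF xA(1)] f'(2)[OF xA(2)] \<alpha>0[OF xA(2)] Fx FxS s b bP] by blast
    then show "\<exists>e. continuous_map (subtopology R_UNIV (cone_cell s)) Y e \<and>
            (\<forall>t\<in>cone_cell s. e t \<in> \<phi> x \<and> (x, e t) \<in> \<Omega>0 \<inter> A \<times> topspace Y) \<and> (\<forall>t\<in>cell_boundary s. e t = b t)"
      using in\<Omega> by (intro exI[of _ e]) auto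
  qed
  obtain g0 where g0: "continuous_map ?Z Y g0" "\<And>x. x \<in> topspace ?Z \<Longrightarrow> g0 x \<in> \<phi> x"
    "\<And>x. x \<in> topspace ?Z \<Longrightarrow> (x, g0 x) \<in> \<Omega>0 \<inter> A \<times> topspace Y"
    by (rule S.selection_in_open_graph[OF dim]) (iprover intro: that)+
  have g0\<phi>: "g0 x \<in> \<phi> x" if "x \<in> A" for x using g0(2) that AX by auto
  obtain g1 where g1: "continuous_map X Y g1" "\<And>x. x \<in> topspace X \<Longrightarrow> g1 x \<in> \<phi> x" "\<And>x. x \<in> A \<Longrightarrow> g1 x = g0 x"
    by (rule Michael_extension[OF X lsc cc A g0(1) g0\<phi>]) (iprover intro: that)+
  have g1Y: "g1 x \<in> topspace Y" if "x \<in> topspace X" for x using continuous_map_funspace[OF g1(1)] that by auto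
  have g1m: "continuous_map X (mtopology_of P.Self) g1" using g1(1) by (simp add: mtopology_of_Self)
  define N where "N = {x\<in>topspace X. \<alpha> x - pdist (g1 x) (f x) \<in> {0<..}}"
  have "continuous_map X euclideanreal (\<lambda>x. \<alpha> x - pdist (g1 x) (f x))"
    using continuous_map_diff[OF \<alpha>c continuous_map_mdist[OF g1m fm]] by simp
  then have N: "openin X N" unfolding N_def by (rule openin_continuous_map_preimage) auto
  have AN: "A \<subseteq> N" using g0(3) g1(3) topZ AX unfolding N_def \<Omega>0_def by auto
  have disj: "disjnt (topspace X - N) A" using AN by (auto simp: disjnt_def)
  have clN: "closedin X (topspace X - N)" using N by (rule openin_closedin_eq[THEN iffD1, THEN conjunct2])
  obtain \<mu> where \<mu>: "continuous_map X (top_of_set {0..1::real}) \<mu>" "\<mu> ` (topspace X - N) \<subseteq> {0}" "\<mu> ` A \<subseteq> {1}"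
    by (rule Urysohn_lemma[OF paracompact_imp_normal_space[OF X] clN A disj zero_le_one]) (iprover intro: that)
  define h where "h = (\<lambda>x. mix (\<mu> x) (f x) (g1 x))"
  have hc: "continuous_map X Y h"
    unfolding h_def using \<mu>(1) by (intro continuous_map_mix f'(1) g1(1)) (auto intro: continuous_map_into_fulltopology)
  have \<mu>01: "\<mu> x \<in> {0..1}" if "x \<in> topspace X" for x using continuous_map_funspace[OF \<mu>(1)] that by auto
  have h\<phi>: "h x \<in> \<phi> x" if x: "x \<in> topspace X" for x
    unfolding h_def using closed_convex_setsD(3)[OF cc[OF x]] f'(2)[OF x] g1(2)[OF x] \<mu>01[OF x]
    unfolding convex_in_prod_mix by blast
  have hf: "pdist (h x) (f x) < \<alpha> x" if x: "x \<in> topspace X" for x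
  proof (cases "x \<in> N")
    case True
    have "pdist (h x) (mix (\<mu> x) (f x) (f x)) \<le> pdist (g1 x) (f x)"
      unfolding h_def using \<mu>01[OF x] P.zero[OF f'(3)[OF x] f'(3)[OF x]] pdist_nonneg by (intro pdist_mix_le) auto
    then show ?thesis using True mix_same[OF f'(3)[OF x]] unfolding N_def by auto
  next
    case False
    then have "\<mu> x = 0" using \<mu>(2) x by auto
    then have "h x = f x" unfolding h_def using mix_0[OF f'(3)[OF x]] by simp
    then show ?thesis using \<alpha>0[OF x] f'(3)[OF x] by simp
  qed
  have hA: "(x, h x) \<notin> F" if x: "x \<in> A" for x
  proof -
    have "\<mu> x = 1" using \<mu>(3) x by auto
    then have "h x = g0 x" unfolding h_def using mix_1[OF g1Y[of x], of "f x"] g1(3)[OF x] x AX by auto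
    then show ?thesis using g0(3)[of x] x topZ unfolding \<Omega>0_def by auto
  qed
  have "restrict h (topspace X) \<in> close_selections X \<phi> f \<alpha>"
    unfolding close_selections_def using restrict_in_selections[OF hc h\<phi>] hf by simp
  moreover have "\<forall>x\<in>A. (x, restrict h (topspace X) x) \<notin> F" using hA AX by auto
  ultimately show ?thesis by blast
qed

text \<open>Cutting \<open>F\<close> down to the closed set \<open>A \<times> topspace Y\<close>
  makes avoidance over \<open>A\<close> a condition on the whole graph, to which
  \<open>graph_neighbourhood\<close> applies.\<close>

lemma selection_avoiding_open:
  assumes X: "paracompact_space X" and A: "closedin X A" and F: "closedin (prod_topology X Y) F"
    and g: "g \<in> selections X Y \<phi>" and gF: "\<And>x. x \<in> A \<Longrightarrow> (x, g x) \<notin> F"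
  shows "\<exists>\<beta>\<in>pos_cmaps X. \<forall>h\<in>close_selections X \<phi> g \<beta>. \<forall>x\<in>A. (x, h x) \<notin> F"
proof -
  have AX: "A \<subseteq> topspace X" using closedin_subset[OF A] .
  have "closedin (prod_topology X Y) (F \<inter> A \<times> topspace Y)"
    using F A by (intro closedin_Int) (auto simp: closedin_prod_Times_iff)
  then have O: "openin (prod_topology X (mtopology_of P.Self)) (topspace (prod_topology X Y) - F \<inter> A \<times> topspace Y)"
    unfolding mtopology_of_Self by blast
  have gc: "continuous_map X (mtopology_of P.Self) g" using selectionsD(1)[OF g] by (simp add: mtopology_of_Self)
  have graph: "(x, g x) \<in> topspace (prod_topology X Y) - F \<inter> A \<times> topspace Y" if "x \<in> topspace X" for x
    using that selectionsD(3)[OF g that] gF by auto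
  obtain \<beta> where \<beta>: "\<beta> \<in> pos_cmaps X"
    "\<And>x y. x \<in> topspace X \<Longrightarrow> y \<in> mspace P.Self \<Longrightarrow> mdist P.Self y (g x) < \<beta> x
      \<Longrightarrow> (x, y) \<in> topspace (prod_topology X Y) - F \<inter> A \<times> topspace Y"
    by (rule graph_neighbourhood[OF X gc O graph]) (iprover intro: that)+
  have "(x, h x) \<notin> F" if h: "h \<in> close_selections X \<phi> g \<beta>" and x: "x \<in> A" for h x
  proof -
    have "h \<in> selections X Y \<phi>" "pdist (h x) (g x) < \<beta> x" using h x AX unfolding close_selections_def by blast+
    then show ?thesis using \<beta>(2)[of x "h x"] selectionsD(3)[of h X \<phi> x] x AX by auto
  qed
  then show ?thesis using \<beta>(1) by blast
qed

text \<open>The open set of maps that cuts out \<open>W\<close> is a union of fine neighbourhoods,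
  with one radius function chosen for each member of \<open>W\<close>.\<close>

lemma openin_selections_fine:
  assumes "W \<subseteq> selections X Y \<phi>" and "\<And>f. f \<in> W \<Longrightarrow> \<exists>\<beta>\<in>pos_cmaps X. close_selections X \<phi> f \<beta> \<subseteq> W"
  shows "openin (subtopology (fine_topology X P.Self) (selections X Y \<phi>)) W"
proof -
  let ?\<beta> = "\<lambda>f. SOME \<beta>. \<beta> \<in> pos_cmaps X \<and> close_selections X \<phi> f \<beta> \<subseteq> W"
  have \<beta>: "?\<beta> f \<in> pos_cmaps X \<and> close_selections X \<phi> f (?\<beta> f) \<subseteq> W" if "f \<in> W" for f
    using someI_ex[of "\<lambda>\<beta>. \<beta> \<in> pos_cmaps X \<and> close_selections X \<phi> f \<beta> \<subseteq> W"] assms(2)[OF that] by blast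
  have cm: "selections X Y \<phi> \<subseteq> cmaps X (mtopology_of P.Self)" unfolding mtopology_of_Self selections_def by blast
  let ?O = "\<Union>f\<in>W. fine_nbhd X P.Self f (?\<beta> f)"
  have "openin (fine_topology X P.Self) ?O"
    using \<beta> assms(1) cm by (intro openin_Union) (auto intro!: openin_fine_nbhd)
  moreover have "?O \<inter> selections X Y \<phi> = W"
  proof
    have "fine_nbhd X P.Self f (?\<beta> f) \<inter> selections X Y \<phi> \<subseteq> close_selections X \<phi> f (?\<beta> f)" for f
      unfolding fine_nbhd_def close_selections_def by auto
    then have "fine_nbhd X P.Self f (?\<beta> f) \<inter> selections X Y \<phi> \<subseteq> W" if "f \<in> W" for f
      using order_trans conjunct2[OF \<beta>[OF that]] by blast
    then show "?O \<inter> selections X Y \<phi> \<subseteq> W" by fast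
    have "f \<in> fine_nbhd X P.Self f (?\<beta> f)" if f: "f \<in> W" for f
    proof -
      have fS: "f \<in> selections X Y \<phi>" using assms(1) f by blast
      have "0 < ?\<beta> f x" if "x \<in> topspace X" for x using \<beta>[OF f] that unfolding pos_cmaps_def by blast
      then show ?thesis using fS cm selectionsD(3)[OF fS] unfolding fine_nbhd_def by auto
    qed
    then show "W \<subseteq> ?O \<inter> selections X Y \<phi>" using assms(1) by blast
  qed
  ultimately show ?thesis unfolding openin_subtopology by (intro exI[of _ ?O] conjI) (assumption, rule sym)
qed

lemma selections_fine_dense:
  assumes "D \<subseteq> selections X Y \<phi>"
    and "\<And>f \<alpha>. f \<in> selections X Y \<phi> \<Longrightarrow> \<alpha> \<in> pos_cmaps X \<Longrightarrow> D \<inter> close_selections X \<phi> f \<alpha> \<noteq> {}"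
  shows "subtopology (fine_topology X P.Self) (selections X Y \<phi>) closure_of D = selections X Y \<phi>"
proof
  let ?T = "subtopology (fine_topology X P.Self) (selections X Y \<phi>)"
  have top: "topspace ?T = selections X Y \<phi>"
    unfolding topspace_subtopology topspace_fine_topology mtopology_of_Self selections_def by blast
  show "?T closure_of D \<subseteq> selections X Y \<phi>" using closure_of_subset_topspace[of ?T D] top by simp
  show "selections X Y \<phi> \<subseteq> ?T closure_of D"
  proof
    fix f assume f: "f \<in> selections X Y \<phi>"
    have "\<exists>g. g \<in> D \<and> g \<in> W" if W: "f \<in> W" "openin ?T W" for W
    proof -
      obtain O' where O: "openin (fine_topology X P.Self) O'" "W = O' \<inter> selections X Y \<phi>"
        using W(2) unfolding openin_subtopology by blast
      then obtain \<alpha> where \<alpha>: "\<alpha> \<in> pos_cmaps X" "fine_nbhd X P.Self f \<alpha> \<subseteq> O'"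
        using W(1) unfolding openin_fine_topology by blast
      obtain g where g: "g \<in> D" "g \<in> close_selections X \<phi> f \<alpha>" using assms(2)[OF f \<alpha>(1)] by blast
      have "g \<in> fine_nbhd X P.Self f \<alpha>"
        using g(2) unfolding close_selections_def fine_nbhd_def mtopology_of_Self selections_def by simp
      then show ?thesis using g \<alpha>(2) O(2) unfolding close_selections_def by blast
    qed
    then show "f \<in> ?T closure_of D" unfolding in_closure_of top using f by blast
  qed
qed

end

section \<open>The avoiding selections as a countable intersection of open dense sets\<close>

theorem theorem5p1:
  fixes X :: "'x topology"
    and A :: "nat \<Rightarrow> 'x set"
    and I :: "'i set"
    and E :: "'i \<Rightarrow> 'b::real_normed_vector set"
    and Y :: "('i \<Rightarrow> 'b) topology"
    and \<rho> :: "('i \<Rightarrow> 'b) metric"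
    and \<phi> :: "'x \<Rightarrow> ('i \<Rightarrow> 'b) set"
    and \<psi> :: "nat \<Rightarrow> 'x \<Rightarrow> ('i \<Rightarrow> 'b) set"
    and D :: "('x \<Rightarrow> 'i \<Rightarrow> 'b) set"
  assumes "paracompact_space X"
    and "\<And>n. closedin X (A n)"
    and "\<And>n. covering_dim_le (subtopology X (A n)) n"
    and "countable I"
    and "\<And>i. i \<in> I \<Longrightarrow> banach_subspace (E i)"
    and "Y = prod_space I E"
    and "mtopology_of \<rho> = Y"
    and "\<And>x. x \<in> topspace X \<Longrightarrow> \<phi> x \<in> closed_convex_sets I E"
    and "lower_semicontinuous X Y \<phi>"
    and "\<And>n x. x \<in> topspace X \<Longrightarrow> \<psi> n x \<subseteq> topspace Y"
    and "\<And>n. has_fsigma_graph X Y (\<psi> n)"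
    and "\<And>n x. x \<in> A n \<Longrightarrow> sigma_Zn_set n (subtopology Y (\<phi> x)) (\<psi> n x \<inter> \<phi> x)"
    and "D = {f \<in> selections X Y \<phi>. \<forall>n. \<forall>x\<in>A n. f x \<notin> \<psi> n x}"
  shows "subtopology (fine_topology X \<rho>) (selections X Y \<phi>) closure_of D = selections X Y \<phi>
    \<and> gdelta_in (subtopology (fine_topology X \<rho>) (selections X Y \<phi>)) D"
proof -
  interpret banach_product I E by unfold_locales (rule assms(4), rule assms(5))
  have X: "paracompact_space X" by (rule assms(1))
  have cc: "\<And>x. x \<in> topspace X \<Longrightarrow> \<phi> x \<in> closed_convex_sets I E" by (rule assms(8))
  have lsc: "lower_semicontinuous X (prod_space I E) \<phi>" using assms(9) unfolding assms(6) .
  have AX: "A n \<subseteq> topspace X" for n using assms(2) by (rule closedin_subset)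
  have fs: "fsigma_in (prod_topology X (prod_space I E))
     {(x, y). x \<in> topspace X \<and> y \<in> topspace (prod_space I E) \<and> y \<in> \<psi> n x}" for n
    using assms(11)[of n] unfolding has_fsigma_graph_def assms(6) .
  \<comment> \<open>The closed pieces of each graph are taken as a sequence, so that all conditions
    can later be enumerated.\<close>
  have "\<forall>n. \<exists>F. (\<forall>k::nat. closedin (prod_topology X (prod_space I E)) (F k)) \<and>
     \<Union>(range F) = {(x, y). x \<in> topspace X \<and> y \<in> topspace (prod_space I E) \<and> y \<in> \<psi> n x}"
  proof
    fix n
    obtain C where "(\<forall>k. closedin (prod_topology X (prod_space I E)) (C k)) \<and> (\<forall>k. C k \<subseteq> C (Suc k)) \<and>
     \<Union>(range C) = {(x, y). x \<in> topspace X \<and> y \<in> topspace (prod_space I E) \<and> y \<in> \<psi> n x}"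
      using fs[of n] unfolding fsigma_in_ascending ..
    then show "\<exists>F. (\<forall>k::nat. closedin (prod_topology X (prod_space I E)) (F k)) \<and>
     \<Union>(range F) = {(x, y). x \<in> topspace X \<and> y \<in> topspace (prod_space I E) \<and> y \<in> \<psi> n x}"
      by (elim conjE) (intro exI[of _ C] conjI)
  qed
  from choice[OF this] obtain F :: "nat \<Rightarrow> nat \<Rightarrow> ('x \<times> ('i \<Rightarrow> 'b)) set"
    where F: "\<forall>n. (\<forall>k. closedin (prod_topology X (prod_space I E)) (F n k)) \<and>
     \<Union>(range (F n)) = {(x, y). x \<in> topspace X \<and> y \<in> topspace (prod_space I E) \<and> y \<in> \<psi> n x}"
    ..
  have Fcl: "closedin (prod_topology X (prod_space I E)) (F n k)" for n k using F by blast
  have Fgraph: "(\<exists>k. (x, y) \<in> F n k) \<longleftrightarrow> y \<in> \<psi> n x"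
    if "x \<in> topspace X" "y \<in> topspace (prod_space I E)" for n x y
  proof -
    have "(x, y) \<in> \<Union>(range (F n)) \<longleftrightarrow> y \<in> \<psi> n x"
      using F[rule_format, THEN conjunct2, of n] that by simp
    then show ?thesis by blast
  qed
  let ?Sel = "selections X (prod_space I E) \<phi>"
  \<comment> \<open>\<open>prod_decode\<close> enumerates the pairs of a set \<open>A n\<close> and
    a closed piece \<open>F n k\<close>, since \<open>selections_Baire\<close> takes one sequence of
    conditions.\<close>
  define G where "G = (\<lambda>j. case prod_decode j of (n, k) \<Rightarrow> {f \<in> ?Sel. \<forall>x\<in>A n. (x, f x) \<notin> F n k})"
  have D: "D = (\<Inter>j. G j)"
  proof -
    have "f x \<notin> \<psi> n x \<longleftrightarrow> (\<forall>k. (x, f x) \<notin> F n k)" if "f \<in> ?Sel" "x \<in> A n" for f n x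
      using Fgraph[of x "f x" n] selectionsD(3)[OF that(1)] AX that(2) by blast
    then have "D = {f \<in> ?Sel. \<forall>n k. \<forall>x\<in>A n. (x, f x) \<notin> F n k}"
      unfolding assms(13) assms(6) by blast
    also have "\<dots> = (\<Inter>j. G j)"
    proof
      show "{f \<in> ?Sel. \<forall>n k. \<forall>x\<in>A n. (x, f x) \<notin> F n k} \<subseteq> (\<Inter>j. G j)"
        unfolding G_def by (auto split: prod.splits)
      show "(\<Inter>j. G j) \<subseteq> {f \<in> ?Sel. \<forall>n k. \<forall>x\<in>A n. (x, f x) \<notin> F n k}"
      proof
        fix f assume f: "f \<in> (\<Inter>j. G j)"
        have "f \<in> ?Sel \<and> (\<forall>x\<in>A n. (x, f x) \<notin> F n k)" for n k
        proof -
          have "f \<in> G (prod_encode (n, k))" using f by blast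
          then show ?thesis unfolding G_def by simp
        qed
        then show "f \<in> {f \<in> ?Sel. \<forall>n k. \<forall>x\<in>A n. (x, f x) \<notin> F n k}" by blast
      qed
    qed
    finally show ?thesis .
  qed
  have Gop: "\<exists>\<beta>\<in>pos_cmaps X. close_selections X \<phi> g \<beta> \<subseteq> G j" if g: "g \<in> G j" for j g
  proof -
    obtain n k where nk: "prod_decode j = (n, k)" by (cases "prod_decode j")
    then have "g \<in> ?Sel" "\<And>x. x \<in> A n \<Longrightarrow> (x, g x) \<notin> F n k" using g unfolding G_def by auto
    then obtain \<beta> where "\<beta> \<in> pos_cmaps X" "\<forall>h\<in>close_selections X \<phi> g \<beta>. \<forall>x\<in>A n. (x, h x) \<notin> F n k"
      using selection_avoiding_open[OF X assms(2) Fcl] by metis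
    then show ?thesis unfolding G_def nk close_selections_def by (intro bexI[of _ \<beta>]) auto
  qed
  have Gdense: "G j \<inter> close_selections X \<phi> f \<alpha> \<noteq> {}" if f: "f \<in> ?Sel" and \<alpha>: "\<alpha> \<in> pos_cmaps X" for j f \<alpha>
  proof -
    obtain n k where nk: "prod_decode j = (n, k)" by (cases "prod_decode j")
    have S: "sigma_Zn_set n (subtopology (prod_space I E) (\<phi> x)) (\<psi> n x \<inter> \<phi> x)" if "x \<in> A n" for x
      using assms(12)[OF that] unfolding assms(6) .
    have FS: "y \<in> \<psi> n x \<inter> \<phi> x" if "x \<in> A n" "y \<in> \<phi> x" "(x, y) \<in> F n k" for x y
    proof -
      have xX: "x \<in> topspace X" using AX that(1) by blast
      then have "y \<in> topspace (prod_space I E)" using closed_convex_setsD(4)[OF cc] that(2) by blast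
      then show ?thesis using Fgraph[OF xX, of y n] that by blast
    qed
    obtain g where "g \<in> close_selections X \<phi> f \<alpha>" "\<forall>x\<in>A n. (x, g x) \<notin> F n k"
      using selection_avoiding_dense[OF X assms(2,3) cc lsc Fcl S FS f \<alpha>] by blast
    then have "g \<in> G j \<inter> close_selections X \<phi> f \<alpha>" unfolding G_def nk close_selections_def by simp
    then show ?thesis by blast
  qed
  have GSel: "G j \<subseteq> ?Sel" for j unfolding G_def by (auto split: prod.splits)
  \<comment> \<open>\<open>\<rho>\<close> is an arbitrary compatible metric, while the arguments
    above use that \<open>pdist\<close> is complete with convex balls.\<close>
  have fine: "fine_topology X \<rho> = fine_topology X P.Self"
    by (rule fine_topology_metric_independent[OF X]) (simp add: assms(6,7) mtopology_of_Self)
  have "subtopology (fine_topology X P.Self) ?Sel closure_of (\<Inter>j. G j) = ?Sel"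
  proof (rule selections_fine_dense)
    show "(\<Inter>j. G j) \<subseteq> ?Sel" using GSel by blast
    show "(\<Inter>j. G j) \<inter> close_selections X \<phi> f \<alpha> \<noteq> {}" if "f \<in> ?Sel" "\<alpha> \<in> pos_cmaps X" for f \<alpha>
      by (rule selections_Baire[OF _ Gop Gdense that]) (rule closed_convex_setsD(2)[OF cc])
  qed
  moreover have "gdelta_in (subtopology (fine_topology X P.Self) ?Sel) (\<Inter>j. G j)"
    by (rule gdelta_in_Inter) (auto intro!: open_imp_gdelta_in openin_selections_fine GSel Gop)
  ultimately show ?thesis unfolding fine D assms(6) by blast
qed

end
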